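(* Let $\mathbb{T}^2$ be the $2$-torus. Up to isomorphism, $P_2(\mathbb{T}^2)$ may be written in the form $F(x,y)\oplus\mathbb{Z}\oplus\mathbb{Z}$, and relative to this identification (and to an identification of $\pi_1(\mathbb{T}^2)$ with $\mathbb{Z}\oplus\mathbb{Z}$): (a) the homomorphism $(p_1)_\#:P_2(\mathbb{T}^2)\to\pi_1(\mathbb{T}^2)$ is projection onto the group $\mathbb{Z}\oplus\mathbb{Z}$, in other words, $(p_1)_\#(w,m,n)=(m,n)$ for all $w\in F(x,y)$ and $m,n\in\mathbb{Z}$. (b) the element $\sigma$ belongs to $B_2(\mathbb{T}^2)\setminus P_2(\mathbb{T}^2)$ and satisfies $\sigma^2=(B,0,0)$, where $B=[x,y^{-1}]$. (c) the images of the generators of $P_2(\mathbb{T}^2)$ under the homomorphism $l_\sigma:P_2(\mathbb{T}^2)\to P_2(\mathbb{T}^2)$ given by conjugating by $\sigma$ are as follows: $$l_\sigma(x,0,0)=(Bx^{-1},1,0),\quad l_\sigma(y,0,0)=(By^{-1},0,1),\quad l_\sigma(\mathbb{1},1,0)=(\mathbb{1},1,0),\quad l_\sigma(\mathbb{1},0,1)=(\mathbb{1},0,1),$$ where $\mathbb{1}$ denotes the trivial element of $F(x,y)$.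
   Context: $F(x,y)$ is the free group on $\{x,y\}$, and $[a,b]=aba^{-1}b^{-1}$. $F_2(\mathbb{T}^2)=\{(y_1,y_2)\in\mathbb{T}^2\times\mathbb{T}^2\mid y_1\ne y_2\}$, and $D_2(\mathbb{T}^2)$ is its quotient by the free involution $(y_1,y_2)\mapsto(y_2,y_1)$. $P_2(\mathbb{T}^2)=\pi_1(F_2(\mathbb{T}^2))$ (pure $2$-string braid group) is regarded as an index-$2$ subgroup of $B_2(\mathbb{T}^2)=\pi_1(D_2(\mathbb{T}^2))$ (full $2$-string braid group) via the double covering $F_2(\mathbb{T}^2)\to D_2(\mathbb{T}^2)$. The map $p_1:F_2(\mathbb{T}^2)\to\mathbb{T}^2$ is projection onto the first coordinate. $\sigma\in B_2(\mathbb{T}^2)$ is the standard generator that swaps the two base points (the half-twist in a disc containing both base points), and $l_\sigma(g)=\sigma g\sigma^{-1}$. *)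

theory Defs
  imports "HOL-Analysis.Analysis" "HOL-Algebra.Elementary_Groups"
begin

section \<open>Quotient topology\<close>

definition quotient_topology :: "'a topology \<Rightarrow> ('a \<Rightarrow> 'b) \<Rightarrow> 'b topology" where
  "quotient_topology X f =
     topology (\<lambda>U. U \<subseteq> f ` topspace X \<and> openin X {x \<in> topspace X. f x \<in> U})"

lemma openin_quotient_topology:
  "openin (quotient_topology X f) U \<longleftrightarrow>
     U \<subseteq> f ` topspace X \<and> openin X {x \<in> topspace X. f x \<in> U}"
proof -
  have "istopology (\<lambda>U. U \<subseteq> f ` topspace X \<and> openin X {x \<in> topspace X. f x \<in> U})"
    unfolding istopology_def
  proof (intro conjI allI impI)
    fix S T
    assume S: "S \<subseteq> f ` topspace X \<and> openin X {x \<in> topspace X. f x \<in> S}"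
      and T: "T \<subseteq> f ` topspace X \<and> openin X {x \<in> topspace X. f x \<in> T}"
    have "{x \<in> topspace X. f x \<in> S \<inter> T} =
        {x \<in> topspace X. f x \<in> S} \<inter> {x \<in> topspace X. f x \<in> T}"
      by auto
    then show "openin X {x \<in> topspace X. f x \<in> S \<inter> T}"
      using S T by auto
    show "S \<inter> T \<subseteq> f ` topspace X"
      using S by auto
  next
    fix K
    assume K: "\<forall>S\<in>K. S \<subseteq> f ` topspace X \<and> openin X {x \<in> topspace X. f x \<in> S}"
    have "{x \<in> topspace X. f x \<in> \<Union>K} = (\<Union>S\<in>K. {x \<in> topspace X. f x \<in> S})"
      by auto
    then show "openin X {x \<in> topspace X. f x \<in> \<Union>K}"
      using K by auto
    show "\<Union>K \<subseteq> f ` topspace X"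
      using K by auto
  qed
  then show ?thesis
    by (simp add: quotient_topology_def topology_inverse')
qed

lemma topspace_quotient_topology [simp]: "topspace (quotient_topology X f) = f ` topspace X"
proof
  show "topspace (quotient_topology X f) \<subseteq> f ` topspace X"
    using openin_topspace[of "quotient_topology X f"] unfolding openin_quotient_topology by (rule conjunct1)
  have "{x \<in> topspace X. f x \<in> f ` topspace X} = topspace X"
    by auto
  then have "openin (quotient_topology X f) (f ` topspace X)"
    by (simp add: openin_quotient_topology)
  then show "f ` topspace X \<subseteq> topspace (quotient_topology X f)"
    by (rule openin_subset)
qed

lemma quotient_map_quotient_topology: "quotient_map X (quotient_topology X f) f"
  unfolding quotient_map_def openin_quotient_topology topspace_quotient_topology by blast


section \<open>Fundamental groups\<close>

definition loops_at :: "'a topology \<Rightarrow> 'a \<Rightarrow> (real \<Rightarrow> 'a) set" where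
  "loops_at X b = {p. pathin X p \<and> p 0 = b \<and> p 1 = b}"

definition loop_homotopic :: "'a topology \<Rightarrow> 'a \<Rightarrow> (real \<Rightarrow> 'a) \<Rightarrow> (real \<Rightarrow> 'a) \<Rightarrow> bool" where
  "loop_homotopic X b = homotopic_with (\<lambda>r. r 0 = b \<and> r 1 = b) (top_of_set {0..1}) X"

definition loop_class :: "'a topology \<Rightarrow> 'a \<Rightarrow> (real \<Rightarrow> 'a) \<Rightarrow> (real \<Rightarrow> 'a) set" where
  "loop_class X b p = {q \<in> loops_at X b. loop_homotopic X b p q}"

text \<open>The library's path concatenation is only available when the points form a topological
  type class; the quotient configuration space below is a topology on a type of sets.\<close>

definition loop_join :: "(real \<Rightarrow> 'a) \<Rightarrow> (real \<Rightarrow> 'a) \<Rightarrow> real \<Rightarrow> 'a" where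
  "loop_join p q t = (if t \<le> 1 / 2 then p (2 * t) else q (2 * t - 1))"

text \<open>Elements are homotopy classes.  Since all members of a class are equivalent, each union
  below is a union of equal classes.\<close>

definition fundamental_group :: "'a topology \<Rightarrow> 'a \<Rightarrow> (real \<Rightarrow> 'a) set monoid" where
  "fundamental_group X b =
     \<lparr>carrier = loop_class X b ` loops_at X b,
      monoid.mult = (\<lambda>A B. \<Union>p\<in>A. \<Union>q\<in>B. loop_class X b (loop_join p q)),
      one = loop_class X b (\<lambda>_. b)\<rparr>"

text \<open>The map induced on fundamental groups by a map f into Y; here b is the base point in Y.\<close>

definition induced_hom ::
    "'b topology \<Rightarrow> 'b \<Rightarrow> ('a \<Rightarrow> 'b) \<Rightarrow> (real \<Rightarrow> 'a) set \<Rightarrow> (real \<Rightarrow> 'b) set" where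
  "induced_hom Y b f A = (\<Union>p\<in>A. loop_class Y b (f \<circ> p))"


section \<open>Free groups\<close>

text \<open>Reduced words; the letter \<open>(a, True)\<close> is the generator \<open>a\<close> and \<open>(a, False)\<close> is its
  inverse.\<close>

definition letter_inv :: "'a \<times> bool \<Rightarrow> 'a \<times> bool" where
  "letter_inv l = (fst l, \<not> snd l)"

definition reduced :: "('a \<times> bool) list \<Rightarrow> bool" where
  "reduced w \<longleftrightarrow> successively (\<lambda>l m. m \<noteq> letter_inv l) w"

fun push_letter :: "'a \<times> bool \<Rightarrow> ('a \<times> bool) list \<Rightarrow> ('a \<times> bool) list" where
  "push_letter l [] = [l]"
| "push_letter l (m # w) = (if m = letter_inv l then w else l # m # w)"

definition free_group :: "'a set \<Rightarrow> ('a \<times> bool) list monoid" where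
  "free_group S =
     \<lparr>carrier = {w \<in> lists (S \<times> UNIV). reduced w},
      monoid.mult = foldr push_letter,
      one = []\<rparr>"

definition free_gen :: "'a \<Rightarrow> ('a \<times> bool) list" where
  "free_gen a = [(a, True)]"

definition commutator :: "('a, 'b) monoid_scheme \<Rightarrow> 'a \<Rightarrow> 'a \<Rightarrow> 'a" where
  "commutator G a b = a \<otimes>\<^bsub>G\<^esub> b \<otimes>\<^bsub>G\<^esub> inv\<^bsub>G\<^esub> a \<otimes>\<^bsub>G\<^esub> inv\<^bsub>G\<^esub> b"

datatype xy = Gx | Gy

abbreviation F_xy :: "(xy \<times> bool) list monoid" where
  "F_xy \<equiv> free_group {Gx, Gy}"

abbreviation Z2 :: "(int \<times> int) monoid" where
  "Z2 \<equiv> integer_group \<times>\<times> integer_group"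


section \<open>Configuration spaces and braid groups of the torus\<close>

type_synonym point = "complex \<times> complex"

definition torus :: "point topology" where
  "torus = top_of_set (sphere 0 1 \<times> sphere 0 1)"

definition F2_torus :: "(point \<times> point) topology" where
  "F2_torus = subtopology (prod_topology torus torus) {(y1, y2). y1 \<noteq> y2}"

text \<open>The orbit of \<open>(y1, y2)\<close> under the swap is encoded as the unordered pair.\<close>

definition unordered :: "point \<times> point \<Rightarrow> point set" where
  "unordered y = {fst y, snd y}"

definition D2_torus :: "point set topology" where
  "D2_torus = quotient_topology F2_torus unordered"

definition pure_braid_group :: "point \<times> point \<Rightarrow> (real \<Rightarrow> point \<times> point) set monoid" where
  "pure_braid_group y = fundamental_group F2_torus y"

definition full_braid_group :: "point \<times> point \<Rightarrow> (real \<Rightarrow> point set) set monoid" where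
  "full_braid_group y = fundamental_group D2_torus (unordered y)"

text \<open>The homomorphism induced by the double covering, through which the pure braid group is
  regarded as a subgroup of the full one.\<close>

definition braid_incl ::
    "point \<times> point \<Rightarrow> (real \<Rightarrow> point \<times> point) set \<Rightarrow> (real \<Rightarrow> point set) set" where
  "braid_incl y = induced_hom D2_torus (unordered y) unordered"

definition p1_hom :: "point \<times> point \<Rightarrow> (real \<Rightarrow> point \<times> point) set \<Rightarrow> (real \<Rightarrow> point) set" where
  "p1_hom y = induced_hom torus (fst y) fst"

text \<open>Conjugation in the full braid group, read as a self-map of the pure braid group.  The
  inverse of \<open>braid_incl\<close> is meaningful only once \<open>braid_incl\<close> is known to be
  injective with image stable under the conjugation.\<close>

definition conj_on_pure ::
    "point \<times> point \<Rightarrow> (real \<Rightarrow> point set) set \<Rightarrow>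
     (real \<Rightarrow> point \<times> point) set \<Rightarrow> (real \<Rightarrow> point \<times> point) set" where
  "conj_on_pure y s g =
     the_inv_into (carrier (pure_braid_group y)) (braid_incl y)
       (s \<otimes>\<^bsub>full_braid_group y\<^esub> braid_incl y g \<otimes>\<^bsub>full_braid_group y\<^esub> inv\<^bsub>full_braid_group y\<^esub> s)"


section \<open>Half-twists\<close>

text \<open>The universal covering of the torus, with the complex numbers as the real plane.\<close>

definition torus_cover :: "complex \<Rightarrow> point" where
  "torus_cover z = (cis (2 * pi * Re z), cis (2 * pi * Im z))"

text \<open>The map \<open>torus_cover\<close> is injective on open discs of radius \<open>1/2\<close>, so for
  \<open>0 < norm v < 1/2\<close> the points \<open>c + v\<close> and \<open>c - v\<close> give two distinct points inside an
  embedded round disc centred at the image of \<open>c\<close>.  Every pair of distinct points of the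
  torus has this form, because two points are joined by a segment of length at most
  \<open>sqrt 2 / 2 < 1\<close>.\<close>

definition twist_base :: "complex \<Rightarrow> complex \<Rightarrow> point \<times> point" where
  "twist_base c v = (torus_cover (c + v), torus_cover (c - v))"

text \<open>The half-twist rotates the two points by the angle \<open>pi\<close> about \<open>c\<close>: counterclockwise
  for \<open>d = 1\<close>, clockwise for \<open>d = -1\<close>.\<close>

definition half_twist :: "real \<Rightarrow> complex \<Rightarrow> complex \<Rightarrow> (real \<Rightarrow> point set) set" where
  "half_twist d c v =
     loop_class D2_torus (unordered (twist_base c v))
       (\<lambda>t. unordered (twist_base c (cis (d * pi * t) * v)))"

end

theory Submission
  imports Defs
begin

text \<open>The plane minus the lattice of Gaussian integers covers the punctured torus.  Recording the
  grid lines that a path crosses, as a word in \<open>x\<close> and \<open>y\<close>, is a homotopy invariant of the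
  path, and together with the end points a complete one.  Write a configuration as its first point
  together with the difference of the two points: loops of configurations then lift to paths in
  \<open>\<complex>\<close> times the punctured plane, and are classified by the displacement of the first coordinate
  and the crossing word of the second one.  This is the decomposition of the pure braid group.

  Exchanging the two points acts on the lifts by \<open>(z, w) \<mapsto> (z - w, - w)\<close>, and negation inverts
  both letters of the crossing word.  A half-twist moves \<open>w\<close> along half a circle around a lattice
  point, which crosses one line of each direction; up to a change of the base point its word is
  \<open>A = x y\<^sup>-\<^sup>1\<close>.  Hence conjugation by \<open>\<sigma>\<close> sends \<open>x\<close> to
  \<open>A x\<^sup>-\<^sup>1 A\<^sup>-\<^sup>1 = B x\<^sup>-\<^sup>1\<close>, likewise for \<open>y\<close>, and \<open>\<sigma>\<^sup>2\<close> is the product of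
  \<open>A\<close> and its image under the inversion of the letters, which is \<open>B\<close>.\<close>

text \<open>The crossing word has to be examined only inside strips between adjacent grid lines. A
  path in a strip meets lines of one direction only, so non-commutativity never enters the local
  check; it arises where strips are concatenated. Convexity of the strips makes the invariant
  complete. A lifted loop has two displacements in the plane, but the group has a single summand of
  rank two beside the free group: the displacement of \<open>w\<close> is the abelianized word and
  carries nothing new. It reappears under conjugation, since the exchange subtracts \<open>w\<close>
  from \<open>z\<close> and so adds exponent sums to the first displacement. This is where the
  entries 1 in the images of x and y come from. Two obstacles shape the formulas. The floor assigns
  a point on a grid line to one side and negation reverses the side; the base difference may lie on
  a line, so correction factors appear and have to cancel. And the base pair is arbitrary, so words
  are normalized by transport to a fixed reference point.\<close>

section \<open>Free groups\<close>

lemma letter_inv_letter_inv [simp]: "letter_inv (letter_inv l) = l"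
  by (simp add: letter_inv_def)

lemma letter_inv_eq_iff [simp]: "letter_inv l = letter_inv m \<longleftrightarrow> l = m"
  by (metis letter_inv_letter_inv)

lemma reduced_simps [simp]:
  "reduced []" "reduced [l]"
  "reduced (l # m # w) \<longleftrightarrow> m \<noteq> letter_inv l \<and> reduced (m # w)"
  by (auto simp: reduced_def)

lemma reduced_Cons: "reduced (l # w) \<longleftrightarrow> reduced w \<and> (w = [] \<or> hd w \<noteq> letter_inv l)"
  by (cases w) auto

lemma reduced_push_letter: "reduced w \<Longrightarrow> reduced (push_letter l w)"
  by (cases w) (auto simp: reduced_Cons)

lemma set_push_letter: "set (push_letter l w) \<subseteq> insert l (set w)"
  by (cases w) auto

lemma push_letter_cancel: "reduced w \<Longrightarrow> push_letter l (push_letter (letter_inv l) w) = w"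
  by (cases w; cases "tl w") (auto simp: reduced_Cons)

lemma push_letter_reduced: "reduced (l # w) \<Longrightarrow> push_letter l w = l # w"
  by (cases w) auto

lemma reduced_foldr: "reduced w \<Longrightarrow> reduced (foldr push_letter u w)"
  by (induction u) (auto simp: reduced_push_letter)

lemma set_foldr_push_letter: "set (foldr push_letter u w) \<subseteq> set u \<union> set w"
proof (induction u)
  case (Cons l u)
  then show ?case using set_push_letter[of l "foldr push_letter u w"] by auto
qed simp

text \<open>Van der Waerden's argument: on reduced words the action of \<open>l\<close> is inverse
  to that of \<open>letter_inv l\<close>, so a pair cancelled inside the left factor acts trivially
  anyway. Associativity follows by induction.\<close>

lemma foldr_push_push_letter:
  assumes "reduced w"
  shows "foldr push_letter (push_letter l u) w = push_letter l (foldr push_letter u w)"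
proof (cases u)
  case (Cons m u')
  then show ?thesis using push_letter_cancel[OF reduced_foldr[OF assms, of u'], of l] by auto
qed simp

lemma foldr_push_letter_assoc:
  "reduced w \<Longrightarrow>
     foldr push_letter (foldr push_letter u v) w = foldr push_letter u (foldr push_letter v w)"
  by (induction u) (auto simp: foldr_push_push_letter)

definition word_inv :: "('a \<times> bool) list \<Rightarrow> ('a \<times> bool) list" where
  "word_inv w = rev (map letter_inv w)"

lemma reduced_word_inv: "reduced w \<Longrightarrow> reduced (word_inv w)"
  unfolding word_inv_def reduced_def successively_rev successively_map
  by (erule successively_mono) auto

lemma foldr_word_inv: "reduced w \<Longrightarrow> foldr push_letter (word_inv w) w = []"
proof (induction w)
  case (Cons l w)
  then show ?case by (auto simp: word_inv_def reduced_Cons)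
qed (simp add: word_inv_def)

lemma free_group_simps:
  "carrier (free_group S) = {w \<in> lists (S \<times> UNIV). reduced w}"
  "u \<otimes>\<^bsub>free_group S\<^esub> w = foldr push_letter u w"
  "\<one>\<^bsub>free_group S\<^esub> = []"
  by (simp_all add: free_group_def)

lemma word_inv_closed: "w \<in> carrier (free_group S) \<Longrightarrow> word_inv w \<in> carrier (free_group S)"
  using reduced_word_inv[of w]
  by (auto simp: free_group_simps word_inv_def letter_inv_def mem_Times_iff)

lemma group_free_group [simp]: "group (free_group S)"
proof (rule groupI)
  fix u w assume "u \<in> carrier (free_group S)" "w \<in> carrier (free_group S)"
  then show "u \<otimes>\<^bsub>free_group S\<^esub> w \<in> carrier (free_group S)"
    using set_foldr_push_letter[of u w] by (auto simp: free_group_simps reduced_foldr lists_eq_set)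
next
  fix w assume "w \<in> carrier (free_group S)"
  then have "word_inv w \<in> carrier (free_group S)" "foldr push_letter (word_inv w) w = []"
    by (auto simp: word_inv_closed) (auto simp: free_group_simps foldr_word_inv)
  then show "\<exists>u\<in>carrier (free_group S). u \<otimes>\<^bsub>free_group S\<^esub> w = \<one>\<^bsub>free_group S\<^esub>"
    by (auto simp: free_group_simps)
qed (auto simp: free_group_simps foldr_push_letter_assoc)

lemma inv_free_group:
  assumes "w \<in> carrier (free_group S)"
  shows "inv\<^bsub>free_group S\<^esub> w = word_inv w"
proof (rule group.inv_equality)
  show "word_inv w \<in> carrier (free_group S)" using assms by (rule word_inv_closed)
qed (use assms in \<open>auto simp: free_group_simps foldr_word_inv\<close>)

interpretation F: group F_xy by simp

abbreviation (input) word_mult :: "(xy \<times> bool) list \<Rightarrow> (xy \<times> bool) list \<Rightarrow> (xy \<times> bool) list" (infixl \<open>\<cdot>\<close> 70) where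
  "u \<cdot> w \<equiv> mult F_xy u w"

lemma carrier_F_xy: "carrier F_xy = {w. reduced w}"
proof -
  have "l \<in> {Gx, Gy} \<times> UNIV" for l :: "xy \<times> bool" by (cases l; cases "fst l") auto
  then show ?thesis by (auto simp: free_group_simps)
qed

lemma free_gen_carrier [simp]: "free_gen a \<in> carrier F_xy"
  by (simp add: carrier_F_xy free_gen_def)

lemma letter_in_carrier [simp]: "[l] \<in> carrier F_xy"
  by (simp add: carrier_F_xy)

lemma inv_letter: "inv\<^bsub>F_xy\<^esub> [l] = [letter_inv l]"
  by (subst inv_free_group) (auto simp: word_inv_def)

lemma map_letter_inv_push_letter:
  "map letter_inv (push_letter l w) = push_letter (letter_inv l) (map letter_inv w)"
  by (cases w) auto

text \<open>The automorphism induced by the map \<open>-1\<close> of the punctured torus.\<close>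

lemma map_letter_inv_hom: "map letter_inv \<in> hom F_xy F_xy"
proof (rule homI)
  fix u w assume "u \<in> carrier F_xy" "w \<in> carrier F_xy"
  show "map letter_inv (u \<cdot> w) = map letter_inv u \<cdot> map letter_inv w"
    unfolding free_group_simps by (induction u) (auto simp: map_letter_inv_push_letter)
next
  fix u assume "u \<in> carrier F_xy"
  then show "map letter_inv u \<in> carrier F_xy"
    unfolding carrier_F_xy mem_Collect_eq reduced_def successively_map
    by (elim successively_mono) (metis letter_inv_letter_inv)
qed

interpretation J: group_hom F_xy F_xy "map letter_inv"
  using map_letter_inv_hom by unfold_locales

text \<open>Ensures that the lattice path spelled by a power of one generator moves in one direction
  only and so stays in a single strip.\<close>

lemma free_gen_power_letters: "fst ` set (free_gen a [^]\<^bsub>F_xy\<^esub> (i::int)) \<subseteq> {a}"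
proof -
  have nat: "fst ` set (free_gen a [^]\<^bsub>F_xy\<^esub> n) \<subseteq> {a}" for n :: nat
  proof (induction n)
    case (Suc n)
    have "fst ` set (free_gen a [^]\<^bsub>F_xy\<^esub> Suc n) \<subseteq>
        fst ` (set (free_gen a [^]\<^bsub>F_xy\<^esub> n) \<union> set (free_gen a))"
      unfolding nat_pow_Suc free_group_simps by (intro image_mono set_foldr_push_letter)
    also have "\<dots> \<subseteq> {a}" using Suc unfolding image_Un free_gen_def by simp
    finally show ?case .
  qed (simp add: free_group_simps)
  have inv: "fst ` set (word_inv w) = fst ` set w" for w :: "(xy \<times> bool) list"
    by (simp add: word_inv_def letter_inv_def image_image)
  show ?thesis
  proof (cases "i < 0")
    case True
    have "inv\<^bsub>F_xy\<^esub> (free_gen a [^]\<^bsub>F_xy\<^esub> nat (- i)) = word_inv (free_gen a [^]\<^bsub>F_xy\<^esub> nat (- i))"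
      by (intro inv_free_group F.nat_pow_closed free_gen_carrier)
    then show ?thesis unfolding int_pow_def2 using True nat by (simp only: inv if_True)
  next
    case False
    then show ?thesis unfolding int_pow_def2 using nat by (simp only: if_False)
  qed
qed

lemma map_letter_inv_power:
  "map letter_inv (free_gen a [^]\<^bsub>F_xy\<^esub> (i::int)) = free_gen a [^]\<^bsub>F_xy\<^esub> (- i)"
proof -
  have "map letter_inv (free_gen a) = inv\<^bsub>F_xy\<^esub> (free_gen a)"
    unfolding free_gen_def inv_letter by simp
  then show ?thesis
    by (simp only: J.hom_int_pow[OF free_gen_carrier] F.int_pow_neg[OF free_gen_carrier]
        F.int_pow_inv[OF free_gen_carrier])
qed

section \<open>Abelianized words as Gaussian integers\<close>

primrec direction :: "xy \<Rightarrow> complex" where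
  "direction Gx = 1"
| "direction Gy = \<i>"

definition letter_shift :: "xy \<times> bool \<Rightarrow> complex" where
  "letter_shift l = (if snd l then direction (fst l) else - direction (fst l))"

definition word_shift :: "(xy \<times> bool) list \<Rightarrow> complex" where
  "word_shift w = sum_list (map letter_shift w)"

lemma letter_shift_inv [simp]: "letter_shift (letter_inv l) = - letter_shift l"
  by (simp add: letter_shift_def letter_inv_def)

lemma word_shift_simps [simp]: "word_shift [] = 0" "word_shift (l # w) = letter_shift l + word_shift w"
  by (simp_all add: word_shift_def)

lemma word_shift_push_letter: "word_shift (push_letter l w) = letter_shift l + word_shift w"
  by (cases w) auto

lemma word_shift_mult: "word_shift (u \<cdot> w) = word_shift u + word_shift w"
  unfolding free_group_simps by (induction u) (auto simp: word_shift_push_letter)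

lemma word_shift_map_letter_inv: "word_shift (map letter_inv w) = - word_shift w"
  by (induction w) auto

lemma word_shift_one [simp]: "word_shift \<one>\<^bsub>F_xy\<^esub> = 0"
  by (simp add: free_group_simps)

lemma word_shift_inv:
  assumes "w \<in> carrier F_xy"
  shows "word_shift (inv\<^bsub>F_xy\<^esub> w) = - word_shift w"
proof -
  have "word_shift (inv\<^bsub>F_xy\<^esub> w \<cdot> w) = 0" using assms by (simp only: F.l_inv word_shift_one)
  then show ?thesis by (simp only: word_shift_mult eq_neg_iff_add_eq_0)
qed

lemma word_shift_free_gen [simp]: "word_shift (free_gen a) = direction a"
  by (simp add: free_gen_def letter_shift_def)

lemma word_shift_power: "word_shift (free_gen a [^]\<^bsub>F_xy\<^esub> (i::int)) = of_int i * direction a"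
proof -
  have nat: "word_shift (free_gen a [^]\<^bsub>F_xy\<^esub> n) = of_nat n * direction a" for n :: nat
  proof (induction n)
    case (Suc n)
    then show ?case
      by (simp only: nat_pow_Suc word_shift_mult word_shift_free_gen of_nat_Suc distrib_right mult_1_left
          add.commute)
  qed (simp only: nat_pow_0 word_shift_one of_nat_0 mult_zero_left)
  show ?thesis
  proof (cases "i < 0")
    case True
    have "word_shift (inv\<^bsub>F_xy\<^esub> (free_gen a [^]\<^bsub>F_xy\<^esub> nat (- i))) = - (of_nat (nat (- i)) * direction a)"
      using word_shift_inv[OF F.nat_pow_closed[OF free_gen_carrier]] nat by (simp only:)
    then show ?thesis using True unfolding int_pow_def2 by simp
  next
    case False
    then show ?thesis unfolding int_pow_def2 if_not_P[OF False] nat by simp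
  qed
qed

section \<open>Holonomy of a local cocycle\<close>

text \<open>Lebesgue number of the cover pulled back along \<open>f\<close>. The balls are cut down
  to \<open>K\<close>, since \<open>f\<close> is continuous only there.\<close>

lemma Lebesgue_number_continuous_on:
  fixes f :: "'a::metric_space \<Rightarrow> 'b::topological_space"
  assumes "compact K" "continuous_on K f" "f ` K \<subseteq> \<Union>\<U>" "\<And>U. U \<in> \<U> \<Longrightarrow> open U"
  obtains \<delta> where "\<delta> > 0" "\<And>x. x \<in> K \<Longrightarrow> \<exists>U\<in>\<U>. f ` (K \<inter> ball x \<delta>) \<subseteq> U"
proof -
  let ?G = "{V. open V \<and> (\<exists>U\<in>\<U>. f ` (K \<inter> V) \<subseteq> U)}"
  have "K \<subseteq> \<Union>?G"
  proof
    fix x assume "x \<in> K"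
    then have "f x \<in> \<Union>\<U>" using assms(3) by (simp add: image_subset_iff)
    then obtain U where U: "U \<in> \<U>" "f x \<in> U" by (rule UnionE)
    obtain V where V: "open V" "V \<inter> K = f -` U \<inter> K"
      using assms(2)[unfolded continuous_on_open_invariant, rule_format, OF assms(4)[OF U(1)]] by blast
    have "f ` (K \<inter> V) \<subseteq> U" using V(2) by blast
    have "x \<in> V" using V(2) \<open>x \<in> K\<close> U(2) by blast
    then show "x \<in> \<Union>?G"
      using \<open>f ` (K \<inter> V) \<subseteq> U\<close> U(1) V(1) by (intro UnionI[of V] CollectI conjI bexI[of _ U])
  qed
  then obtain \<delta> where \<delta>: "0 < \<delta>" "\<And>x. x \<in> K \<Longrightarrow> \<exists>V\<in>?G. ball x \<delta> \<subseteq> V"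
    by (rule Heine_Borel_lemma[OF assms(1)]) simp_all
  show thesis
  proof (rule that[OF \<delta>(1)])
    fix x assume "x \<in> K"
    then obtain V U where "ball x \<delta> \<subseteq> V" "U \<in> \<U>" "f ` (K \<inter> V) \<subseteq> U" using \<delta>(2) by blast
    then show "\<exists>U\<in>\<U>. f ` (K \<inter> ball x \<delta>) \<subseteq> U" by (intro bexI[of _ U]) (blast, assumption)
  qed
qed

text \<open>A flat connection in discrete form: \<open>c u v\<close> is the transport from
  \<open>u\<close> to \<open>v\<close>, and it has to be consistent only among points of one member
  of the cover. It is total, so that products along arbitrary chains are defined.\<close>

locale local_cocycle = group G for G (structure) +
  fixes \<U> :: "'p::metric_space set set" and c :: "'p \<Rightarrow> 'p \<Rightarrow> 'a"
  assumes open_cover: "U \<in> \<U> \<Longrightarrow> open U"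
    and c_closed [simp]: "c u v \<in> carrier G"
    and cocycle: "\<lbrakk>U \<in> \<U>; u \<in> U; v \<in> U; w \<in> U\<rbrakk> \<Longrightarrow> c u v \<otimes> c v w = c u w"
begin

lemma c_refl: "u \<in> \<Union>\<U> \<Longrightarrow> c u u = \<one>"
  using cocycle by (metis UnionE c_closed r_cancel_one)

primrec chain_prod :: "(nat \<Rightarrow> 'p) \<Rightarrow> nat \<Rightarrow> 'a" where
  "chain_prod f 0 = \<one>"
| "chain_prod f (Suc n) = chain_prod f n \<otimes> c (f n) (f (Suc n))"

lemma chain_prod_closed [simp]: "chain_prod f n \<in> carrier G"
  by (induction n) auto

lemma chain_prod_cong: "(\<And>k. k \<le> n \<Longrightarrow> f k = g k) \<Longrightarrow> chain_prod f n = chain_prod g n"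
  by (induction n) auto

lemma chain_prod_add: "chain_prod f (a + b) = chain_prod f a \<otimes> chain_prod (\<lambda>k. f (a + k)) b"
  by (induction b) (auto simp: m_assoc)

lemma chain_prod_block:
  assumes "U \<in> \<U>" "\<And>k. k \<le> n \<Longrightarrow> f k \<in> U"
  shows "chain_prod f n = c (f 0) (f n)"
  using assms(2)
proof (induction n)
  case 0
  then show ?case using c_refl[of "f 0"] assms(1) by (metis UnionI chain_prod.simps(1) le_refl)
next
  case (Suc n)
  then show ?case by (simp add: cocycle[OF assms(1)])
qed

text \<open>Each cell commutes by the cocycle identity in a common member of the cover; the
  induction pushes the first rung across all cells.\<close>

lemma chain_prod_ladder:
  assumes "\<And>k. k < n \<Longrightarrow> \<exists>U\<in>\<U>. {f k, f (Suc k), f' k, f' (Suc k)} \<subseteq> U"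
  shows "c (f 0) (f' 0) \<otimes> chain_prod f' n = chain_prod f n \<otimes> c (f n) (f' n)"
  using assms
proof (induction n)
  case (Suc n)
  obtain U where U: "U \<in> \<U>" "{f n, f (Suc n), f' n, f' (Suc n)} \<subseteq> U" using Suc.prems by blast
  have "c (f 0) (f' 0) \<otimes> chain_prod f' (Suc n) = chain_prod f n \<otimes> (c (f n) (f' n) \<otimes> c (f' n) (f' (Suc n)))"
    using Suc by (simp flip: m_assoc)
  also have "c (f n) (f' n) \<otimes> c (f' n) (f' (Suc n)) = c (f n) (f (Suc n)) \<otimes> c (f (Suc n)) (f' (Suc n))"
    using U by (simp add: cocycle[OF U(1)])
  finally show ?case by (simp add: m_assoc)
qed simp

definition fits :: "(real \<Rightarrow> 'p) \<Rightarrow> nat \<Rightarrow> bool" where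
  "fits p n \<longleftrightarrow> (\<forall>k<n. \<exists>U\<in>\<U>. p ` {k / n .. Suc k / n} \<subseteq> U)"

definition subdiv_prod :: "(real \<Rightarrow> 'p) \<Rightarrow> nat \<Rightarrow> 'a" where
  "subdiv_prod p n = chain_prod (\<lambda>k. p (k / n)) n"

text \<open>A block lies in one member of the cover, so dividing it further does not change its
  contribution. Two fitting subdivisions can then be compared through the one whose size is the
  product of theirs.\<close>

lemma fits_refine:
  assumes "fits p n" "n > 0" "m > 0"
  shows "fits p (n * m)" "subdiv_prod p (n * m) = subdiv_prod p n"
proof -
  show "fits p (n * m)" unfolding fits_def
  proof (intro allI impI)
    fix k assume "k < n * m"
    then have "k div m < n" by (simp add: less_mult_imp_div_less)
    then obtain U where U: "U \<in> \<U>" "p ` {real (k div m) / n .. Suc (k div m) / n} \<subseteq> U"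
      using assms(1) unfolding fits_def by blast
    have "real (k div m) / n \<le> k / real (n * m)"
    proof -
      have "real (k div m * m) \<le> k" unfolding of_nat_le_iff by (rule div_times_less_eq_dividend)
      then show ?thesis using assms by (simp add: field_simps)
    qed
    moreover have "Suc k / real (n * m) \<le> Suc (k div m) / n"
    proof -
      have "Suc k \<le> Suc (k div m) * m"
        using assms(3) by (metis Suc_leI dividend_less_div_times mult_Suc)
      then have "real (Suc k) \<le> real (Suc (k div m) * m)" by (simp only: of_nat_le_iff)
      then have "real (Suc k) / real (n * m) \<le> real (Suc (k div m) * m) / real (n * m)"
        by (rule divide_right_mono) simp
      then show ?thesis using assms(3) by (simp only: of_nat_mult) simp
    qed
    ultimately have "p ` {k / real (n * m) .. Suc k / real (n * m)} \<subseteq> U"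
      using U(2) by (intro order_trans[OF image_mono U(2)]) auto
    then show "\<exists>U\<in>\<U>. p ` {k / real (n * m) .. Suc k / real (n * m)} \<subseteq> U" using U(1) by blast
  qed
  have "chain_prod (\<lambda>k. p (k / real (n * m))) (j * m) = chain_prod (\<lambda>k. p (k / n)) j" if "j \<le> n" for j
    using that
  proof (induction j)
    case (Suc j)
    then obtain U where U: "U \<in> \<U>" "p ` {real j / n .. Suc j / n} \<subseteq> U"
      using assms(1) unfolding fits_def by (meson Suc_le_lessD)
    have "p ((j * m + k) / real (n * m)) \<in> U" if "k \<le> m" for k
    proof -
      have "real (j * m + k) / real (n * m) \<in> {real j / n .. Suc j / n}"
      proof -
        have "real (j * m + k) / real (n * m) = j / n + k / m / n"
          using assms by (simp add: field_simps)
        moreover have "k / m \<le> 1" using that assms by simp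
        then have "k / m / n \<le> 1 / n" by (rule divide_right_mono) simp
        ultimately show ?thesis by (simp add: add_divide_distrib)
      qed
      then show ?thesis using U(2) by blast
    qed
    then have "chain_prod (\<lambda>k. p ((j * m + k) / real (n * m))) m
        = c (p ((j * m + 0) / real (n * m))) (p ((j * m + m) / real (n * m)))"
      by (intro chain_prod_block[OF U(1)])
    moreover have "(j * m + 0) / real (n * m) = j / n" "(j * m + m) / real (n * m) = Suc j / n"
      using assms by (auto simp: field_simps)
    moreover have "Suc j * m = j * m + m" by simp
    ultimately show ?case
      using Suc by (simp add: chain_prod_add del: mult_Suc of_nat_Suc of_nat_add of_nat_mult)
  qed simp
  then show "subdiv_prod p (n * m) = subdiv_prod p n" by (simp add: subdiv_prod_def)
qed

definition hol :: "(real \<Rightarrow> 'p) \<Rightarrow> 'a" where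
  "hol p = subdiv_prod p (SOME n. n > 0 \<and> fits p n)"

lemma hol_eq:
  assumes "fits p n" "n > 0"
  shows "hol p = subdiv_prod p n"
proof -
  define m where "m = (SOME n. n > 0 \<and> fits p n)"
  have "m > 0 \<and> fits p m" unfolding m_def by (rule someI[where x = n]) (use assms in auto)
  then show ?thesis using fits_refine[of p m n] fits_refine[of p n m] assms
    by (simp add: hol_def mult.commute flip: m_def)
qed

lemma hol_closed [simp]: "hol p \<in> carrier G"
  by (simp add: hol_def subdiv_prod_def)

lemma ex_fits:
  assumes "path p" "path_image p \<subseteq> \<Union>\<U>"
  obtains n where "n > 0" "fits p n"
proof -
  obtain \<delta> where \<delta>: "\<delta> > 0" "\<And>x. x \<in> {0..1} \<Longrightarrow> \<exists>U\<in>\<U>. p ` ({0..1} \<inter> ball x \<delta>) \<subseteq> U"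
    using Lebesgue_number_continuous_on[of "{0..1}" p \<U>] assms open_cover
    unfolding path_def path_image_def by auto
  obtain n :: nat where n: "n > 0" "1 / n < \<delta>"
    using real_arch_inverse[of \<delta>] \<delta>(1) by (auto simp: field_simps)
  have "fits p n" unfolding fits_def
  proof (intro allI impI)
    fix k assume k: "k < n"
    then obtain U where U: "U \<in> \<U>" "p ` ({0..1} \<inter> ball (k / n) \<delta>) \<subseteq> U"
      using \<delta>(2)[of "k / n"] n by (auto simp: field_simps)
    have "{real k / n .. Suc k / n} \<subseteq> {0..1} \<inter> ball (k / n) \<delta>"
    proof
      fix t assume "t \<in> {real k / n .. Suc k / n}"
      then have t: "k / n \<le> t" "t \<le> k / n + 1 / n" by (auto simp: add_divide_distrib)
      have "k / n + 1 / n \<le> 1" using k n by (simp add: field_simps)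
      with t n show "t \<in> {0..1} \<inter> ball (k / n) \<delta>"
        by (auto simp: dist_real_def intro: order_trans[rotated])
    qed
    then show "\<exists>U\<in>\<U>. p ` {k / n .. Suc k / n} \<subseteq> U" using U by (meson image_mono order_trans)
  qed
  with n that show thesis by blast
qed

lemma hol_cong:
  assumes "\<And>t. t \<in> {0..1} \<Longrightarrow> p t = q t"
  shows "hol p = hol q"
proof -
  have sub: "{real k / real n .. Suc k / n} \<subseteq> {0..1}" if "k < n" for k n :: nat
  proof -
    have "real (Suc k) \<le> real n" using that by (simp only: of_nat_le_iff Suc_le_eq)
    then have "Suc k / real n \<le> 1" using that by (simp add: field_simps)
    moreover have "0 \<le> real k / real n" by simp
    ultimately show ?thesis by auto
  qed
  have "p ` {real k / real n .. Suc k / n} = q ` {real k / n .. Suc k / n}" if "k < n" for k n :: nat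
    using subsetD[OF sub[OF that]] assms by (intro image_cong) (auto simp del: of_nat_Suc atLeastAtMost_iff)
  then have "fits p n = fits q n" for n by (simp add: fits_def cong: conj_cong)
  moreover have "subdiv_prod p n = subdiv_prod q n" for n
    unfolding subdiv_prod_def by (rule chain_prod_cong) (cases "n = 0"; auto intro!: assms simp: field_simps)
  ultimately show ?thesis by (simp add: hol_def)
qed

lemma hol_within:
  assumes "path_image p \<subseteq> U" "U \<in> \<U>"
  shows "hol p = c (pathstart p) (pathfinish p)"
proof -
  have "fits p 1" using assms by (auto simp: fits_def path_image_def)
  then show ?thesis using hol_eq[of p 1] assms
    by (simp add: subdiv_prod_def pathstart_def pathfinish_def)
qed

lemma hol_join:
  assumes "path p" "path_image p \<subseteq> \<Union>\<U>" "path q" "path_image q \<subseteq> \<Union>\<U>" "pathfinish p = pathstart q"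
  shows "hol (p +++ q) = hol p \<otimes> hol q"
proof -
  obtain n m where nm: "n > 0" "fits p n" "m > 0" "fits q m" using ex_fits assms by metis
  \<comment> \<open>Both paths are cut into equally many pieces, so that the \<open>N + N\<close>
    equal pieces of the joined path are exactly theirs.\<close>
  define N where "N = n * m"
  have N: "N > 0" "fits p N" "fits q N"
    using nm fits_refine[of p n m] fits_refine[of q m n] by (auto simp: N_def mult.commute)
  have left: "(p +++ q) (k / real (N + N)) = p (k / N)" if "k \<le> N" for k
    using that N(1) by (auto simp: joinpaths_def field_simps)
  have right: "(p +++ q) (real (N + k) / real (N + N)) = q (k / N)" if "k \<le> N" for k
  proof (cases "k = 0")
    case True
    then show ?thesis using N(1) assms(5) by (simp add: joinpaths_def pathstart_def pathfinish_def)
  next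
    case False
    then show ?thesis using N(1) by (simp add: joinpaths_def field_simps)
  qed
  have "fits (p +++ q) (N + N)" unfolding fits_def
  proof (intro allI impI)
    fix k assume k: "k < N + N"
    show "\<exists>U\<in>\<U>. (p +++ q) ` {k / real (N + N) .. Suc k / real (N + N)} \<subseteq> U"
    proof (cases "k < N")
      case True
      then obtain U where U: "U \<in> \<U>" "p ` {k / N .. Suc k / N} \<subseteq> U"
        using N(2) unfolding fits_def by blast
      have "(p +++ q) t \<in> U" if "t \<in> {k / real (N + N) .. Suc k / real (N + N)}" for t
      proof -
        have t: "2 * t \<in> {k / N .. Suc k / N}" using that N(1) by (auto simp: field_simps)
        moreover have "Suc k / real N \<le> 1"
          using True N(1) by (simp add: field_simps flip: of_nat_Suc)
        ultimately have "2 * t \<le> 1" by simp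
        note t this
        with U(2) show ?thesis by (auto simp: joinpaths_def)
      qed
      then show ?thesis using U(1) by blast
    next
      case False
      define j where "j = k - N"
      have j: "k = N + j" "j < N" using False k by (auto simp: j_def)
      then obtain U where U: "U \<in> \<U>" "q ` {j / N .. Suc j / N} \<subseteq> U"
        using N(3) unfolding fits_def by blast
      have "(p +++ q) t \<in> U" if "t \<in> {k / real (N + N) .. Suc k / real (N + N)}" for t
      proof -
        have t: "2 * t - 1 \<in> {j / N .. Suc j / N}" using that j N(1) by (auto simp: field_simps)
        then have "j / N \<le> 2 * t - 1" by simp
        then have "0 \<le> 2 * t - 1" by (rule order_trans[rotated]) simp
        then have t1: "2 * t \<ge> 1" by simp
        have "(p +++ q) t = q (2 * t - 1)"
        proof (cases "2 * t = 1")
          case True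
          then show ?thesis
            using assms(5) by (auto simp: joinpaths_def pathstart_def pathfinish_def)
        next
          case False
          then show ?thesis using t1 by (auto simp: joinpaths_def)
        qed
        with t U(2) show ?thesis by auto
      qed
      then show ?thesis using U(1) by blast
    qed
  qed
  then have "hol (p +++ q) = subdiv_prod (p +++ q) (N + N)" using N(1) by (intro hol_eq) auto
  also have "\<dots> = chain_prod (\<lambda>k. (p +++ q) (k / real (N + N))) N \<otimes>
      chain_prod (\<lambda>k. (p +++ q) (real (N + k) / real (N + N))) N"
    unfolding subdiv_prod_def by (rule chain_prod_add)
  also have "\<dots> = subdiv_prod p N \<otimes> subdiv_prod q N" unfolding subdiv_prod_def
    using chain_prod_cong[of N "\<lambda>k. (p +++ q) (k / real (N + N))", OF left]
      chain_prod_cong[of N "\<lambda>k. (p +++ q) (real (N + k) / real (N + N))", OF right]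
    by simp
  also have "\<dots> = hol p \<otimes> hol q" using N by (simp add: hol_eq)
  finally show ?thesis .
qed

text \<open>The square is cut into cells that each map into one member of the cover. Neighbouring
  rows form a ladder whose end rungs are trivial because the end points stay fixed.\<close>

theorem hol_homotopic:
  assumes "homotopic_paths (\<Union>\<U>) p q"
  shows "hol p = hol q"
proof -
  let ?sq = "{0..1::real} \<times> {0..1::real}"
  obtain h where h: "continuous_on ?sq h" "h \<in> ?sq \<rightarrow> \<Union>\<U>"
      "\<And>x. x \<in> {0..1} \<Longrightarrow> h (0, x) = p x" "\<And>x. x \<in> {0..1} \<Longrightarrow> h (1, x) = q x"
      "\<And>t. t \<in> {0..1} \<Longrightarrow> pathstart (h \<circ> Pair t) = pathstart p"
      "\<And>t. t \<in> {0..1} \<Longrightarrow> pathfinish (h \<circ> Pair t) = pathfinish p"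
    using assms unfolding homotopic_paths by blast
  obtain \<delta> where \<delta>: "\<delta> > 0" "\<And>z. z \<in> ?sq \<Longrightarrow> \<exists>U\<in>\<U>. h ` (?sq \<inter> ball z \<delta>) \<subseteq> U"
    using Lebesgue_number_continuous_on[of ?sq h \<U>] h(1,2) open_cover
    by (metis compact_Icc compact_Times image_subset_iff_funcset)
  obtain n :: nat where n: "n > 0" "1 / n < \<delta> / 2"
    using real_arch_inverse[of "\<delta> / 2"] \<delta>(1) by (auto simp: field_simps)
  have cell: "\<exists>U\<in>\<U>. h ` ({i / n .. Suc i / n} \<times> {k / n .. Suc k / n}) \<subseteq> U" if "i < n" "k < n" for i k
  proof -
    have *: "i / n + 1 / n \<le> 1" "k / n + 1 / n \<le> 1" using that n by (simp_all add: field_simps)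
    then obtain U where U: "U \<in> \<U>" "h ` (?sq \<inter> ball (i / n, k / n) \<delta>) \<subseteq> U"
      using \<delta>(2)[of "(i / n, k / n)"] that n by (auto simp: field_simps)
    have "z \<in> ?sq \<inter> ball (i / n, k / n) \<delta>"
      if "z \<in> {i / n .. Suc i / n} \<times> {k / n .. Suc k / n}" for z
    proof -
      obtain s t where z: "z = (s, t)" by (cases z)
      have st: "i / n \<le> s" "s \<le> i / n + 1 / n" "k / n \<le> t" "t \<le> k / n + 1 / n"
        using that z by (auto simp: add_divide_distrib)
      have "dist (i / n, k / n) z \<le> dist (i / n) s + dist (k / n) t"
        unfolding z dist_Pair_Pair by (rule sqrt_sum_squares_le_sum) auto
      also have "\<dots> < \<delta>" using st n by (simp add: dist_real_def)
      finally have "z \<in> ball (i / n, k / n) \<delta>" by simp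
      moreover have "0 \<le> i / n" "0 \<le> k / n" by auto
      then have "0 \<le> s" "0 \<le> t" "s \<le> 1" "t \<le> 1" using st * by linarith+
      ultimately show ?thesis using z by simp
    qed
    then show ?thesis using U by (meson image_mono order_trans subsetI)
  qed
  define r where "r i = (\<lambda>t. h (real i / n, t))" for i
  have i01: "real i / n \<in> {0..1}" if "i \<le> n" for i using that n(1) by auto
  have ends: "r i 0 = p 0" "r i 1 = p 1" if "i \<le> n" for i
    using h(5,6)[OF i01[OF that]] by (auto simp: r_def pathstart_def pathfinish_def)
  have in_S: "p 0 \<in> \<Union>\<U>" "p 1 \<in> \<Union>\<U>"
    using h(2,3) by (metis PiE SigmaI atLeastAtMost_iff le_numeral_extra(3,4) zero_le_one)+
  have step: "subdiv_prod (r i) n = subdiv_prod (r (Suc i)) n" if "i < n" for i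
  proof -
    have "\<exists>U\<in>\<U>. {r i (k / n), r i (Suc k / n), r (Suc i) (k / n), r (Suc i) (Suc k / n)} \<subseteq> U"
      if "k < n" for k
    proof -
      obtain U where "U \<in> \<U>" "h ` ({i / n .. Suc i / n} \<times> {k / n .. Suc k / n}) \<subseteq> U"
        using cell \<open>i < n\<close> \<open>k < n\<close> by blast
      moreover have "real i / n \<le> Suc i / n" "k / n \<le> Suc k / n" by (auto simp: divide_right_mono)
      ultimately show ?thesis by (intro bexI[of _ U]) (auto simp: r_def image_subset_iff)
    qed
    then have "c (r i 0) (r (Suc i) 0) \<otimes> subdiv_prod (r (Suc i)) n = subdiv_prod (r i) n \<otimes> c (r i 1) (r (Suc i) 1)"
      using chain_prod_ladder[of n "\<lambda>k. r i (k / n)" "\<lambda>k. r (Suc i) (k / n)"] n(1)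
      by (simp add: subdiv_prod_def)
    then show ?thesis using that in_S by (simp add: ends c_refl subdiv_prod_def)
  qed
  have "subdiv_prod (r 0) n = subdiv_prod (r i) n" if "i \<le> n" for i
    using that by (induction i) (auto simp: step)
  then have eq: "subdiv_prod (r 0) n = subdiv_prod (r n) n" by simp
  have fits_r: "fits (r i) n" if "i \<le> n" for i unfolding fits_def
  proof (intro allI impI)
    fix k assume k: "k < n"
    \<comment> \<open>There is no cell of index \<open>n\<close>, so row \<open>n\<close> is treated
      as the far side of the cells of index \<open>n - 1\<close>.\<close>
    define j where "j = (if i < n then i else n - 1)"
    have j: "j < n" using that n(1) by (auto simp: j_def)
    have "i = j \<or> i = Suc j" using that n(1) by (auto simp: j_def)
    then have "real i / n \<in> {j / n .. Suc j / n}" by (auto simp: divide_right_mono)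
    moreover obtain U where "U \<in> \<U>" "h ` ({j / n .. Suc j / n} \<times> {k / n .. Suc k / n}) \<subseteq> U"
      using cell[OF j k] by blast
    ultimately have "r i ` {k / n .. Suc k / n} \<subseteq> U" "U \<in> \<U>" by (force simp: r_def)+
    then show "\<exists>U\<in>\<U>. r i ` {k / n .. Suc k / n} \<subseteq> U" by blast
  qed
  have "hol p = hol (r 0)" "hol q = hol (r n)"
    using h(3,4) n(1) by (auto intro!: hol_cong simp: r_def)
  then show ?thesis using eq hol_eq[OF fits_r n(1)] by simp
qed

text \<open>A gauge change: \<open>T\<close> alters the cocycle by an endomorphism and a coboundary,
  whose inner factors telescope along the path and leave only those at the ends. The cases of
  interest are lattice translations and negation.\<close>

lemma hol_transform:
  assumes "path p" "path_image p \<subseteq> \<Union>\<U>" "f \<in> hom G G" "\<And>u. k u \<in> carrier G"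
    and T: "\<And>U. U \<in> \<U> \<Longrightarrow> \<exists>V\<in>\<U>. T ` U \<subseteq> V"
    and cT: "\<And>U u v. U \<in> \<U> \<Longrightarrow> u \<in> U \<Longrightarrow> v \<in> U \<Longrightarrow> c (T u) (T v) = inv (k u) \<otimes> f (c u v) \<otimes> k v"
  shows "hol (T \<circ> p) = inv (k (pathstart p)) \<otimes> f (hol p) \<otimes> k (pathfinish p)"
proof -
  interpret f: group_hom G G f
    using assms(3) by unfold_locales
  obtain n where n: "n > 0" "fits p n" using ex_fits assms by metis
  have "fits (T \<circ> p) n" unfolding fits_def image_comp[symmetric]
  proof (intro allI impI)
    fix j assume "j < n"
    then obtain U where "U \<in> \<U>" "p ` {j / n .. Suc j / n} \<subseteq> U"
      using n(2) unfolding fits_def by blast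
    then show "\<exists>V\<in>\<U>. T ` (p ` {j / n .. Suc j / n}) \<subseteq> V"
      using T by (meson image_mono order_trans)
  qed
  moreover have "chain_prod (\<lambda>j. T (p (j / n))) m =
      inv (k (p 0)) \<otimes> f (chain_prod (\<lambda>j. p (j / n)) m) \<otimes> k (p (m / n))" if "m \<le> n" for m
    using that
  proof (induction m)
    case 0
    then show ?case using assms(4) by simp
  next
    case (Suc m)
    then obtain U where U: "U \<in> \<U>" "p ` {m / n .. Suc m / n} \<subseteq> U"
      using n(2) unfolding fits_def by (meson Suc_le_lessD)
    then have "p (m / n) \<in> U" "p (Suc m / n) \<in> U" by (auto simp: divide_right_mono image_subset_iff)
    note c = cT[OF U(1) this]
    have "k (p (m / n)) \<otimes> (inv k (p (m / n)) \<otimes> x) = x" if "x \<in> carrier G" for x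
      using that assms(4) by (simp flip: m_assoc)
    with c Suc assms(4) show ?case
      by (simp add: m_assoc del: of_nat_Suc)
  qed
  ultimately show ?thesis using n by (simp add: hol_eq subdiv_prod_def pathstart_def pathfinish_def)
qed

end

section \<open>The plane punctured at the grid points\<close>

definition grid :: "complex set" where
  "grid = {z. Re z \<in> \<int> \<and> Im z \<in> \<int>}"

lemma grid_0 [simp]: "0 \<in> grid"
  by (simp add: grid_def)

lemma grid_minus_iff [simp]: "- z \<in> grid \<longleftrightarrow> z \<in> grid"
  by (simp add: grid_def)

lemma grid_add: "z \<in> grid \<Longrightarrow> w \<in> grid \<Longrightarrow> z + w \<in> grid"
  by (simp add: grid_def)

lemma grid_diff: "z \<in> grid \<Longrightarrow> w \<in> grid \<Longrightarrow> z - w \<in> grid"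
  by (simp add: grid_def)

lemma grid_add_iff [simp]:
  "w \<in> grid \<Longrightarrow> z + w \<in> grid \<longleftrightarrow> z \<in> grid"
  "w \<in> grid \<Longrightarrow> w + z \<in> grid \<longleftrightarrow> z \<in> grid"
  using grid_diff[of "z + w" w] grid_add[of z w] by (auto simp: add.commute)

section \<open>Strips between adjacent grid lines\<close>

definition Re_strip :: "int \<Rightarrow> complex set" where
  "Re_strip n = {z. n < Re z \<and> Re z < n + 1}"

definition Im_strip :: "int \<Rightarrow> complex set" where
  "Im_strip n = {z. n < Im z \<and> Im z < n + 1}"

text \<open>A vertical strip meets only horizontal grid lines and a horizontal strip only vertical
  ones, so the crossings inside a strip involve a single generator.\<close>

definition strips :: "complex set set" where
  "strips = range Re_strip \<union> range Im_strip"

lemma strip_cases: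
  assumes "U \<in> strips"
  obtains n where "U = Re_strip n" | n where "U = Im_strip n"
  using assms by (auto simp: strips_def)

lemma strips_intros [intro]: "Re_strip n \<in> strips" "Im_strip n \<in> strips"
  by (auto simp: strips_def)

lemma floor_Re_strip: "u \<in> Re_strip n \<Longrightarrow> \<lfloor>Re u\<rfloor> = n"
  by (auto simp: Re_strip_def floor_eq_iff)

lemma floor_Im_strip: "u \<in> Im_strip n \<Longrightarrow> \<lfloor>Im u\<rfloor> = n"
  by (auto simp: Im_strip_def floor_eq_iff)

lemma in_Re_strip: "Re u \<notin> \<int> \<Longrightarrow> u \<in> Re_strip \<lfloor>Re u\<rfloor>"
  unfolding Re_strip_def by simp (metis Ints_of_int floor_correct less_eq_real_def)

lemma in_Im_strip: "Im u \<notin> \<int> \<Longrightarrow> u \<in> Im_strip \<lfloor>Im u\<rfloor>"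
  unfolding Im_strip_def by simp (metis Ints_of_int floor_correct less_eq_real_def)

lemma no_int_between:
  assumes "of_int n < (x::real)" "x < of_int n + 1"
  shows "x \<notin> \<int>"
proof
  assume "x \<in> \<int>"
  then obtain m where m: "x = of_int m" by (rule Ints_cases)
  have "n < m" using assms(1) unfolding m of_int_less_iff .
  moreover have "of_int m < (of_int (n + 1) :: real)" using assms(2) unfolding m by simp
  then have "m < n + 1" unfolding of_int_less_iff .
  ultimately show False by simp
qed

lemma Union_strips: "\<Union>strips = - grid"
proof
  show "\<Union>strips \<subseteq> - grid"
    using no_int_between by (auto simp: strips_def Re_strip_def Im_strip_def grid_def)
  show "- grid \<subseteq> \<Union>strips"
  proof
    fix u assume "u \<in> - grid"
    then have "u \<in> Re_strip \<lfloor>Re u\<rfloor> \<or> u \<in> Im_strip \<lfloor>Im u\<rfloor>"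
      using in_Re_strip in_Im_strip by (auto simp: grid_def)
    then show "u \<in> \<Union>strips" by (auto simp: strips_def)
  qed
qed

lemma strip_subset: "U \<in> strips \<Longrightarrow> U \<subseteq> - grid"
  using Union_strips by blast

lemma Re_strip_halfspaces: "Re_strip n = {z. n < Re z} \<inter> {z. Re z < n + 1}"
  by (auto simp: Re_strip_def)

lemma Im_strip_halfspaces: "Im_strip n = {z. n < Im z} \<inter> {z. Im z < n + 1}"
  by (auto simp: Im_strip_def)

lemma open_strip: "U \<in> strips \<Longrightarrow> open U"
  by (elim strip_cases) (simp_all add: Re_strip_halfspaces Im_strip_halfspaces open_Int
      open_halfspace_Re_gt open_halfspace_Re_lt open_halfspace_Im_gt open_halfspace_Im_lt)

lemma convex_strip: "U \<in> strips \<Longrightarrow> convex U"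
  by (auto elim!: strip_cases simp: Re_strip_halfspaces Im_strip_halfspaces
      convex_halfspace_Re_gt convex_halfspace_Re_lt convex_halfspace_Im_gt convex_halfspace_Im_lt
      intro!: convex_Int)

text \<open>Vertical lines count as \<open>x\<close>, horizontal ones as \<open>y\<close>. Inside a
  strip one exponent vanishes, so no order of the crossings has to be decided. By the floor, a point
  on a grid line belongs to the cell to its right or above it.\<close>

definition crossing :: "complex \<Rightarrow> complex \<Rightarrow> (xy \<times> bool) list" where
  "crossing u v = free_gen Gx [^]\<^bsub>F_xy\<^esub> (\<lfloor>Re v\<rfloor> - \<lfloor>Re u\<rfloor>) \<cdot> free_gen Gy [^]\<^bsub>F_xy\<^esub> (\<lfloor>Im v\<rfloor> - \<lfloor>Im u\<rfloor>)"

lemma crossing_closed [simp]: "crossing u v \<in> carrier F_xy"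
  by (simp only: crossing_def F.m_closed F.int_pow_closed free_gen_carrier)

lemma crossing_Re_strip:
  "u \<in> Re_strip n \<Longrightarrow> v \<in> Re_strip n \<Longrightarrow> crossing u v = free_gen Gy [^]\<^bsub>F_xy\<^esub> (\<lfloor>Im v\<rfloor> - \<lfloor>Im u\<rfloor>)"
  by (simp add: crossing_def floor_Re_strip)

lemma crossing_Im_strip:
  "u \<in> Im_strip n \<Longrightarrow> v \<in> Im_strip n \<Longrightarrow> crossing u v = free_gen Gx [^]\<^bsub>F_xy\<^esub> (\<lfloor>Re v\<rfloor> - \<lfloor>Re u\<rfloor>)"
  by (simp add: crossing_def floor_Im_strip)

interpretation H: local_cocycle F_xy strips crossing
proof
  have diff: "free_gen a [^]\<^bsub>F_xy\<^esub> (j - i) \<cdot> free_gen a [^]\<^bsub>F_xy\<^esub> (k - j) = free_gen a [^]\<^bsub>F_xy\<^esub> (k - i)"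
    for a and i j k :: int
    unfolding F.int_pow_mult[OF free_gen_carrier, symmetric] by simp
  show "crossing u v \<cdot> crossing v w = crossing u w"
    if "U \<in> strips" "u \<in> U" "v \<in> U" "w \<in> U" for U u v w
    using that(1)
  proof (cases rule: strip_cases)
    case (1 n)
    then show ?thesis using that diff by (simp only: crossing_Re_strip[of _ n])
  next
    case (2 n)
    then show ?thesis using that diff by (simp only: crossing_Im_strip[of _ n])
  qed
qed (simp_all add: open_strip)

abbreviation hol :: "(real \<Rightarrow> complex) \<Rightarrow> (xy \<times> bool) list" where
  "hol \<equiv> H.hol"

definition floor_point :: "complex \<Rightarrow> complex" where
  "floor_point u = Complex \<lfloor>Re u\<rfloor> \<lfloor>Im u\<rfloor>"

lemma word_shift_crossing: "word_shift (crossing u v) = floor_point v - floor_point u"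
  by (simp add: crossing_def word_shift_mult word_shift_power floor_point_def complex_eq_iff)

lemma word_shift_chain_prod:
  "word_shift (H.chain_prod f n) = floor_point (f n) - floor_point (f 0)"
  by (induction n) (simp_all add: word_shift_mult word_shift_crossing)

lemma word_shift_hol: 
  assumes "path p" "path_image p \<subseteq> - grid"
  shows "word_shift (hol p) = floor_point (pathfinish p) - floor_point (pathstart p)"
proof -
  obtain n where "n > 0" "H.fits p n" using H.ex_fits assms unfolding Union_strips by metis
  then show ?thesis
    by (simp add: H.hol_eq H.subdiv_prod_def word_shift_chain_prod pathfinish_def pathstart_def)
qed

lemma floor_point_add: "k \<in> grid \<Longrightarrow> floor_point (u + k) = floor_point u + k"
  by (auto simp: floor_point_def grid_def complex_eq_iff elim!: Ints_cases)

text \<open>Both end points have the same offset within their cells, so the rounding in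
  \<open>word_shift_hol\<close> cancels. This ties the displacement of the second coordinate of a
  braid to its word.\<close>

lemma word_shift_hol_loop:
  assumes "path p" "path_image p \<subseteq> - grid" "pathfinish p - pathstart p \<in> grid"
  shows "word_shift (hol p) = pathfinish p - pathstart p"
  using floor_point_add[OF assms(3), of "pathstart p"] word_shift_hol[OF assms(1,2)] by simp

lemma word_shift_in_grid [simp]: "word_shift w \<in> grid"
proof (induction w)
  case (Cons l w)
  have "letter_shift l \<in> grid" by (cases "fst l") (auto simp: letter_shift_def grid_def)
  then show ?case using Cons by simp
qed simp

subsection \<open>Paths along words\<close>

abbreviation (input) plane_homotopic :: "(real \<Rightarrow> complex) \<Rightarrow> (real \<Rightarrow> complex) \<Rightarrow> bool" (infix \<open>\<simeq>\<close> 50) where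
  "p \<simeq> q \<equiv> homotopic_paths (- grid) p q"

lemma homotopic_paths_convex:
  fixes p q :: "real \<Rightarrow> 'a::real_normed_vector"
  assumes "convex U" "path p" "path q" "path_image p \<subseteq> U" "path_image q \<subseteq> U"
    "pathstart p = pathstart q" "pathfinish p = pathfinish q"
  shows "homotopic_paths U p q"
proof (rule homotopic_paths_linear)
  fix t :: real assume "t \<in> {0..1}"
  then have "p t \<in> U" "q t \<in> U" using assms(4,5) by (auto simp: path_image_def)
  then show "closed_segment (p t) (q t) \<subseteq> U" using assms(1) by (simp add: closed_segment_subset)
qed (use assms in auto)

section \<open>Cell centres as standard end points\<close>

definition centre :: "complex \<Rightarrow> complex" where
  "centre u = floor_point u + Complex (1/2) (1/2)"

text \<open>A tail joining an arbitrary end point to a lattice path through centres. It stays in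
  every strip that contains \<open>u\<close> and has trivial word.\<close>

definition spoke :: "complex \<Rightarrow> real \<Rightarrow> complex" where
  "spoke u = linepath (centre u) u"

lemma floor_centre [simp]: "\<lfloor>Re (centre u)\<rfloor> = \<lfloor>Re u\<rfloor>" "\<lfloor>Im (centre u)\<rfloor> = \<lfloor>Im u\<rfloor>"
  by (simp_all add: centre_def floor_point_def floor_eq_iff)

lemma centre_strips: "centre u \<in> Re_strip \<lfloor>Re u\<rfloor>" "centre u \<in> Im_strip \<lfloor>Im u\<rfloor>"
  by (simp_all add: centre_def floor_point_def Re_strip_def Im_strip_def)

lemma centre_Re_strip: "u \<in> Re_strip n \<Longrightarrow> centre u \<in> Re_strip n"
  using centre_strips(1)[of u] by (simp add: floor_Re_strip)

lemma centre_Im_strip: "u \<in> Im_strip n \<Longrightarrow> centre u \<in> Im_strip n"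
  using centre_strips(2)[of u] by (simp add: floor_Im_strip)

lemma centre_add: "k \<in> grid \<Longrightarrow> centre (u + k) = centre u + k"
  by (simp add: centre_def floor_point_add)

lemma spoke_ends [simp]: "path (spoke u)" "pathstart (spoke u) = centre u" "pathfinish (spoke u) = u"
  by (simp_all add: spoke_def)

lemma spoke_strip: "U \<in> strips \<Longrightarrow> u \<in> U \<Longrightarrow> path_image (spoke u) \<subseteq> U"
  unfolding spoke_def path_image_linepath
  by (rule closed_segment_subset) (auto elim!: strip_cases simp: centre_Re_strip centre_Im_strip convex_strip strips_intros)

lemma strip_of:
  assumes "u \<notin> grid" obtains U where "U \<in> strips" "u \<in> U" "centre u \<in> U"
proof -
  obtain U where U: "U \<in> strips" "u \<in> U" using assms Union_strips by (metis ComplI UnionE)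
  then have "centre u \<in> U" by (auto elim!: strip_cases simp: centre_Re_strip centre_Im_strip)
  with U that show thesis by blast
qed

lemma spoke_subset: "u \<notin> grid \<Longrightarrow> path_image (spoke u) \<subseteq> - grid"
  using strip_of spoke_strip strip_subset by (metis order_trans)

lemma crossing_same_cell: "\<lfloor>Re u\<rfloor> = \<lfloor>Re v\<rfloor> \<Longrightarrow> \<lfloor>Im u\<rfloor> = \<lfloor>Im v\<rfloor> \<Longrightarrow> crossing u v = \<one>\<^bsub>F_xy\<^esub>"
  by (simp add: crossing_def)

lemma hol_spoke:
  assumes "u \<notin> grid"
  shows "hol (spoke u) = \<one>\<^bsub>F_xy\<^esub>" "hol (reversepath (spoke u)) = \<one>\<^bsub>F_xy\<^esub>"
proof -
  obtain U where "U \<in> strips" "u \<in> U" using strip_of assms by metis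
  then show "hol (spoke u) = \<one>\<^bsub>F_xy\<^esub>" "hol (reversepath (spoke u)) = \<one>\<^bsub>F_xy\<^esub>"
    using spoke_strip by (simp_all add: H.hol_within[of _ U] crossing_same_cell)
qed

primrec word_path :: "complex \<Rightarrow> (xy \<times> bool) list \<Rightarrow> real \<Rightarrow> complex" where
  "word_path q [] = linepath q q"
| "word_path q (l # w) = linepath q (q + letter_shift l) +++ word_path (q + letter_shift l) w"

lemma pathstart_word_path [simp]: "pathstart (word_path q w) = q"
  by (cases w) auto

lemma pathfinish_word_path [simp]: "pathfinish (word_path q w) = q + word_shift w"
  by (induction w arbitrary: q) auto

lemma path_word_path [simp]: "path (word_path q w)"
  by (induction w arbitrary: q) auto

definition is_centre :: "complex \<Rightarrow> bool" where
  "is_centre q \<longleftrightarrow> centre q = q"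

lemma is_centre_centre [simp]: "is_centre (centre u)"
  by (simp add: is_centre_def centre_def[of "centre u"]) (simp add: centre_def floor_point_def floor_eq_iff)

lemma letter_shift_in_grid [simp]: "letter_shift l \<in> grid"
  using word_shift_in_grid[of "[l]"] by simp

lemma is_centre_shift: "is_centre q \<Longrightarrow> is_centre (q + letter_shift l)"
  by (simp add: is_centre_def centre_add)

lemma letter_strip:
  assumes "is_centre q"
  obtains U where "U \<in> strips" "q \<in> U" "q + letter_shift l \<in> U"
proof (cases "fst l")
  case Gx
  then have "Im (q + letter_shift l) = Im q" by (simp add: letter_shift_def)
  moreover have "q \<in> Im_strip \<lfloor>Im q\<rfloor>"
    using centre_strips(2)[of q] assms by (simp add: is_centre_def)
  ultimately show ?thesis
    by (intro that[of "Im_strip \<lfloor>Im q\<rfloor>"] strips_intros) (simp_all add: Im_strip_def)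
next
  case Gy
  then have "Re (q + letter_shift l) = Re q" by (simp add: letter_shift_def)
  moreover have "q \<in> Re_strip \<lfloor>Re q\<rfloor>"
    using centre_strips(1)[of q] assms by (simp add: is_centre_def)
  ultimately show ?thesis
    by (intro that[of "Re_strip \<lfloor>Re q\<rfloor>"] strips_intros) (simp_all add: Re_strip_def)
qed

lemma letter_path_subset:
  "is_centre q \<Longrightarrow> path_image (linepath q (q + letter_shift l)) \<subseteq> - grid"
  by (metis letter_strip convex_strip closed_segment_subset path_image_linepath strip_subset order_trans)

lemma word_path_subset: "is_centre q \<Longrightarrow> path_image (word_path q w) \<subseteq> - grid"
proof (induction w arbitrary: q)
  case Nil
  then show ?case using letter_path_subset[of q undefined] by auto
next
  case (Cons l w)
  then show ?case
    using letter_path_subset[of q l] is_centre_shift[of q l] by (auto simp: path_image_join)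
qed

lemma word_path_strip:
  assumes "fst ` set w \<subseteq> {a}" "q \<in> U"
    "a = Gx \<and> U = Im_strip n \<or> a = Gy \<and> U = Re_strip n"
  shows "path_image (word_path q w) \<subseteq> U"
  using assms(1,2)
proof (induction w arbitrary: q)
  case (Cons l w)
  have shift: "q + letter_shift l \<in> U"
    using assms(3) Cons.prems by (auto simp: letter_shift_def Im_strip_def Re_strip_def)
  moreover have "convex U" using assms(3) convex_strip by blast
  ultimately have "closed_segment q (q + letter_shift l) \<subseteq> U"
    using Cons.prems by (simp add: closed_segment_subset)
  then show ?case using Cons shift by (auto simp: path_image_join)
qed auto

text \<open>A cancelling pair of letters is a segment traversed forth and back, hence
  contractible.\<close>

lemma word_path_push_letter:
  assumes "is_centre q"
  shows "word_path q (l # w) \<simeq> word_path q (push_letter l w)"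
proof (cases "\<exists>w'. w = letter_inv l # w'")
  case True
  then obtain w' where w: "w = letter_inv l # w'" by blast
  let ?l = "linepath q (q + letter_shift l)" and ?p = "word_path q w'"
  have l: "path_image ?l \<subseteq> - grid" and p: "path_image ?p \<subseteq> - grid"
    using assms by (simp_all only: letter_path_subset word_path_subset)
  have rev: "linepath (q + letter_shift l) q = reversepath ?l" by simp
  have "?l +++ (reversepath ?l +++ ?p) \<simeq> (?l +++ reversepath ?l) +++ ?p"
    by (rule homotopic_paths_assoc) (use l p in \<open>auto simp del: path_image_linepath reversepath_linepath\<close>)
  also have "\<dots> \<simeq> linepath q q +++ ?p" by (rule homotopic_paths_join)
      (use homotopic_paths_rinv[of ?l "- grid"] l p in \<open>auto simp del: path_image_linepath reversepath_linepath\<close>)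
  also have "\<dots> \<simeq> ?p" by (rule homotopic_paths_lid') (use p in auto)
  finally show ?thesis by (simp add: w)
next
  case False
  then have "push_letter l w = l # w" by (cases w) auto
  then show ?thesis using word_path_subset[OF assms, of "l # w"] by (simp del: word_path.simps)
qed

lemma word_path_mult:
  assumes "is_centre q"
  shows "word_path q u +++ word_path (q + word_shift u) w \<simeq> word_path q (u \<cdot> w)"
  using assms unfolding free_group_simps
proof (induction u arbitrary: q)
  case Nil
  then show ?case
    using homotopic_paths_lid'[of "word_path q w" "- grid" q] word_path_subset by (simp del: linepath_trivial)
next
  case (Cons l u)
  let ?q = "q + letter_shift l"
  have c: "is_centre ?q" by (rule is_centre_shift[OF Cons.prems])
  have l: "path_image (linepath q ?q) \<subseteq> - grid" using Cons.prems by (rule letter_path_subset)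
  have c2: "is_centre (?q + word_shift u)"
    using c by (simp add: is_centre_def centre_add del: centre_def)
  note sub = l word_path_subset[OF c] word_path_subset[OF c2]
  have "(linepath q ?q +++ word_path ?q u) +++ word_path (?q + word_shift u) w \<simeq> linepath q ?q +++ (word_path ?q u +++ word_path (?q + word_shift u) w)"
    by (subst homotopic_paths_sym_eq, rule homotopic_paths_assoc) (use sub in auto)
  also have "\<dots> \<simeq> linepath q ?q +++ word_path ?q (foldr push_letter u w)"
    by (rule homotopic_paths_join) (use Cons.IH[OF c] l in auto)
  also have "\<dots> = word_path q (l # foldr push_letter u w)" by simp
  also have "\<dots> \<simeq> word_path q (push_letter l (foldr push_letter u w))"
    by (rule word_path_push_letter[OF Cons.prems])
  finally show ?case by (simp add: add.assoc)
qed

text \<open>The word is a power of one generator, so the lattice path runs in the same strip, and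
  convexity of the strip supplies the homotopy.\<close>

lemma homotopic_within_strip:
  assumes "U \<in> strips" "path p" "path_image p \<subseteq> U"
  defines "u \<equiv> pathstart p" and "v \<equiv> pathfinish p"
  shows "spoke u +++ p \<simeq> word_path (centre u) (crossing u v) +++ spoke v"
proof -
  have uv: "u \<in> U" "v \<in> U" using assms(3) by (auto simp: u_def v_def)
  have shift: "centre u + word_shift (crossing u v) = centre v"
    by (simp add: word_shift_crossing centre_def)
  have "path_image (word_path (centre u) (crossing u v)) \<subseteq> U" using assms(1)
  proof (cases rule: strip_cases)
    case (1 n)
    then show ?thesis
      using word_path_strip[of "crossing u v" Gy "centre u" U n] uv free_gen_power_letters
      by (simp add: crossing_Re_strip centre_Re_strip)
  next
    case (2 n)
    then show ?thesis
      using word_path_strip[of "crossing u v" Gx "centre u" U n] uv free_gen_power_letters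
      by (simp add: crossing_Im_strip centre_Im_strip)
  qed
  then have "homotopic_paths U (spoke u +++ p) (word_path (centre u) (crossing u v) +++ spoke v)"
    using spoke_strip[OF assms(1)] uv assms(2,3) shift
    by (intro homotopic_paths_convex convex_strip[OF assms(1)]) (auto simp: path_image_join u_def v_def)
  then show ?thesis using strip_subset[OF assms(1)] by (rule homotopic_paths_subset)
qed

text \<open>Normal form of a path. The pieces lying in strips are replaced one after the other, and
  the spoke is carried along from each subdivision point to the next.\<close>

proposition homotopic_word_path:
  assumes "path p" "path_image p \<subseteq> - grid"
  shows "spoke (pathstart p) +++ p \<simeq> word_path (centre (pathstart p)) (hol p) +++ spoke (pathfinish p)"
proof -
  obtain n where n: "n > 0" "H.fits p n" using H.ex_fits assms unfolding Union_strips by metis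
  define f where "f k = p (k / n)" for k :: nat
  define q where "q = centre (p 0)"
  have p_in: "p t \<notin> grid" if "t \<in> {0..1}" for t
    using assms(2) that unfolding path_image_def by blast
  have f_in: "f k \<notin> grid" if "k \<le> n" for k using that n p_in by (simp add: f_def)
  have "spoke (p 0) +++ subpath 0 (k / n) p \<simeq> word_path q (H.chain_prod f k) +++ spoke (f k)" if "k \<le> n" for k
    using that
  proof (induction k)
    case 0
    have sp: "path_image (spoke (p 0)) \<subseteq> - grid" using p_in by (simp add: spoke_subset)
    have const: "subpath 0 0 p = linepath (p 0) (p 0)" by (rule subpath_refl)
    have "spoke (p 0) +++ linepath (p 0) (p 0) \<simeq> spoke (p 0)"
      using sp by (intro homotopic_paths_rid') auto
    also have "\<dots> \<simeq> linepath q q +++ spoke (p 0)"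
      using sp by (subst homotopic_paths_sym_eq, intro homotopic_paths_lid') (auto simp: q_def)
    finally show ?case by (simp add: const f_def free_group_simps del: linepath_trivial)
  next
    case (Suc k)
    define r where "r = subpath (k / n) (Suc k / n) p"
    have kn: "k / n \<in> {0..1}" "Suc k / n \<in> {0..1}" "k / n \<le> Suc k / n"
      using Suc.prems n(1) by (auto simp: field_simps)
    obtain U where U: "U \<in> strips" "p ` {k / n .. Suc k / n} \<subseteq> U"
      using n(2) Suc.prems unfolding H.fits_def by (meson Suc_le_lessD)
    have r: "path r" "path_image r \<subseteq> U" "pathstart r = f k" "pathfinish r = f (Suc k)"
      using kn U(2) assms(1)
      by (auto simp: r_def f_def path_subpath path_image_subpath simp del: of_nat_Suc)
    have rL: "path_image r \<subseteq> - grid" using r(2) strip_subset[OF U(1)] by blast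
    let ?s = "subpath 0 (k / n) p"
    have s: "path ?s" "path_image ?s \<subseteq> - grid" "pathstart ?s = p 0" "pathfinish ?s = f k"
      using kn assms path_image_subpath_subset[of 0 "k / n" p] by (auto simp: f_def)
    have fk: "f k \<notin> grid" "f (Suc k) \<notin> grid" "p 0 \<notin> grid" using Suc.prems f_in p_in by auto
    let ?e = "word_path q (H.chain_prod f k)" and ?c = "word_path (centre (f k)) (crossing (f k) (f (Suc k)))"
    have q: "is_centre q" by (simp add: q_def)
    have e_end: "q + word_shift (H.chain_prod f k) = centre (f k)"
      by (simp add: q_def word_shift_chain_prod centre_def f_def)
    have c_end: "centre (f k) + word_shift (crossing (f k) (f (Suc k))) = centre (f (Suc k))"
      by (simp add: word_shift_crossing centre_def)
    note sub = spoke_subset[OF fk(1)] spoke_subset[OF fk(2)] spoke_subset[OF fk(3)]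
      word_path_subset[OF q] word_path_subset[OF is_centre_centre] s r rL e_end c_end
    have "spoke (p 0) +++ subpath 0 (Suc k / n) p \<simeq> spoke (p 0) +++ (?s +++ r)"
      using homotopic_join_subpaths[of p "- grid" 0 "k / n" "Suc k / n"] kn assms sub
      by (intro homotopic_paths_join) (auto simp: r_def homotopic_paths_sym_eq)
    also have "\<dots> \<simeq> (spoke (p 0) +++ ?s) +++ r" by (rule homotopic_paths_assoc) (use sub in auto)
    also have "\<dots> \<simeq> (?e +++ spoke (f k)) +++ r" by (rule homotopic_paths_join) (use sub Suc in auto)
    also have "\<dots> \<simeq> ?e +++ (spoke (f k) +++ r)"
      by (subst homotopic_paths_sym_eq, rule homotopic_paths_assoc) (use sub in auto)
    also have "\<dots> \<simeq> ?e +++ (?c +++ spoke (f (Suc k)))" by (rule homotopic_paths_join)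
        (use sub homotopic_within_strip[OF U(1) r(1,2)] in auto)
    also have "\<dots> \<simeq> (?e +++ ?c) +++ spoke (f (Suc k))"
      by (rule homotopic_paths_assoc) (use sub in auto)
    also have "\<dots> \<simeq> word_path q (H.chain_prod f (Suc k)) +++ spoke (f (Suc k))"
      by (rule homotopic_paths_join)
        (use sub word_path_mult[OF q, of "H.chain_prod f k" "crossing (f k) (f (Suc k))"] in auto)
    finally show ?case .
  qed
  from this[of n] n show ?thesis
    by (simp add: f_def[abs_def] q_def H.hol_eq H.subdiv_prod_def pathstart_def pathfinish_def)
qed

text \<open>Completeness: equal words give equal lattice paths between the same spokes, so the
  normal forms agree, and the initial spoke is then cancelled.\<close>

theorem homotopic_iff_hol:
  assumes "path p" "path_image p \<subseteq> - grid" "path q" "path_image q \<subseteq> - grid"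
    "pathstart p = pathstart q" "pathfinish p = pathfinish q"
  shows "p \<simeq> q \<longleftrightarrow> hol p = hol q"
proof
  assume "p \<simeq> q"
  then show "hol p = hol q" using H.hol_homotopic by (simp add: Union_strips)
next
  assume eq: "hol p = hol q"
  let ?s = "spoke (pathstart p)"
  have start: "pathstart p \<notin> grid" using assms(2) pathstart_in_path_image by blast
  have s: "path_image ?s \<subseteq> - grid" by (rule spoke_subset[OF start])
  have cancel: "reversepath ?s +++ (?s +++ r) \<simeq> r"
    if r: "path r" "path_image r \<subseteq> - grid" "pathstart r = pathstart p" for r
  proof -
    have "reversepath ?s +++ (?s +++ r) \<simeq> (reversepath ?s +++ ?s) +++ r"
      by (rule homotopic_paths_assoc) (use s r in auto)
    also have "\<dots> \<simeq> linepath (pathstart p) (pathstart p) +++ r"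
      by (rule homotopic_paths_join) (use homotopic_paths_linv[of ?s] s r in auto)
    also have "\<dots> \<simeq> r" by (rule homotopic_paths_lid') (use r in auto)
    finally show ?thesis .
  qed
  have "?s +++ p \<simeq> ?s +++ q"
    using homotopic_word_path[OF assms(1,2)] homotopic_word_path[OF assms(3,4)] assms(5,6) eq
    by (metis homotopic_paths_sym homotopic_paths_trans)
  then have "reversepath ?s +++ (?s +++ p) \<simeq> reversepath ?s +++ (?s +++ q)"
    by (rule homotopic_paths_join[rotated]) (use s in auto)
  then show "p \<simeq> q"
    using cancel[of p] cancel[of q] assms by (metis homotopic_paths_sym homotopic_paths_trans)
qed

lemma crossing_letter: "crossing q (q + letter_shift l) = [l]"
proof -
  obtain a b where l: "l = (a, b)" by (cases l)
  have pos: "free_gen z [^]\<^bsub>F_xy\<^esub> (1::int) = [(z, True)]" for z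
    unfolding F.int_pow_1[OF free_gen_carrier] by (simp add: free_gen_def)
  have neg: "free_gen z [^]\<^bsub>F_xy\<^esub> (- 1::int) = [(z, False)]" for z
    unfolding F.int_pow_neg[OF free_gen_carrier] F.int_pow_1[OF free_gen_carrier]
    by (simp add: free_gen_def inv_letter letter_inv_def)
  have one: "\<one>\<^bsub>F_xy\<^esub> \<cdot> [m] = [m]" "[m] \<cdot> \<one>\<^bsub>F_xy\<^esub> = [m]" for m
    by (simp_all only: F.l_one F.r_one letter_in_carrier)
  show ?thesis
  proof (cases a)
    case Gx
    then have "\<lfloor>Re (q + letter_shift l)\<rfloor> - \<lfloor>Re q\<rfloor> = (if b then 1 else - 1)"
      "\<lfloor>Im (q + letter_shift l)\<rfloor> - \<lfloor>Im q\<rfloor> = 0"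
      using floor_of_int[where 'a = real and z = "- 1"] by (simp_all add: l letter_shift_def)
    then show ?thesis
      unfolding crossing_def int_pow_0 using Gx by (cases b) (simp_all only: int_pow_0 if_True if_False pos neg one l)
  next
    case Gy
    then have "\<lfloor>Im (q + letter_shift l)\<rfloor> - \<lfloor>Im q\<rfloor> = (if b then 1 else - 1)"
      "\<lfloor>Re (q + letter_shift l)\<rfloor> - \<lfloor>Re q\<rfloor> = 0"
      using floor_of_int[where 'a = real and z = "- 1"] by (simp_all add: l letter_shift_def)
    then show ?thesis
      unfolding crossing_def int_pow_0 using Gy by (cases b) (simp_all only: int_pow_0 if_True if_False pos neg one l)
  qed
qed

lemma hol_word_path:
  assumes "is_centre q" "reduced w"
  shows "hol (word_path q w) = w"
  using assms
proof (induction w arbitrary: q)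
  case Nil
  then obtain U where "U \<in> strips" "q \<in> U" using letter_strip by metis
  then have "hol (linepath q q) = crossing q q" using H.hol_within[of "linepath q q" U] by simp
  then show ?case by (simp add: crossing_same_cell free_group_simps del: linepath_trivial)
next
  case (Cons l w)
  let ?q = "q + letter_shift l"
  obtain U where U: "U \<in> strips" "q \<in> U" "?q \<in> U" using letter_strip Cons.prems(1) by metis
  then have "hol (linepath q ?q) = [l]"
    using H.hol_within[of "linepath q ?q" U] closed_segment_subset[OF U(2,3) convex_strip[OF U(1)]]
    by (simp add: crossing_letter)
  moreover have "hol (word_path ?q w) = w" using Cons is_centre_shift by (simp add: reduced_Cons)
  ultimately have "hol (word_path q (l # w)) = [l] \<cdot> w"
    using H.hol_join[of "linepath q ?q" "word_path ?q w"] letter_path_subset word_path_subset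
      is_centre_shift Cons.prems(1)
    by (simp add: Union_strips)
  then show ?case using Cons.prems(2) by (simp add: free_group_simps push_letter_reduced)
qed

text \<open>Every word occurs. With \<open>homotopic_iff_hol\<close>, classes of paths from
  \<open>u\<close> to its grid translates correspond bijectively to the free group.\<close>

proposition ex_path_hol:
  assumes "u \<notin> grid" "w \<in> carrier F_xy"
  obtains p where "path p" "path_image p \<subseteq> - grid" "pathstart p = u"
    "pathfinish p = u + word_shift w" "hol p = w"
proof -
  define v where "v = u + word_shift w"
  have v: "v \<notin> grid" "centre v = centre u + word_shift w"
    using assms(1) by (simp_all add: v_def centre_add)
  let ?p = "reversepath (spoke u) +++ word_path (centre u) w +++ spoke v"
  have sub: "path_image (word_path (centre u) w) \<subseteq> - grid" "path_image (spoke u) \<subseteq> - grid"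
    "path_image (spoke v) \<subseteq> - grid"
    using assms(1) v(1) by (simp_all add: word_path_subset spoke_subset)
  have red: "reduced w" using assms(2) by (simp add: carrier_F_xy)
  have "hol ?p = \<one>\<^bsub>F_xy\<^esub> \<cdot> (w \<cdot> \<one>\<^bsub>F_xy\<^esub>)"
    using sub v by (simp add: H.hol_join Union_strips path_image_join hol_spoke assms(1) hol_word_path red)
  then have "hol ?p = w" using assms(2) by (simp only: F.l_one F.r_one)
  moreover have "path ?p" "path_image ?p \<subseteq> - grid" "pathstart ?p = u" "pathfinish ?p = v"
    using sub v by (auto simp: path_image_join)
  ultimately show thesis using that unfolding v_def by blast
qed

section \<open>Fundamental groups of abstract topologies\<close>

lemma prod_topology_top_of_set: "prod_topology (top_of_set A) (top_of_set B) = top_of_set (A \<times> B)"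
  by (simp add: prod_topology_subtopology flip: euclidean_product_topology)
    (simp add: subtopology_subtopology Times_Int_Times)

lemma loop_homotopic_imp_loops:
  assumes "loop_homotopic X b p q"
  shows "p \<in> loops_at X b" "q \<in> loops_at X b"
  using homotopic_with_imp_continuous_maps[OF assms[unfolded loop_homotopic_def]]
    homotopic_with_imp_property[OF assms[unfolded loop_homotopic_def]]
  by (auto simp: loops_at_def pathin_def)

lemma loop_homotopic_refl: "p \<in> loops_at X b \<Longrightarrow> loop_homotopic X b p p"
  by (simp add: loop_homotopic_def loops_at_def pathin_def)

lemma loop_homotopic_sym: "loop_homotopic X b p q \<Longrightarrow> loop_homotopic X b q p"
  unfolding loop_homotopic_def by (simp add: homotopic_with_sym)

lemma loop_homotopic_trans [trans]:
  "loop_homotopic X b p q \<Longrightarrow> loop_homotopic X b q r \<Longrightarrow> loop_homotopic X b p r"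
  unfolding loop_homotopic_def by (rule homotopic_with_trans)

lemma loop_homotopic_cong:
  assumes "p \<in> loops_at X b" "\<And>t. t \<in> {0..1} \<Longrightarrow> p t = q t"
  shows "loop_homotopic X b p q"
  unfolding loop_homotopic_def
  by (rule homotopic_with_equal) (use assms in \<open>force simp: loops_at_def pathin_def\<close>)+

lemma loop_class_eq_iff:
  assumes "p \<in> loops_at X b" "q \<in> loops_at X b"
  shows "loop_class X b p = loop_class X b q \<longleftrightarrow> loop_homotopic X b p q"
proof
  assume "loop_class X b p = loop_class X b q"
  then show "loop_homotopic X b p q"
    using loop_homotopic_refl[OF assms(2)] assms(2) by (auto simp: loop_class_def)
next
  assume "loop_homotopic X b p q"
  then show "loop_class X b p = loop_class X b q"
    unfolding loop_class_def by (blast intro: loop_homotopic_trans loop_homotopic_sym)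
qed

lemma loop_class_eqI: "loop_homotopic X b p q \<Longrightarrow> loop_class X b p = loop_class X b q"
  using loop_class_eq_iff loop_homotopic_imp_loops by metis

lemma loop_class_cong:
  assumes "p \<in> loops_at X b" "\<And>t. t \<in> {0..1} \<Longrightarrow> p t = q t"
  shows "loop_class X b p = loop_class X b q"
  using loop_homotopic_cong[OF assms] loop_homotopic_imp_loops(2)[of X b p q]
  by (simp add: loop_class_eq_iff assms(1))

lemma loop_homotopic_compose_paths:
  assumes "homotopic_paths S a a'" "continuous_map (top_of_set S) X f"
    "f (pathstart a) = b" "f (pathfinish a) = b"
  shows "loop_homotopic X b (f \<circ> a) (f \<circ> a')"
  unfolding loop_homotopic_def
  by (rule homotopic_with_compose_continuous_map_left[OF assms(1)[unfolded homotopic_paths_def] assms(2)])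
    (use assms(3,4) in \<open>auto simp: pathstart_def pathfinish_def\<close>)

lemma loop_homotopic_compose:
  assumes "loop_homotopic X b p q" "continuous_map X Y f"
  shows "loop_homotopic Y (f b) (f \<circ> p) (f \<circ> q)"
  unfolding loop_homotopic_def
  by (rule homotopic_with_compose_continuous_map_left[OF assms(1)[unfolded loop_homotopic_def] assms(2)])
    auto

lemma loops_at_compose: "p \<in> loops_at X b \<Longrightarrow> continuous_map X Y f \<Longrightarrow> f \<circ> p \<in> loops_at Y (f b)"
  by (auto simp: loops_at_def pathin_compose)

lemma loop_homotopic_join:
  assumes "loop_homotopic X b p p'" "loop_homotopic X b q q'"
  shows "loop_homotopic X b (loop_join p q) (loop_join p' q')"
proof -
  let ?I = "top_of_set {0..1::real}"
  obtain h where h: "continuous_map (prod_topology ?I ?I) X h"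
    "\<And>x. h (0, x) = p x" "\<And>x. h (1, x) = p' x" "\<And>t. t \<in> {0..1} \<Longrightarrow> h (t, 0) = b \<and> h (t, 1) = b"
    using assms(1) unfolding loop_homotopic_def homotopic_with_def by blast
  obtain k where k: "continuous_map (prod_topology ?I ?I) X k"
    "\<And>x. k (0, x) = q x" "\<And>x. k (1, x) = q' x" "\<And>t. t \<in> {0..1} \<Longrightarrow> k (t, 0) = b \<and> k (t, 1) = b"
    using assms(2) unfolding loop_homotopic_def homotopic_with_def by blast
  let ?P = "prod_topology ?I ?I"
  have P: "?P = top_of_set ({0..1} \<times> {0..1})" by (rule prod_topology_top_of_set)
  define H where "H = (\<lambda>z. if snd z \<le> 1 / 2 then h (fst z, 2 * snd z) else k (fst z, 2 * snd z - 1))"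
  have "continuous_map ?P X H" unfolding H_def
  proof (rule continuous_map_cases_le)
    have "continuous_map (subtopology ?P {z \<in> topspace ?P. snd z \<le> 1 / 2}) ?P (\<lambda>z. (fst z, 2 * snd z))"
      unfolding P by (auto simp: subtopology_subtopology continuous_map_in_subtopology
          intro!: continuous_intros)
    then show "continuous_map (subtopology ?P {z \<in> topspace ?P. snd z \<le> 1 / 2}) X (\<lambda>z. h (fst z, 2 * snd z))"
      using continuous_map_compose[OF _ h(1)] by (simp add: o_def)
    have "continuous_map (subtopology ?P {z \<in> topspace ?P. 1 / 2 \<le> snd z}) ?P (\<lambda>z. (fst z, 2 * snd z - 1))"
      unfolding P by (auto simp: subtopology_subtopology continuous_map_in_subtopology
          intro!: continuous_intros)
    then show "continuous_map (subtopology ?P {z \<in> topspace ?P. 1 / 2 \<le> snd z}) X (\<lambda>z. k (fst z, 2 * snd z - 1))"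
      using continuous_map_compose[OF _ k(1)] by (simp add: o_def)
    show "continuous_map ?P euclideanreal snd" unfolding P by (auto intro!: continuous_intros)
    show "h (fst z, 2 * snd z) = k (fst z, 2 * snd z - 1)"
      if "z \<in> topspace ?P" "snd z = 1 / 2" for z
    proof -
      have "2 * snd z = 1" "2 * snd z - 1 = 0" "fst z \<in> {0..1}" using that by auto
      then show ?thesis using h(4) k(4) by (simp only:)
    qed
  qed simp
  then show ?thesis unfolding loop_homotopic_def homotopic_with_def
    by (intro exI[of _ H]) (auto simp: H_def loop_join_def h(2-4) k(2-4))
qed

lemma loop_join_in_loops: "p \<in> loops_at X b \<Longrightarrow> q \<in> loops_at X b \<Longrightarrow> loop_join p q \<in> loops_at X b"
  by (meson loop_homotopic_imp_loops(1) loop_homotopic_join loop_homotopic_refl)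

lemma loop_join_compose: "loop_join (f \<circ> a) (f \<circ> a') = f \<circ> (a +++ a')"
  by (auto simp: loop_join_def joinpaths_def)

lemma compose_loop_join: "f \<circ> loop_join a a' = loop_join (f \<circ> a) (f \<circ> a')"
  by (auto simp: loop_join_def)

text \<open>Associativity, unit and inverse compare reparametrizations of a single loop. Paths in
  the interval with common ends are homotopic by convexity, and composition with \<open>p\<close>
  carries this over to \<open>X\<close>.\<close>

lemma loop_homotopic_compose_interval:
  assumes "p \<in> loops_at X b" "path a" "path a'" "path_image a \<subseteq> {0..1}" "path_image a' \<subseteq> {0..1}"
    "pathstart a = pathstart a'" "pathfinish a = pathfinish a'" "p (pathstart a) = b" "p (pathfinish a) = b"
  shows "loop_homotopic X b (p \<circ> a) (p \<circ> a')"
proof (rule loop_homotopic_compose_paths)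
  show "homotopic_paths {0..1} a a'" by (rule homotopic_paths_convex) (use assms in auto)
qed (use assms in \<open>auto simp: loops_at_def pathin_def\<close>)

lemma loop_homotopic_assoc:
  assumes "p \<in> loops_at X b" "q \<in> loops_at X b" "r \<in> loops_at X b"
  shows "loop_homotopic X b (loop_join (loop_join p q) r) (loop_join p (loop_join q r))"
proof -
  let ?P = "loop_join (loop_join p q) r"
  \<comment> \<open>The piecewise linear map that sends the breakpoints 1/2 and 3/4 of the right
    bracketing to 1/4 and 1/2 of the left one.\<close>
  let ?a = "linepath 0 (1/4) +++ (linepath (1/4) (1/2) +++ linepath (1/2) (1::real))"
  have P: "?P \<in> loops_at X b" using assms by (simp add: loop_join_in_loops)
  have "loop_homotopic X b (?P \<circ> linepath 0 1) (?P \<circ> ?a)"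
    by (rule loop_homotopic_compose_interval[OF P])
      (use P in \<open>auto simp: path_image_join closed_segment_eq_real_ivl loops_at_def\<close>)
  moreover have "?P \<circ> linepath 0 1 = ?P" by (auto simp: linepath_def)
  moreover have "?P \<circ> ?a = loop_join p (loop_join q r)"
  proof
    fix t :: real
    have a: "?a t = (if t \<le> 1/2 then t / 2 else if t \<le> 3/4 then t - 1/4 else 2 * t - 1)"
      by (simp add: joinpaths_def linepath_def field_simps)
    have "2 * (2 * (t - 1/4)) - 1 = 2 * (2 * t - 1)" "2 * (2 * t - 1) - 1 = 2 * (2 * t - 1) - 1"
      by simp_all
    then show "(?P \<circ> ?a) t = loop_join p (loop_join q r) t"
      unfolding o_apply a loop_join_def by auto
  qed
  ultimately show ?thesis by simp
qed

lemma const_in_loops: "b \<in> topspace X \<Longrightarrow> (\<lambda>_. b) \<in> loops_at X b"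
  by (simp add: loops_at_def)

lemma loop_homotopic_lid:
  assumes "p \<in> loops_at X b"
  shows "loop_homotopic X b (loop_join (\<lambda>_. b) p) p"
proof -
  have "loop_homotopic X b (p \<circ> (linepath 0 0 +++ linepath 0 1)) (p \<circ> linepath 0 1)"
    by (rule loop_homotopic_compose_interval[OF assms])
      (use assms in \<open>auto simp: path_image_join closed_segment_eq_real_ivl loops_at_def\<close>)
  moreover have "p \<circ> linepath 0 0 = (\<lambda>_. b)" "p \<circ> linepath 0 1 = p"
    using assms by (auto simp: loops_at_def linepath_def)
  ultimately show ?thesis by (simp flip: loop_join_compose)
qed

lemma reversed_in_loops: "p \<in> loops_at X b \<Longrightarrow> (\<lambda>t. p (1 - t)) \<in> loops_at X b"
proof -
  assume p: "p \<in> loops_at X b"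
  have "continuous_map (top_of_set {0..1::real}) (top_of_set {0..1}) (\<lambda>t. 1 - t)"
    by (auto simp: continuous_map_in_subtopology intro!: continuous_intros)
  then have "continuous_map (top_of_set {0..1}) X (p \<circ> (\<lambda>t. 1 - t))"
    using p by (intro continuous_map_compose) (auto simp: loops_at_def pathin_def)
  then show "(\<lambda>t. p (1 - t)) \<in> loops_at X b" using p by (auto simp: loops_at_def pathin_def o_def)
qed

lemma loop_homotopic_linv:
  assumes "p \<in> loops_at X b"
  shows "loop_homotopic X b (loop_join (\<lambda>t. p (1 - t)) p) (\<lambda>_. b)"
proof -
  \<comment> \<open>Going from 1 back to 0 and forward again is homotopic, inside the interval, to
    resting at 1.\<close>
  have "loop_homotopic X b (p \<circ> (linepath 1 0 +++ linepath 0 1)) (p \<circ> linepath 1 1)"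
    by (rule loop_homotopic_compose_interval[OF assms])
      (use assms in \<open>auto simp: path_image_join closed_segment_eq_real_ivl loops_at_def\<close>)
  moreover have "p \<circ> linepath 1 1 = (\<lambda>_. b)" "p \<circ> linepath 0 1 = p" "p \<circ> linepath 1 0 = (\<lambda>t. p (1 - t))"
    using assms by (auto simp: loops_at_def linepath_def reversepath_def)
  ultimately show ?thesis by (simp flip: loop_join_compose)
qed

section \<open>The group of loop classes and induced homomorphisms\<close>

lemma fundamental_group_simps:
  "carrier (fundamental_group X b) = loop_class X b ` loops_at X b"
  "\<one>\<^bsub>fundamental_group X b\<^esub> = loop_class X b (\<lambda>_. b)"
  by (simp_all add: fundamental_group_def)

lemma loop_class_carrier [intro]: "p \<in> loops_at X b \<Longrightarrow> loop_class X b p \<in> carrier (fundamental_group X b)"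
  by (simp add: fundamental_group_simps)

lemma loop_class_mult:
  assumes "p \<in> loops_at X b" "q \<in> loops_at X b"
  shows "loop_class X b p \<otimes>\<^bsub>fundamental_group X b\<^esub> loop_class X b q = loop_class X b (loop_join p q)"
proof -
  have "loop_class X b (loop_join p' q') = loop_class X b (loop_join p q)"
    if "p' \<in> loop_class X b p" "q' \<in> loop_class X b q" for p' q'
    using that by (intro loop_class_eqI loop_homotopic_join loop_homotopic_sym[of X b p p']
        loop_homotopic_sym[of X b q q']) (auto simp: loop_class_def)
  then have "loop_class X b p \<otimes>\<^bsub>fundamental_group X b\<^esub> loop_class X b q =
      (\<Union>p'\<in>loop_class X b p. \<Union>q'\<in>loop_class X b q. loop_class X b (loop_join p q))"
    unfolding fundamental_group_def monoid.simps by (intro SUP_cong refl)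
  \<comment> \<open>The union of equal sets collapses to one of them only if the index sets are
    nonempty.\<close>
  moreover have "p \<in> loop_class X b p" "q \<in> loop_class X b q"
    using assms by (simp_all add: loop_class_def loop_homotopic_refl)
  then have "loop_class X b p \<noteq> {}" "loop_class X b q \<noteq> {}" by blast+
  ultimately show ?thesis by (simp only: UN_constant if_False)
qed

theorem group_fundamental_group:
  assumes "b \<in> topspace X"
  shows "group (fundamental_group X b)"
proof (rule groupI)
  show "\<one>\<^bsub>fundamental_group X b\<^esub> \<in> carrier (fundamental_group X b)"
    using assms by (simp add: fundamental_group_simps const_in_loops)
next
  fix A assume "A \<in> carrier (fundamental_group X b)"
  then obtain p where p: "p \<in> loops_at X b" "A = loop_class X b p"
    by (auto simp: fundamental_group_simps)
  then show "\<one>\<^bsub>fundamental_group X b\<^esub> \<otimes>\<^bsub>fundamental_group X b\<^esub> A = A"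
    by (simp add: fundamental_group_simps loop_class_mult const_in_loops[OF assms]
        loop_class_eqI[OF loop_homotopic_lid])
  have "loop_class X b (\<lambda>t. p (1 - t)) \<otimes>\<^bsub>fundamental_group X b\<^esub> A = \<one>\<^bsub>fundamental_group X b\<^esub>"
    using p by (simp add: fundamental_group_simps loop_class_mult reversed_in_loops
        loop_class_eqI[OF loop_homotopic_linv])
  then show "\<exists>B\<in>carrier (fundamental_group X b). B \<otimes>\<^bsub>fundamental_group X b\<^esub> A = \<one>\<^bsub>fundamental_group X b\<^esub>"
    by (rule bexI) (intro loop_class_carrier reversed_in_loops p(1))
next
  fix A B C
  assume "A \<in> carrier (fundamental_group X b)" "B \<in> carrier (fundamental_group X b)"
  then show "A \<otimes>\<^bsub>fundamental_group X b\<^esub> B \<in> carrier (fundamental_group X b)"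
    by (auto simp: fundamental_group_simps loop_class_mult loop_join_in_loops)
  assume "C \<in> carrier (fundamental_group X b)"
  with \<open>A \<in> _\<close> \<open>B \<in> _\<close> show "A \<otimes>\<^bsub>fundamental_group X b\<^esub> B \<otimes>\<^bsub>fundamental_group X b\<^esub> C =
      A \<otimes>\<^bsub>fundamental_group X b\<^esub> (B \<otimes>\<^bsub>fundamental_group X b\<^esub> C)"
    unfolding fundamental_group_simps
    by (elim imageE) (simp only: loop_class_mult loop_join_in_loops loop_class_eqI[OF loop_homotopic_assoc])
qed

lemma induced_hom_loop_class:
  assumes "continuous_map X Y f" "p \<in> loops_at X b"
  shows "induced_hom Y (f b) f (loop_class X b p) = loop_class Y (f b) (f \<circ> p)"
proof -
  have "loop_class Y (f b) (f \<circ> q) = loop_class Y (f b) (f \<circ> p)" if "q \<in> loop_class X b p" for q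
  proof -
    have "loop_homotopic X b q p"
      using that by (auto simp: loop_class_def intro: loop_homotopic_sym)
    then show ?thesis by (rule loop_class_eqI[OF loop_homotopic_compose[OF _ assms(1)]])
  qed
  then have "induced_hom Y (f b) f (loop_class X b p) = (\<Union>q\<in>loop_class X b p. loop_class Y (f b) (f \<circ> p))"
    unfolding induced_hom_def by (intro SUP_cong refl)
  moreover have "p \<in> loop_class X b p" using assms by (simp add: loop_class_def loop_homotopic_refl)
  then have "loop_class X b p \<noteq> {}" by blast
  ultimately show ?thesis by (simp only: UN_constant if_False)
qed

lemma induced_hom_is_hom:
  assumes "continuous_map X Y f"
  shows "induced_hom Y (f b) f \<in> hom (fundamental_group X b) (fundamental_group Y (f b))"
  by (rule homI)
    (auto simp: fundamental_group_simps induced_hom_loop_class[OF assms] loop_class_mult loop_join_in_loops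
      loops_at_compose[OF _ assms] compose_loop_join)

section \<open>Homotopy lifting\<close>

abbreviation unit_square :: "(real \<times> real) set" where
  "unit_square \<equiv> {0..1} \<times> {0..1}"

text \<open>Two consequences of being a covering, taken as axioms: squares lift from a prescribed
  starting point, and path lifts are unique. In this form the property passes to composites and can
  be checked for unordered pairs without evenly covered neighbourhoods.\<close>

locale path_lifting =
  fixes S :: "'a::real_normed_vector set" and X :: "'b topology" and \<kappa> :: "'a \<Rightarrow> 'b"
  assumes continuous: "continuous_map (top_of_set S) X \<kappa>"
    and lift_square: "\<lbrakk>continuous_map (top_of_set unit_square) X h; s \<in> S; \<kappa> s = h (0, 0)\<rbrakk>
      \<Longrightarrow> \<exists>f. continuous_on unit_square f \<and> f ` unit_square \<subseteq> S \<and> f (0, 0) = s \<and> (\<forall>z\<in>unit_square. \<kappa> (f z) = h z)"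
    and lift_unique: "\<lbrakk>path p; path q; path_image p \<subseteq> S; path_image q \<subseteq> S; pathstart p = pathstart q;
        \<And>t. t \<in> {0..1} \<Longrightarrow> \<kappa> (p t) = \<kappa> (q t); t \<in> {0..1}\<rbrakk> \<Longrightarrow> p t = q t"
begin

lemma lift_path:
  assumes "pathin X p" "s \<in> S" "p 0 = \<kappa> s"
  obtains P where "path P" "path_image P \<subseteq> S" "pathstart P = s" "\<And>t. t \<in> {0..1} \<Longrightarrow> \<kappa> (P t) = p t"
proof -
  \<comment> \<open>A path is lifted as a square that is constant in the first variable.\<close>
  have "continuous_map (top_of_set unit_square) X (p \<circ> snd)"
  proof (rule continuous_map_compose)
    show "continuous_map (top_of_set unit_square) (top_of_set {0..1}) snd"
      by (auto simp: continuous_map_in_subtopology intro!: continuous_intros)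
  qed (use assms(1) in \<open>simp add: pathin_def\<close>)
  then obtain f where f: "continuous_on unit_square f" "f ` unit_square \<subseteq> S" "f (0, 0) = s"
      "\<forall>z\<in>unit_square. \<kappa> (f z) = (p \<circ> snd) z"
    using lift_square[of "p \<circ> snd" s] assms(2,3) by auto
  show thesis
  proof (rule that[of "\<lambda>t. f (0, t)"])
    show "path (\<lambda>t. f (0, t))"
      unfolding path_def by (rule continuous_on_compose2[OF f(1)]) (auto intro!: continuous_intros)
  qed (use f in \<open>auto simp: path_image_def pathstart_def image_subset_iff\<close>)
qed

text \<open>The sides of the lifted square are identified by unique lifting, in an order in which
  each starts at a known corner: left, bottom, right, top.\<close>

lemma loop_homotopic_imp_homotopic_paths:
  assumes P: "path P" "path_image P \<subseteq> S" and P': "path P'" "path_image P' \<subseteq> S"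
    and start: "pathstart P = pathstart P'"
    and hom: "loop_homotopic X b (\<kappa> \<circ> P) (\<kappa> \<circ> P')"
  shows "homotopic_paths S P P'"
proof -
  obtain h where h: "continuous_map (top_of_set unit_square) X h"
    "\<And>x. h (0, x) = \<kappa> (P x)" "\<And>x. h (1, x) = \<kappa> (P' x)" "\<And>t. t \<in> {0..1} \<Longrightarrow> h (t, 0) = b \<and> h (t, 1) = b"
    using hom unfolding loop_homotopic_def homotopic_with_def prod_topology_top_of_set by auto
  have P0: "P 0 \<in> S" using P(2) by (auto simp: path_image_def)
  obtain f where f: "continuous_on unit_square f" "f ` unit_square \<subseteq> S" "f (0, 0) = P 0"
    "\<forall>z\<in>unit_square. \<kappa> (f z) = h z"
    using lift_square[OF h(1) P0] h(2) by auto
  have side: "path (f \<circ> g)" "path_image (f \<circ> g) \<subseteq> S" if "path g" "path_image g \<subseteq> unit_square" for g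
    using that f(1,2) by (auto simp: path_image_compose intro!: path_continuous_image continuous_on_subset[OF f(1)])
  have f_eq: "f (g t) = r t" if "path g" "path_image g \<subseteq> unit_square" "path r" "path_image r \<subseteq> S"
    "f (g 0) = r 0" "\<And>t. t \<in> {0..1} \<Longrightarrow> h (g t) = \<kappa> (r t)" "t \<in> {0..1}" for g r t
  proof -
    have "\<kappa> ((f \<circ> g) t) = \<kappa> (r t)" if "t \<in> {0..1}" for t
    proof -
      have "g t \<in> unit_square"
        using \<open>path_image g \<subseteq> unit_square\<close> \<open>t \<in> {0..1}\<close> unfolding path_image_def by blast
      then show ?thesis
        using bspec[OF f(4)] \<open>\<And>t. t \<in> {0..1} \<Longrightarrow> h (g t) = \<kappa> (r t)\<close>[OF \<open>t \<in> {0..1}\<close>]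
        by (simp only: o_apply)
    qed
    then show ?thesis using lift_unique[of "f \<circ> g" r t] side[of g] that by (simp add: pathstart_def)
  qed
  have left: "f (0, t) = P t" if "t \<in> {0..1}" for t
    by (rule f_eq[of "\<lambda>t. (0, t)"]) (use that h P f in \<open>auto simp: path_def path_image_def intro!: continuous_intros\<close>)
  have bottom: "f (s, 0) = P 0" if "s \<in> {0..1}" for s by (rule f_eq[of "\<lambda>s. (s, 0)" "\<lambda>_. P 0"])
      (use that h(2)[of 0] h(4) f P0 in \<open>auto simp: path_def path_image_def intro!: continuous_intros\<close>)
  have right: "f (1, t) = P' t" if "t \<in> {0..1}" for t by (rule f_eq[of "\<lambda>t. (1, t)"])
      (use that h P' f bottom[of 1] start in \<open>auto simp: path_def path_image_def pathstart_def intro!: continuous_intros\<close>)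
  have P1: "P 1 \<in> S" using P(2) by (auto simp: path_image_def)
  have top: "f (s, 1) = P 1" if "s \<in> {0..1}" for s by (rule f_eq[of "\<lambda>s. (s, 1)" "\<lambda>_. P 1"])
      (use that h(2)[of 1] h(4) f P1 left[of 1] in \<open>auto simp: path_def path_image_def intro!: continuous_intros\<close>)
  show ?thesis unfolding homotopic_paths
    by (rule exI[of _ f]) (use f(1,2) left right bottom top in \<open>auto simp: pathstart_def pathfinish_def image_subset_iff\<close>)
qed

lemma loop_homotopic_iff:
  assumes "path P" "path_image P \<subseteq> S" "path P'" "path_image P' \<subseteq> S" "pathstart P = pathstart P'"
    "\<kappa> (pathstart P) = b" "\<kappa> (pathfinish P) = b"
  shows "loop_homotopic X b (\<kappa> \<circ> P) (\<kappa> \<circ> P') \<longleftrightarrow> homotopic_paths S P P'"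
  using loop_homotopic_imp_homotopic_paths[OF assms(1-5)]
    loop_homotopic_compose_paths[OF _ continuous assms(6,7)] by blast

lemma compose_in_loops:
  assumes "path P" "path_image P \<subseteq> S" "\<kappa> (pathstart P) = b" "\<kappa> (pathfinish P) = b"
  shows "\<kappa> \<circ> P \<in> loops_at X b"
proof -
  have "continuous_map (top_of_set {0..1}) (top_of_set S) P"
    using assms(1,2) by (auto simp: path_def path_image_def continuous_map_in_subtopology)
  then have "pathin X (\<kappa> \<circ> P)"
    unfolding pathin_def by (rule continuous_map_compose[OF _ continuous])
  then show ?thesis using assms(3,4) by (simp add: loops_at_def pathstart_def pathfinish_def)
qed

lemma loop_class_eq_iff_homotopic_paths:
  assumes "path P" "path_image P \<subseteq> S" "path P'" "path_image P' \<subseteq> S" "pathstart P = pathstart P'"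
    "\<kappa> (pathstart P) = b" "\<kappa> (pathfinish P) = b" "\<kappa> (pathfinish P') = b"
  shows "loop_class X b (\<kappa> \<circ> P) = loop_class X b (\<kappa> \<circ> P') \<longleftrightarrow> homotopic_paths S P P'"
  using loop_homotopic_iff[OF assms(1-7)] compose_in_loops assms by (metis loop_class_eq_iff)

lemma ex_lift_of_class:
  assumes "A \<in> carrier (fundamental_group X (\<kappa> s))" "s \<in> S"
  obtains P where "path P" "path_image P \<subseteq> S" "pathstart P = s" "\<kappa> (pathfinish P) = \<kappa> s"
    "A = loop_class X (\<kappa> s) (\<kappa> \<circ> P)"
proof -
  obtain p where p: "p \<in> loops_at X (\<kappa> s)" "A = loop_class X (\<kappa> s) p"
    using assms(1) by (auto simp: fundamental_group_simps)
  obtain P where P: "path P" "path_image P \<subseteq> S" "pathstart P = s" "\<And>t. t \<in> {0..1} \<Longrightarrow> \<kappa> (P t) = p t"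
    using lift_path[of p s] p(1) assms(2) by (auto simp: loops_at_def)
  have "A = loop_class X (\<kappa> s) (\<kappa> \<circ> P)"
    unfolding p(2) by (rule loop_class_cong[OF p(1)]) (simp add: P(4))
  moreover have "\<kappa> (pathfinish P) = \<kappa> s"
    using P(4)[of 1] p(1) by (simp add: loops_at_def pathfinish_def)
  ultimately show thesis by (intro that[OF P(1-3)])
qed

end

text \<open>Squares are lifted in two stages. It serves for the covering of unordered pairs, which
  is \<open>pair_cover\<close> followed by the double covering.\<close>

lemma path_lifting_compose:
  assumes "path_lifting S (top_of_set A) q" "path_lifting A X r"
  shows "path_lifting S X (r \<circ> q)"
proof -
  interpret q: path_lifting S "top_of_set A" q by fact
  interpret r: path_lifting A X r by fact
  have qA: "q s \<in> A" if "s \<in> S" for s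
    using q.continuous that by (auto simp: continuous_map_in_subtopology)
  have qc: "continuous_on S q" using q.continuous by (auto simp: continuous_map_in_subtopology)
  show ?thesis
  proof
    show "continuous_map (top_of_set S) X (r \<circ> q)"
      using q.continuous r.continuous by (rule continuous_map_compose)
  next
    fix h s assume h: "continuous_map (top_of_set unit_square) X h" "s \<in> S" "(r \<circ> q) s = h (0, 0)"
    obtain f where f: "continuous_on unit_square f" "f ` unit_square \<subseteq> A" "f (0, 0) = q s"
      "\<forall>z\<in>unit_square. r (f z) = h z"
      using r.lift_square[OF h(1) qA[OF h(2)]] h(3) by auto
    have "continuous_map (top_of_set unit_square) (top_of_set A) f"
      using f(1,2) by (auto simp: continuous_map_in_subtopology)
    then obtain g where g: "continuous_on unit_square g" "g ` unit_square \<subseteq> S" "g (0, 0) = s"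
      "\<forall>z\<in>unit_square. q (g z) = f z"
      using q.lift_square[OF _ h(2), of f] f(3) by auto
    show "\<exists>f. continuous_on unit_square f \<and> f ` unit_square \<subseteq> S \<and> f (0, 0) = s \<and>
        (\<forall>z\<in>unit_square. (r \<circ> q) (f z) = h z)"
      using g f(4) by (intro exI[of _ g]) simp
  next
    fix p p' :: "real \<Rightarrow> 'a" and t :: real
    assume p: "path p" "path p'" "path_image p \<subseteq> S" "path_image p' \<subseteq> S" "pathstart p = pathstart p'"
      and eq: "\<And>t. t \<in> {0..1} \<Longrightarrow> (r \<circ> q) (p t) = (r \<circ> q) (p' t)" and t: "t \<in> {0..1}"
    have path: "path (q \<circ> p)" "path (q \<circ> p')" "path_image (q \<circ> p) \<subseteq> A" "path_image (q \<circ> p') \<subseteq> A"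
      using p qA by (auto simp: path_image_compose intro!: path_continuous_image continuous_on_subset[OF qc])
    have "(q \<circ> p) t = (q \<circ> p') t" if "t \<in> {0..1}" for t
      by (rule r.lift_unique[OF path _ _ that]) (use p(5) eq in \<open>simp_all add: pathstart_compose\<close>)
    then show "p t = p' t" using q.lift_unique[OF p _ t] by simp
  qed
qed

section \<open>Coverings of the torus and of its configuration spaces\<close>

definition torus_pts :: "point set" where
  "torus_pts = sphere 0 1 \<times> sphere 0 1"

lemma torus_eq: "torus = top_of_set torus_pts"
  by (simp add: torus_def torus_pts_def)

definition config_pts :: "(point \<times> point) set" where
  "config_pts = {(a, b). a \<in> torus_pts \<and> b \<in> torus_pts \<and> a \<noteq> b}"

lemma F2_torus_eq: "F2_torus = top_of_set config_pts"
proof -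
  have "prod_topology torus torus = top_of_set (torus_pts \<times> torus_pts)"
    unfolding torus_eq by (rule prod_topology_top_of_set)
  then show ?thesis
    unfolding F2_torus_def config_pts_def by (simp add: subtopology_subtopology) (rule arg_cong, auto)
qed

lemma grid_norm_ge_1:
  assumes "z \<in> grid" "z \<noteq> 0"
  shows "1 \<le> norm z"
proof -
  have int: "1 \<le> \<bar>x\<bar>" if "x \<in> \<int>" "x \<noteq> 0" for x :: real using that by (auto elim!: Ints_cases)
  have "Re z \<noteq> 0 \<or> Im z \<noteq> 0" using assms(2) by (auto simp: complex_eq_iff)
  then have "1 \<le> \<bar>Re z\<bar> \<or> 1 \<le> \<bar>Im z\<bar>" using int assms(1) unfolding grid_def by blast
  then show ?thesis using abs_Re_le_cmod[of z] abs_Im_le_cmod[of z] by linarith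
qed

text \<open>The grid is discrete. Applied to the difference of two lifts, this is the uniqueness of
  lifting.\<close>

lemma grid_constant:
  assumes "path p" "path_image p \<subseteq> grid" "t \<in> {0..1}"
  shows "p t = p 0"
proof -
  have dist: "1 \<le> norm (z - w)" if "z \<in> grid" "w \<in> grid" "z \<noteq> w" for z w
    using that by (intro grid_norm_ge_1 grid_diff) simp_all
  have "p constant_on {0..1}"
  proof (rule continuous_discrete_range_constant)
    fix x :: real assume x: "x \<in> {0..1}"
    have "1 \<le> norm (p y - p x)" if "y \<in> {0..1}" "p y \<noteq> p x" for y
      using that x assms(2) by (intro dist) (auto simp: path_image_def)
    then show "\<exists>e>0. \<forall>y. y \<in> {0..1} \<and> p y \<noteq> p x \<longrightarrow> e \<le> norm (p y - p x)"
      by (intro exI[of _ 1]) simp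
  qed (use assms(1) in \<open>simp_all add: path_def\<close>)
  then show ?thesis using assms(3) by (auto simp: constant_on_def)
qed

text \<open>The covering is a parameter because the argument is run both with
  \<open>torus_cover\<close> and with its composite with a reflection of the plane.\<close>

locale torus_covering =
  fixes tc :: "complex \<Rightarrow> point"
  assumes tc_continuous: "continuous_on UNIV tc"
    and tc_in [simp]: "tc z \<in> torus_pts"
    and tc_eq_iff: "tc z = tc w \<longleftrightarrow> z - w \<in> grid"
    and tc_lift: "continuous_on unit_square f \<Longrightarrow> f ` unit_square \<subseteq> torus_pts \<Longrightarrow>
      \<exists>g. continuous_on unit_square g \<and> (\<forall>z\<in>unit_square. tc (g z) = f z)"
begin

text \<open>Adding a grid vector moves a lift to the prescribed starting point without changing its
  image.\<close>

lemma tc_lift_from: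
  assumes "continuous_on unit_square f" "f ` unit_square \<subseteq> torus_pts" "tc s = f (0, 0)"
  obtains g where "continuous_on unit_square g" "g (0, 0) = s" "\<And>z. z \<in> unit_square \<Longrightarrow> tc (g z) = f z"
proof -
  obtain g where g: "continuous_on unit_square g" "\<forall>z\<in>unit_square. tc (g z) = f z"
    using tc_lift[OF assms(1,2)] by blast
  have "tc s = tc (g (0, 0))" using g(2) assms(3) by simp
  then have l: "s - g (0, 0) \<in> grid" by (simp add: tc_eq_iff)
  show thesis
  proof (rule that[of "\<lambda>z. g z + (s - g (0, 0))"])
    fix z assume "z \<in> unit_square"
    have "tc (g z + (s - g (0, 0))) = tc (g z)" using l by (simp add: tc_eq_iff)
    then show "tc (g z + (s - g (0, 0))) = f z" using g(2) \<open>z \<in> unit_square\<close> by simp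
  qed (use g(1) in \<open>auto intro!: continuous_intros\<close>)
qed

sublocale T: path_lifting UNIV torus tc
proof
  show "continuous_map (top_of_set UNIV) torus tc" unfolding torus_eq
  proof (rule continuous_map_into_subtopology)
    show "continuous_map (top_of_set UNIV) euclidean tc"
      using tc_continuous by (simp only: continuous_map_iff_continuous)
  qed (intro funcsetI tc_in)
next
  fix h s assume h: "continuous_map (top_of_set unit_square) torus h" "s \<in> (UNIV :: complex set)" "tc s = h (0, 0)"
  then have "continuous_on unit_square h" "h ` unit_square \<subseteq> torus_pts"
    by (auto simp: torus_eq continuous_map_in_subtopology)
  then obtain g where "continuous_on unit_square g" "g (0, 0) = s" "\<And>z. z \<in> unit_square \<Longrightarrow> tc (g z) = h z"
    using tc_lift_from[of h s] h(3) by metis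
  then show "\<exists>f. continuous_on unit_square f \<and> f ` unit_square \<subseteq> UNIV \<and> f (0, 0) = s \<and>
      (\<forall>z\<in>unit_square. tc (f z) = h z)"
    by (intro exI[of _ g] conjI ballI subset_UNIV)
next
  fix p q :: "real \<Rightarrow> complex" and t :: real
  assume "path p" "path q" "pathstart p = pathstart q" "\<And>t. t \<in> {0..1} \<Longrightarrow> tc (p t) = tc (q t)" "t \<in> {0..1}"
  then have "path (\<lambda>t. p t - q t)" "path_image (\<lambda>t. p t - q t) \<subseteq> grid" "p 0 - q 0 = 0"
    by (auto simp: path_def path_image_def pathstart_def simp flip: tc_eq_iff intro!: continuous_intros)
  from grid_constant[OF this(1,2) \<open>t \<in> {0..1}\<close>] this(3) show "p t = q t" by simp
qed

text \<open>The first coordinate lifts the first point, the second one the difference of the two points.\<close>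

definition pair_cover :: "complex \<times> complex \<Rightarrow> point \<times> point" where
  "pair_cover s = (tc (fst s), tc (fst s - snd s))"

lemma pair_cover_eq_iff:
  "pair_cover s = pair_cover s' \<longleftrightarrow> fst s - fst s' \<in> grid \<and> snd s - snd s' \<in> grid"
proof -
  have "fst s - snd s - (fst s' - snd s') = (fst s - fst s') + - (snd s - snd s')" by simp
  then show ?thesis unfolding pair_cover_def prod.inject tc_eq_iff
    using grid_add_iff(2)[of "fst s - fst s'" "- (snd s - snd s')"] grid_minus_iff by metis
qed

sublocale pair: path_lifting "UNIV \<times> - grid" F2_torus pair_cover
proof
  have c: "continuous_on UNIV pair_cover" unfolding pair_cover_def
    by (intro continuous_intros continuous_on_compose2[OF tc_continuous]) auto
  have "pair_cover s \<in> config_pts" if "s \<in> UNIV \<times> - grid" for s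
  proof -
    have "fst s - (fst s - snd s) \<notin> grid" using that by auto
    then show ?thesis unfolding pair_cover_def config_pts_def using tc_in tc_eq_iff by blast
  qed
  then show "continuous_map (top_of_set (UNIV \<times> - grid)) F2_torus pair_cover"
    unfolding F2_torus_eq using c by (auto simp: continuous_map_in_subtopology intro: continuous_on_subset)
next
  fix h and s :: "complex \<times> complex"
  assume h: "continuous_map (top_of_set unit_square) F2_torus h" "s \<in> UNIV \<times> - grid" "pair_cover s = h (0, 0)"
  have hc: "continuous_on unit_square h" and hF: "\<And>z. z \<in> unit_square \<Longrightarrow> h z \<in> config_pts"
    using h(1) unfolding F2_torus_eq by (auto simp: continuous_map_in_subtopology)
  have hT: "fst (h z) \<in> torus_pts" "snd (h z) \<in> torus_pts" "fst (h z) \<noteq> snd (h z)" if "z \<in> unit_square" for z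
    using hF[OF that] unfolding config_pts_def by (simp_all add: case_prod_beta)
  have "continuous_on unit_square (\<lambda>z. fst (h z))" by (intro continuous_intros hc)
  moreover have "(\<lambda>z. fst (h z)) ` unit_square \<subseteq> torus_pts" using hT(1) by (intro image_subsetI)
  moreover have "tc (fst s) = fst (h (0, 0))" by (simp add: h(3)[symmetric] pair_cover_def)
  ultimately obtain g1 where g1: "continuous_on unit_square g1" "g1 (0, 0) = fst s" "\<And>z. z \<in> unit_square \<Longrightarrow> tc (g1 z) = fst (h z)"
    by (rule tc_lift_from) metis
  have "continuous_on unit_square (\<lambda>z. snd (h z))" by (intro continuous_intros hc)
  moreover have "(\<lambda>z. snd (h z)) ` unit_square \<subseteq> torus_pts" using hT(2) by (intro image_subsetI)
  moreover have "tc (fst s - snd s) = snd (h (0, 0))" by (simp add: h(3)[symmetric] pair_cover_def)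
  ultimately obtain g2 where g2: "continuous_on unit_square g2" "g2 (0, 0) = fst s - snd s" "\<And>z. z \<in> unit_square \<Longrightarrow> tc (g2 z) = snd (h z)"
    by (rule tc_lift_from) metis
  \<comment> \<open>The two points are lifted separately; the difference of the lifts avoids the
    grid because the points are distinct.\<close>
  let ?f = "\<lambda>z. (g1 z, g1 z - g2 z)"
  have "g1 z - g2 z \<notin> grid" if "z \<in> unit_square" for z
  proof -
    have "tc (g1 z) \<noteq> tc (g2 z)" using hT(3)[OF that] unfolding g1(3)[OF that] g2(3)[OF that] .
    then show ?thesis by (simp add: tc_eq_iff)
  qed
  then have "?f ` unit_square \<subseteq> UNIV \<times> - grid" by blast
  moreover have "pair_cover (?f z) = h z" if "z \<in> unit_square" for z
    using g1(3)[OF that] g2(3)[OF that] by (simp add: pair_cover_def)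
  moreover have "?f (0, 0) = s" by (simp add: g1(2) g2(2) prod_eq_iff)
  moreover have "continuous_on unit_square ?f" using g1(1) g2(1) by (intro continuous_intros)
  ultimately show "\<exists>f. continuous_on unit_square f \<and> f ` unit_square \<subseteq> UNIV \<times> - grid \<and> f (0, 0) = s \<and>
      (\<forall>z\<in>unit_square. pair_cover (f z) = h z)"
    by (intro exI[of _ ?f] conjI ballI)
next
  fix p q :: "real \<Rightarrow> complex \<times> complex" and t :: real
  assume pq: "path p" "path q" "pathstart p = pathstart q"
    and eq: "\<And>t. t \<in> {0..1} \<Longrightarrow> pair_cover (p t) = pair_cover (q t)" and t: "t \<in> {0..1}"
  have c: "continuous_on {0..1} p" "continuous_on {0..1} q" using pq by (simp_all add: path_def)
  have "path (\<lambda>t. fst (p t) - fst (q t))" "path (\<lambda>t. snd (p t) - snd (q t))"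
    unfolding path_def by (intro continuous_intros c)+
  moreover have "path_image (\<lambda>t. fst (p t) - fst (q t)) \<subseteq> grid"
    "path_image (\<lambda>t. snd (p t) - snd (q t)) \<subseteq> grid"
    using eq unfolding pair_cover_eq_iff path_image_def by blast+
  moreover have "p 0 = q 0" using pq(3) by (simp add: pathstart_def)
  ultimately show "p t = q t"
    using grid_constant[of "\<lambda>t. fst (p t) - fst (q t)" t] grid_constant[of "\<lambda>t. snd (p t) - snd (q t)" t] t
    by (simp add: prod_eq_iff)
qed

end

section \<open>Unordered pairs and the double covering\<close>

definition swap_pair :: "'a \<times> 'a \<Rightarrow> 'a \<times> 'a" where
  "swap_pair y = (snd y, fst y)"

lemma swap_pair_simps [simp]:
  "fst (swap_pair y) = snd y" "snd (swap_pair y) = fst y" "swap_pair (swap_pair y) = y"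
  by (simp_all add: swap_pair_def)

lemma unordered_swap [simp]: "unordered (swap_pair y) = unordered y"
  by (auto simp: unordered_def)

lemma unordered_eq_iff: "unordered y = unordered y' \<longleftrightarrow> y' = y \<or> y' = swap_pair y"
  by (cases y; cases y') (auto simp: unordered_def swap_pair_def doubleton_eq_iff)

lemma swap_config_pts: "y \<in> config_pts \<Longrightarrow> swap_pair y \<in> config_pts"
  by (auto simp: config_pts_def swap_pair_def)

lemma swap_pair_neq: "y \<in> config_pts \<Longrightarrow> swap_pair y \<noteq> y"
  by (auto simp: config_pts_def swap_pair_def)

lemma topspace_F2_torus [simp]: "topspace F2_torus = config_pts"
  by (simp add: F2_torus_eq)

lemma topspace_D2_torus [simp]: "topspace D2_torus = unordered ` config_pts"
  by (simp add: D2_torus_def)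

lemma continuous_unordered: "continuous_map F2_torus D2_torus unordered"
  unfolding D2_torus_def by (intro quotient_imp_continuous_map quotient_map_quotient_topology)

text \<open>\<open>Y\<close> orders each pair arbitrarily and may jump. A symmetric function of it
  factors through the quotient, whose universal property gives continuity.\<close>

lemma continuous_on_symmetric:
  fixes \<phi> :: "point \<times> point \<Rightarrow> 'c::topological_space" and K :: "'k::topological_space set"
  assumes "continuous_on config_pts \<phi>" "\<And>y. \<phi> (swap_pair y) = \<phi> y"
    and h: "continuous_map (top_of_set K) D2_torus h"
    and Y: "\<And>z. z \<in> K \<Longrightarrow> Y z \<in> config_pts \<and> unordered (Y z) = h z"
  shows "continuous_on K (\<lambda>z. \<phi> (Y z))"
proof -
  define \<psi> where "\<psi> A = \<phi> (SOME y. y \<in> config_pts \<and> unordered y = A)" for A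
  have \<psi>: "\<psi> (unordered y) = \<phi> y" if "y \<in> config_pts" for y
  proof -
    define x where "x = (SOME x. x \<in> config_pts \<and> unordered x = unordered y)"
    have "x \<in> config_pts \<and> unordered x = unordered y"
      unfolding x_def by (rule someI[of _ y]) (simp add: that)
    then have "y = x \<or> y = swap_pair x" by (simp only: unordered_eq_iff)
    then have "\<phi> x = \<phi> y" using assms(2)[of x] by (elim disjE) simp_all
    then show ?thesis by (simp only: \<psi>_def x_def)
  qed
  have "continuous_map F2_torus euclidean (\<psi> \<circ> unordered)" using assms(1) unfolding F2_torus_eq
    by (auto simp: \<psi> cong: continuous_on_cong)
  then have "continuous_map D2_torus euclidean \<psi>"
    unfolding D2_torus_def by (rule continuous_compose_quotient_map[OF quotient_map_quotient_topology])
  then have "continuous_map (top_of_set K) euclidean (\<psi> \<circ> h)"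
    using h continuous_map_compose by blast
  then have "continuous_on K (\<psi> \<circ> h)" by simp
  moreover have "(\<psi> \<circ> h) z = \<phi> (Y z)" if "z \<in> K" for z using \<psi> Y[OF that] by (metis o_apply)
  ultimately show ?thesis by (simp cong: continuous_on_cong)
qed

text \<open>Two unit complex numbers \<open>a\<close>, \<open>b\<close> have the form \<open>m * w\<close>, \<open>m * cnj w\<close> with \<open>m\<^sup>2 = a * b\<close>, so
  \<open>(a - b) / m\<close> is imaginary.\<close>

lemma unit_diff_imaginary:
  fixes a b m :: complex
  assumes "norm a = 1" "norm b = 1" "m\<^sup>2 = a * b"
  shows "Re ((a - b) / m) = 0"
proof -
  have m: "norm m = 1"
  proof -
    have "(norm m)\<^sup>2 = 1" using assms by (simp add: norm_mult flip: norm_power)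
    then show ?thesis using norm_ge_zero[of m] by (simp add: power2_eq_1_iff)
  qed
  have inv: "cnj z = inverse z" if "norm z = 1" for z :: complex
  proof -
    have "z * cnj z = 1" using complex_norm_square[of z] that by simp
    then show ?thesis using inverse_unique[of z "cnj z"] by simp
  qed
  have nz: "a \<noteq> 0" "b \<noteq> 0" "m \<noteq> 0" using assms m by auto
  have "cnj ((a - b) / m) = (inverse a - inverse b) / inverse m" using assms m by (simp add: inv)
  also have "\<dots> = (b - a) * m / (a * b)" using nz by (simp add: field_simps)
  also have "\<dots> = - ((a - b) / m)"
    using nz assms(3) by (simp add: field_simps power2_eq_square flip: assms(3))
  finally have "Re (cnj ((a - b) / m)) = - Re ((a - b) / m)" by simp
  then show ?thesis unfolding cnj.sel by simp
qed

text \<open>The lift is built from square roots of symmetric functions of the pair: \<open>m1\<close> and \<open>m2\<close>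
  are roots of the products of the coordinates, and \<open>g\<close> is a root of the square of
  \<open>u1 + \<i> u2\<close>, where \<open>u1\<close> and \<open>u2\<close> are the normalized coordinate differences.  As
  these are real, \<open>g\<close> determines both of them up to a common sign.\<close>

lemma D2_lift_square:
  assumes h: "continuous_map (top_of_set unit_square) D2_torus h"
  obtains f where "continuous_on unit_square f"
    "\<And>z. z \<in> unit_square \<Longrightarrow> f z \<in> config_pts \<and> unordered (f z) = h z"
proof -
  have "h z \<in> unordered ` config_pts" if "z \<in> unit_square" for z
    using continuous_map_image_subset_topspace[OF h] that by (auto simp: image_subset_iff)
  then have "\<forall>z\<in>unit_square. \<exists>y. y \<in> config_pts \<and> unordered y = h z" by (metis imageE)
  then obtain Y where Y: "\<And>z. z \<in> unit_square \<Longrightarrow> Y z \<in> config_pts \<and> unordered (Y z) = h z"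
    by metis
  define a1 b1 a2 b2 where
    "a1 = (\<lambda>z. fst (fst (Y z)))" "b1 = (\<lambda>z. fst (snd (Y z)))" "a2 = (\<lambda>z. snd (fst (Y z)))" "b2 = (\<lambda>z. snd (snd (Y z)))"
  note ab_def = this
  have Y_eq: "Y z = ((a1 z, a2 z), (b1 z, b2 z))" for z by (simp add: ab_def)
  have unit: "norm (a1 z) = 1" "norm (b1 z) = 1" "norm (a2 z) = 1" "norm (b2 z) = 1"
    and ne: "a1 z \<noteq> b1 z \<or> a2 z \<noteq> b2 z" if "z \<in> unit_square" for z
    using conjunct1[OF Y[OF that]] unfolding Y_eq config_pts_def torus_pts_def by simp_all
  have symc: "continuous_on unit_square (\<lambda>z. \<phi> (Y z))"
    if "continuous_on config_pts \<phi>" "\<And>y. \<phi> (swap_pair y) = \<phi> y" for \<phi> :: "point \<times> point \<Rightarrow> complex"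
    by (rule continuous_on_symmetric[OF that h]) (rule Y)
  have cont:
    "continuous_on unit_square (\<lambda>z. a1 z + b1 z)" "continuous_on unit_square (\<lambda>z. a2 z + b2 z)"
    "continuous_on unit_square (\<lambda>z. a1 z * b1 z)" "continuous_on unit_square (\<lambda>z. a2 z * b2 z)"
    "continuous_on unit_square (\<lambda>z. (a1 z - b1 z)\<^sup>2)" "continuous_on unit_square (\<lambda>z. (a2 z - b2 z)\<^sup>2)"
    "continuous_on unit_square (\<lambda>z. (a1 z - b1 z) * (a2 z - b2 z))"
    unfolding ab_def
    by (rule symc[of "\<lambda>y. fst (fst y) + fst (snd y)"], intro continuous_intros, simp add: add.commute)
      (rule symc[of "\<lambda>y. snd (fst y) + snd (snd y)"], intro continuous_intros, simp add: add.commute,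
       rule symc[of "\<lambda>y. fst (fst y) * fst (snd y)"], intro continuous_intros, simp add: mult.commute,
       rule symc[of "\<lambda>y. snd (fst y) * snd (snd y)"], intro continuous_intros, simp add: mult.commute,
       rule symc[of "\<lambda>y. (fst (fst y) - fst (snd y))\<^sup>2"], intro continuous_intros, simp add: power2_commute,
       rule symc[of "\<lambda>y. (snd (fst y) - snd (snd y))\<^sup>2"], intro continuous_intros, simp add: power2_commute,
       rule symc[of "\<lambda>y. (fst (fst y) - fst (snd y)) * (snd (fst y) - snd (snd y))"], intro continuous_intros,
       simp add: algebra_simps)
  have contr: "contractible unit_square" by (intro convex_imp_contractible convex_Times) simp_all
  have nz: "a1 z * b1 z \<noteq> 0" "a2 z * b2 z \<noteq> 0" if "z \<in> unit_square" for z
    using unit[OF that] by force+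
  obtain m1 where m1: "continuous_on unit_square m1" "\<And>z. z \<in> unit_square \<Longrightarrow> a1 z * b1 z = (m1 z)\<^sup>2"
    using continuous_sqrt_on_contractible[OF cont(3) contr nz(1)] by metis
  obtain m2 where m2: "continuous_on unit_square m2" "\<And>z. z \<in> unit_square \<Longrightarrow> a2 z * b2 z = (m2 z)\<^sup>2"
    using continuous_sqrt_on_contractible[OF cont(4) contr nz(2)] by metis
  have m0: "m1 z \<noteq> 0" "m2 z \<noteq> 0" if "z \<in> unit_square" for z
    using nz[OF that] unfolding m1(2)[OF that] m2(2)[OF that] by simp_all
  define u1 u2 where "u1 = (\<lambda>z. Im ((a1 z - b1 z) / m1 z))" "u2 = (\<lambda>z. Im ((a2 z - b2 z) / m2 z))"
  note u_def = this
  have u: "(a1 z - b1 z) / m1 z = \<i> * u1 z" "(a2 z - b2 z) / m2 z = \<i> * u2 z" if "z \<in> unit_square" for z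
    using unit_diff_imaginary[of "a1 z" "b1 z" "m1 z"] unit_diff_imaginary[of "a2 z" "b2 z" "m2 z"]
      unit[OF that] m1(2)[OF that] m2(2)[OF that]
    by (simp_all add: u_def complex_eq_iff)
  have diff: "a1 z - b1 z = \<i> * u1 z * m1 z" "a2 z - b2 z = \<i> * u2 z * m2 z" if "z \<in> unit_square" for z
    using u[OF that] m0[OF that] by (simp_all add: divide_eq_eq)
  \<comment> \<open>The normalized differences are \<open>\<i> * u1\<close> and
    \<open>\<i> * u2\<close>, so the overall minus sign makes this the square of
    \<open>Complex (u1 z) (u2 z)\<close>. Its ingredients are symmetric under the swap or one of the
    chosen roots, hence continuous.\<close>
  define W where "W = (\<lambda>z. - ((a1 z - b1 z)\<^sup>2 / (m1 z)\<^sup>2 - (a2 z - b2 z)\<^sup>2 / (m2 z)\<^sup>2 +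
      2 * \<i> * ((a1 z - b1 z) * (a2 z - b2 z) / (m1 z * m2 z))))"
  have W: "W z = (Complex (u1 z) (u2 z))\<^sup>2" if "z \<in> unit_square" for z
  proof -
    have "W z = - (((a1 z - b1 z) / m1 z)\<^sup>2 - ((a2 z - b2 z) / m2 z)\<^sup>2 +
        2 * \<i> * (((a1 z - b1 z) / m1 z) * ((a2 z - b2 z) / m2 z)))"
      unfolding W_def power_divide times_divide_times_eq ..
    also have "\<dots> = (Complex (u1 z) (u2 z))\<^sup>2"
      unfolding u[OF that] by (simp add: complex_eq_iff power2_eq_square)
    finally show ?thesis .
  qed
  have "continuous_on unit_square W"
    unfolding W_def by (intro continuous_intros cont m1 m2) (use m0 in auto)
  \<comment> \<open>Distinct points differ in some coordinate, so \<open>u1\<close> and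
    \<open>u2\<close> never vanish together; this is what permits taking the root.\<close>
  moreover have "W z \<noteq> 0" if "z \<in> unit_square" for z
  proof -
    have "u1 z \<noteq> 0 \<or> u2 z \<noteq> 0" using diff[OF that] ne[OF that] by auto
    then have "Complex (u1 z) (u2 z) \<noteq> 0" by (simp add: complex_eq_iff)
    then show ?thesis unfolding W[OF that] by simp
  qed
  ultimately obtain g where g: "continuous_on unit_square g" "\<And>z. z \<in> unit_square \<Longrightarrow> W z = (g z)\<^sup>2"
    using continuous_sqrt_on_contractible[OF _ contr, of W] by metis
  have g_cases: "g z = Complex (u1 z) (u2 z) \<or> g z = - Complex (u1 z) (u2 z)" if "z \<in> unit_square" for z
    unfolding power2_eq_iff[symmetric] g(2)[OF that, symmetric] by (rule W[OF that])
  \<comment> \<open>Midpoint plus and minus half the difference, with \<open>g\<close> in place of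
    the possibly discontinuous \<open>u1\<close> and \<open>u2\<close>. The wrong sign of
    \<open>g\<close> merely swaps the two points, so the unordered pair is right in either
    case.\<close>
  define f where "f = (\<lambda>z.
    (((a1 z + b1 z) / 2 + \<i> * Re (g z) * m1 z / 2, (a2 z + b2 z) / 2 + \<i> * Im (g z) * m2 z / 2),
     ((a1 z + b1 z) / 2 - \<i> * Re (g z) * m1 z / 2, (a2 z + b2 z) / 2 - \<i> * Im (g z) * m2 z / 2)))"
  have f_cases: "f z = Y z \<or> f z = swap_pair (Y z)" if "z \<in> unit_square" for z
  proof -
    have half: "(a + b) / 2 + (a - b) / 2 = a" "(a + b) / 2 - (a - b) / 2 = b" for a b :: complex
      by (simp_all add: field_simps)
    show ?thesis using g_cases[OF that]
    proof
      assume "g z = Complex (u1 z) (u2 z)"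
      then have "f z = Y z"
        using half[of "a1 z" "b1 z"] half[of "a2 z" "b2 z"] by (simp add: f_def Y_eq diff[OF that])
      then show ?thesis by simp
    next
      assume "g z = - Complex (u1 z) (u2 z)"
      then have "f z = swap_pair (Y z)"
        using half[of "a1 z" "b1 z"] half[of "a2 z" "b2 z"] by (simp add: f_def Y_eq diff[OF that] swap_pair_def)
      then show ?thesis by simp
    qed
  qed
  show thesis
  proof (rule that)
    show "continuous_on unit_square f"
      unfolding f_def by (intro continuous_intros cont m1 m2 g) simp_all
    show "f z \<in> config_pts \<and> unordered (f z) = h z" if "z \<in> unit_square" for z
      using f_cases[OF that] Y[OF that] swap_config_pts by (metis unordered_swap)
  qed
qed

interpretation D2: path_lifting config_pts D2_torus unordered
proof
  show "continuous_map (top_of_set config_pts) D2_torus unordered"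
    using continuous_unordered by (simp add: F2_torus_eq)
next
  fix h s assume h: "continuous_map (top_of_set unit_square) D2_torus h" "s \<in> config_pts" "unordered s = h (0, 0)"
  obtain f where f: "continuous_on unit_square f"
    "\<And>z. z \<in> unit_square \<Longrightarrow> f z \<in> config_pts \<and> unordered (f z) = h z"
    using D2_lift_square[OF h(1)] by metis
  have "unordered (f (0, 0)) = unordered s" using f(2)[of "(0, 0)"] h(3) by simp
  \<comment> \<open>The lift may start at the wrong ordering; its swap is then the required
    one.\<close>
  then consider "f (0, 0) = s" | "swap_pair (f (0, 0)) = s" unfolding unordered_eq_iff by metis
  then show "\<exists>f. continuous_on unit_square f \<and> f ` unit_square \<subseteq> config_pts \<and> f (0, 0) = s \<and>
      (\<forall>z\<in>unit_square. unordered (f z) = h z)"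
  proof cases
    case 1
    then show ?thesis using f by (intro exI[of _ f] conjI ballI image_subsetI) simp_all
  next
    case 2
    have "continuous_on unit_square (\<lambda>z. swap_pair (f z))"
      unfolding swap_pair_def by (intro continuous_intros f(1))
    moreover have "(\<lambda>z. swap_pair (f z)) ` unit_square \<subseteq> config_pts"
      using f(2) swap_config_pts by (intro image_subsetI) simp
    moreover have "\<forall>z\<in>unit_square. unordered (swap_pair (f z)) = h z"
      using f(2) unordered_swap by simp
    ultimately show ?thesis using 2 by (intro exI[of _ "\<lambda>z. swap_pair (f z)"] conjI)
  qed
next
  fix p q :: "real \<Rightarrow> point \<times> point" and t :: real
  assume pq: "path p" "path q" "path_image p \<subseteq> config_pts" "path_image q \<subseteq> config_pts" "pathstart p = pathstart q"
    and eq: "\<And>t. t \<in> {0..1} \<Longrightarrow> unordered (p t) = unordered (q t)" and t: "t \<in> {0..1}"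
  let ?I = "{0..1::real}"
  \<comment> \<open>The times at which the lifts agree and those at which they are swaps of each
    other: two closed sets that cover the connected interval and are disjoint because the swap has
    no fixed point.\<close>
  let ?A = "{t \<in> ?I. p t - q t = 0}" and ?B = "{t \<in> ?I. p t - swap_pair (q t) = 0}"
  have "closed ?A" "closed ?B" unfolding swap_pair_def using pq(1,2) unfolding path_def
    by (intro continuous_closed_preimage_constant continuous_intros; simp)+
  have cover: "?I \<subseteq> ?A \<union> ?B"
  proof
    fix t assume t: "t \<in> ?I"
    have "q t = p t \<or> q t = swap_pair (p t)" using eq[OF t] unfolding unordered_eq_iff .
    then have "p t - q t = 0 \<or> p t - swap_pair (q t) = 0" by (elim disjE) simp_all
    with t show "t \<in> ?A \<union> ?B" by simp
  qed
  have "?A \<inter> ?B \<inter> ?I = {}"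
  proof -
    have ne: "q t \<noteq> swap_pair (q t)" if "t \<in> ?I" for t
    proof -
      have "q t \<in> config_pts"
        using that pq(4) unfolding path_image_def by (rule subsetD[OF _ imageI, rotated])
      then show ?thesis using swap_pair_neq[of "q t"] by simp
    qed
    show ?thesis
    proof (rule equals0I)
      fix x assume "x \<in> ?A \<inter> ?B \<inter> ?I"
      then have "x \<in> ?I" "p x - q x = 0" "p x - swap_pair (q x) = 0" by blast+
      then show False using ne[of x] by simp
    qed
  qed
  from connected_closedD[OF connected_Icc this cover \<open>closed ?A\<close> \<open>closed ?B\<close>]
  have "?A \<inter> ?I = {} \<or> ?B \<inter> ?I = {}" .
  moreover have "0 \<in> ?A \<inter> ?I" using pq(5) by (simp add: pathstart_def)
  ultimately have "t \<notin> ?B" using t by auto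
  then show "p t = q t" using cover t by auto
qed

section \<open>The two coordinate systems on the torus\<close>

text \<open>Exchanging real and imaginary parts reverses the orientation, so that only clockwise
  half-twists have to be considered.\<close>

definition exchange :: "bool \<Rightarrow> complex \<Rightarrow> complex" where
  "exchange b z = (if b then Complex (Im z) (Re z) else z)"

lemma exchange_exchange [simp]: "exchange b (exchange b z) = z"
  by (simp add: exchange_def)

lemma cis_eq_iff_Ints: "cis (2 * pi * a) = cis (2 * pi * b) \<longleftrightarrow> a - b \<in> \<int>"
proof -
  have "cis (2 * pi * a) = cis (2 * pi * b) \<longleftrightarrow>
      sin (2 * pi * a) = sin (2 * pi * b) \<and> cos (2 * pi * a) = cos (2 * pi * b)"
    unfolding complex_eq_iff cis.sel by (rule conj_commute)
  also have "\<dots> \<longleftrightarrow> (\<exists>n::int. 2 * pi * a = 2 * pi * b + 2 * pi * n)" by (rule sin_cos_eq_iff)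
  also have "\<dots> \<longleftrightarrow> (\<exists>n::int. a - b = n)"
  proof -
    have "2 * pi * a = 2 * pi * b + 2 * pi * n \<longleftrightarrow> 2 * pi * (a - b - n) = 0" for n :: real
      unfolding right_diff_distrib by linarith
    then show ?thesis by simp
  qed
  also have "\<dots> \<longleftrightarrow> a - b \<in> \<int>" unfolding Ints_def image_iff by simp
  finally show ?thesis .
qed

text \<open>A nonvanishing function on a contractible set has a continuous logarithm, whose
  imaginary part is the angle.\<close>

lemma unit_circle_lift:
  fixes f :: "'a::real_normed_vector \<Rightarrow> complex"
  assumes "continuous_on K f" "contractible K" "\<And>z. z \<in> K \<Longrightarrow> norm (f z) = 1"
  obtains g where "continuous_on K g" "\<And>z. z \<in> K \<Longrightarrow> f z = cis (2 * pi * g z)"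
proof -
  obtain g where g: "continuous_on K g" "\<And>z. z \<in> K \<Longrightarrow> f z = exp (g z)"
    by (rule continuous_logarithm_on_contractible[OF assms(1,2)]) (use assms(3) in force)+
  show thesis
  proof (rule that[of "\<lambda>z. Im (g z) / (2 * pi)"])
    fix z assume z: "z \<in> K"
    have "exp (Re (g z)) = 1" using assms(3)[OF z] g(2)[OF z] by simp
    then show "f z = cis (2 * pi * (Im (g z) / (2 * pi)))"
      using g(2)[OF z] by (simp add: exp_eq_polar)
  qed (use g(1) in \<open>auto intro!: continuous_intros\<close>)
qed

lemma torus_covering_exchange: "torus_covering (torus_cover \<circ> exchange b)"
proof
  have lat: "exchange b z \<in> grid \<longleftrightarrow> z \<in> grid" for z by (auto simp: exchange_def grid_def)
  have ex_diff: "exchange b z - exchange b w = exchange b (z - w)" for z w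
    by (simp add: exchange_def complex_eq_iff)
  have exc: "continuous_on A (exchange b)" for A
    unfolding exchange_def Complex_eq by (cases b) (auto intro!: continuous_intros)
  show "continuous_on UNIV (torus_cover \<circ> exchange b)"
    unfolding torus_cover_def o_def by (intro continuous_intros exc)
  show "(torus_cover \<circ> exchange b) z \<in> torus_pts" for z by (simp add: torus_cover_def torus_pts_def)
  show "(torus_cover \<circ> exchange b) z = (torus_cover \<circ> exchange b) w \<longleftrightarrow> z - w \<in> grid" for z w
    unfolding lat[of "z - w", symmetric] ex_diff[symmetric]
    by (simp add: torus_cover_def cis_eq_iff_Ints grid_def)
  fix f :: "real \<times> real \<Rightarrow> point" assume f: "continuous_on unit_square f" "f ` unit_square \<subseteq> torus_pts"
  have contr: "contractible unit_square" by (intro convex_imp_contractible convex_Times) simp_all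
  have unit: "norm (fst (f z)) = 1" "norm (snd (f z)) = 1" if "z \<in> unit_square" for z
  proof -
    have "f z \<in> torus_pts" using f(2) that by blast
    then show "norm (fst (f z)) = 1" "norm (snd (f z)) = 1"
      by (simp_all add: torus_pts_def mem_Times_iff)
  qed
  obtain g1 where g1: "continuous_on unit_square g1" "\<And>z. z \<in> unit_square \<Longrightarrow> fst (f z) = cis (2 * pi * g1 z)"
    using unit_circle_lift[OF continuous_on_fst[OF f(1)] contr unit(1)] by metis
  obtain g2 where g2: "continuous_on unit_square g2" "\<And>z. z \<in> unit_square \<Longrightarrow> snd (f z) = cis (2 * pi * g2 z)"
    using unit_circle_lift[OF continuous_on_snd[OF f(1)] contr unit(2)] by metis
  show "\<exists>g. continuous_on unit_square g \<and> (\<forall>z\<in>unit_square. (torus_cover \<circ> exchange b) (g z) = f z)"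
  proof (intro exI conjI ballI)
    show "continuous_on unit_square (\<lambda>z. exchange b (Complex (g1 z) (g2 z)))" unfolding Complex_eq
      by (rule continuous_on_compose2[OF exc[of UNIV], where f = "\<lambda>z. of_real (g1 z) + \<i> * of_real (g2 z)"])
        (intro continuous_intros g1 g2, simp)
    fix z assume "z \<in> unit_square"
    then show "(torus_cover \<circ> exchange b) (exchange b (Complex (g1 z) (g2 z))) = f z"
      using g1(2) g2(2) by (simp add: torus_cover_def prod_eq_iff)
  qed
qed

section \<open>Holonomy of symmetric and circular paths\<close>

text \<open>Integer translations permute the strips and preserve differences of floors, so the
  coboundary is trivial.\<close>

lemma hol_translate:
  assumes "path p" "path_image p \<subseteq> - grid" "k \<in> grid"
  shows "hol ((\<lambda>z. z + k) \<circ> p) = hol p"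
proof -
  obtain i j :: int where k: "Re k = i" "Im k = j"
    using assms(3) by (auto simp: grid_def elim!: Ints_cases)
  have "hol ((\<lambda>z. z + k) \<circ> p) =
      inv\<^bsub>F_xy\<^esub> \<one>\<^bsub>F_xy\<^esub> \<cdot> (\<lambda>w. w) (hol p) \<cdot> \<one>\<^bsub>F_xy\<^esub>"
  proof (rule H.hol_transform[where k = "\<lambda>_. \<one>\<^bsub>F_xy\<^esub>"])
    fix U assume "U \<in> strips"
    then show "\<exists>V\<in>strips. (\<lambda>z. z + k) ` U \<subseteq> V"
    proof (cases rule: strip_cases)
      case (1 n)
      then show ?thesis
        by (intro bexI[OF _ strips_intros(1)[of "n + i"]]) (auto simp: Re_strip_def k)
    next
      case (2 n)
      then show ?thesis
        by (intro bexI[OF _ strips_intros(2)[of "n + j"]]) (auto simp: Im_strip_def k)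
    qed
  next
    fix u v
    have "crossing (u + k) (v + k) = crossing u v" by (simp add: crossing_def k)
    then show "crossing (u + k) (v + k) = inv\<^bsub>F_xy\<^esub> \<one>\<^bsub>F_xy\<^esub> \<cdot> crossing u v \<cdot> \<one>\<^bsub>F_xy\<^esub>"
      by (simp only: F.inv_one F.l_one F.r_one crossing_closed F.m_closed F.one_closed)
  qed (use assms in \<open>simp_all add: Union_strips hom_def\<close>)
  then show ?thesis by (simp only: F.inv_one F.l_one F.r_one H.hol_closed)
qed

section \<open>Negation and its corrections on the grid lines\<close>

definition int_indicator :: "real \<Rightarrow> int" where
  "int_indicator x = (if x \<in> \<int> then 1 else 0)"

lemma floor_minus_int_indicator: "\<lfloor>- x\<rfloor> = int_indicator x - 1 - \<lfloor>x\<rfloor>"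
proof (cases "x \<in> \<int>")
  case True
  then show ?thesis by (auto simp: int_indicator_def elim!: Ints_cases)
next
  case False
  then have "x \<noteq> of_int \<lfloor>x\<rfloor>" by (metis Ints_of_int)
  then show ?thesis using False by (simp add: floor_minus ceiling_altdef int_indicator_def)
qed

text \<open>The map \<open>-1\<close> preserves the grid lines, but \<open>floor (-x)\<close> and \<open>- floor x - 1\<close> differ on
  them; the group element below records the difference.\<close>

definition edge_corr :: "complex \<Rightarrow> (xy \<times> bool) list" where
  "edge_corr u = free_gen Gx [^]\<^bsub>F_xy\<^esub> int_indicator (Re u) \<cdot> free_gen Gy [^]\<^bsub>F_xy\<^esub> int_indicator (Im u)"

lemma edge_corr_closed [simp]: "edge_corr u \<in> carrier F_xy"
  unfolding edge_corr_def by (intro F.m_closed F.int_pow_closed free_gen_carrier)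

lemma edge_corr_translate: "k \<in> grid \<Longrightarrow> edge_corr (u + k) = edge_corr u"
  by (simp add: edge_corr_def int_indicator_def grid_def)

lemma edge_corr_one: "Re u \<notin> \<int> \<Longrightarrow> Im u \<notin> \<int> \<Longrightarrow> edge_corr u = \<one>\<^bsub>F_xy\<^esub>"
  by (simp add: edge_corr_def int_indicator_def)

lemma power_combine:
  "inv\<^bsub>F_xy\<^esub> (free_gen a [^]\<^bsub>F_xy\<^esub> (i::int)) \<cdot> free_gen a [^]\<^bsub>F_xy\<^esub> (j::int) \<cdot> free_gen a [^]\<^bsub>F_xy\<^esub> (k::int) =
    free_gen a [^]\<^bsub>F_xy\<^esub> (- i + j + k)"
  by (simp only: F.int_pow_mult[OF free_gen_carrier] F.int_pow_neg[OF free_gen_carrier])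

text \<open>Negation permutes the strips and reverses crossing exponents up to an
  \<open>int_indicator\<close> term at each end; these terms form the coboundary of
  \<open>edge_corr\<close>.\<close>

lemma hol_uminus:
  assumes "path p" "path_image p \<subseteq> - grid"
  shows "hol (uminus \<circ> p) = inv\<^bsub>F_xy\<^esub> edge_corr (pathstart p) \<cdot> map letter_inv (hol p) \<cdot> edge_corr (pathfinish p)"
proof (rule H.hol_transform)
  fix U assume "U \<in> strips"
  then show "\<exists>V\<in>strips. uminus ` U \<subseteq> V"
  proof (cases rule: strip_cases)
    case (1 n)
    then show ?thesis by (intro bexI[OF _ strips_intros(1)[of "- n - 1"]]) (auto simp: Re_strip_def)
  next
    case (2 n)
    then show ?thesis by (intro bexI[OF _ strips_intros(2)[of "- n - 1"]]) (auto simp: Im_strip_def)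
  qed
next
  fix U u v assume U: "U \<in> strips" "u \<in> U" "v \<in> U"
  have exponent: "- int_indicator a + - (\<lfloor>b\<rfloor> - \<lfloor>a\<rfloor>) + int_indicator b = \<lfloor>- b\<rfloor> - \<lfloor>- a\<rfloor>" for a b
    by (simp add: floor_minus_int_indicator)
  show "crossing (- u) (- v) =
      inv\<^bsub>F_xy\<^esub> edge_corr u \<cdot> map letter_inv (crossing u v) \<cdot> edge_corr v"
    using U(1)
  proof (cases rule: strip_cases)
    case (1 n)
    have minus: "- u \<in> Re_strip (- n - 1)" "- v \<in> Re_strip (- n - 1)"
      using U(2,3) 1 by (auto simp: Re_strip_def)
    have corr: "edge_corr w = free_gen Gy [^]\<^bsub>F_xy\<^esub> int_indicator (Im w)" if "w \<in> U" for w
    proof -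
      have "Re w \<notin> \<int>" using that 1 no_int_between[of n "Re w"] by (simp add: Re_strip_def)
      then have "int_indicator (Re w) = 0" by (simp add: int_indicator_def)
      then show ?thesis
        unfolding edge_corr_def by (simp only: int_pow_0 F.l_one F.int_pow_closed free_gen_carrier)
    qed
    show ?thesis
      unfolding crossing_Re_strip[OF minus] crossing_Re_strip[OF U(2,3)[unfolded 1]] corr[OF U(2)] corr[OF U(3)]
        map_letter_inv_power power_combine uminus_complex.sel exponent ..
  next
    case (2 n)
    have minus: "- u \<in> Im_strip (- n - 1)" "- v \<in> Im_strip (- n - 1)"
      using U(2,3) 2 by (auto simp: Im_strip_def)
    have corr: "edge_corr w = free_gen Gx [^]\<^bsub>F_xy\<^esub> int_indicator (Re w)" if "w \<in> U" for w
    proof -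
      have "Im w \<notin> \<int>" using that 2 no_int_between[of n "Im w"] by (simp add: Im_strip_def)
      then have "int_indicator (Im w) = 0" by (simp add: int_indicator_def)
      then show ?thesis
        unfolding edge_corr_def by (simp only: int_pow_0 F.r_one F.int_pow_closed free_gen_carrier)
    qed
    show ?thesis
      unfolding crossing_Im_strip[OF minus] crossing_Im_strip[OF U(2,3)[unfolded 2]] corr[OF U(2)] corr[OF U(3)]
        map_letter_inv_power power_combine uminus_complex.sel exponent ..
  qed
qed (use assms in \<open>simp_all add: Union_strips map_letter_inv_hom\<close>)

text \<open>Logarithms of points of the punctured unit disc lie in a convex set, so that paths with the
  same logarithmic end points are homotopic.\<close>

definition polar_path :: "complex \<Rightarrow> complex \<Rightarrow> real \<Rightarrow> complex" where
  "polar_path a b = exp \<circ> linepath a b"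

lemma small_not_grid: "z \<noteq> 0 \<Longrightarrow> norm z < 1 \<Longrightarrow> z \<notin> grid"
  using grid_norm_ge_1[of z] by linarith

lemma exp_left_not_grid: "Re a < 0 \<Longrightarrow> exp a \<notin> grid"
  by (rule small_not_grid) simp_all

lemma polar_path_simps [simp]:
  "path (polar_path a b)" "pathstart (polar_path a b) = exp a" "pathfinish (polar_path a b) = exp b"
  by (simp_all add: polar_path_def pathstart_compose pathfinish_compose path_continuous_image continuous_on_exp)

lemma polar_path_subset:
  assumes "Re a < 0" "Re b < 0"
  shows "path_image (polar_path a b) \<subseteq> - grid"
proof -
  have "closed_segment a b \<subseteq> {z. Re z < 0}"
    using assms by (intro closed_segment_subset convex_halfspace_Re_lt) simp_all
  then show ?thesis unfolding polar_path_def path_image_compose path_image_linepath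
    by (intro image_subsetI) (use exp_left_not_grid in blast)
qed

lemma hol_polar_path_mult:
  assumes "Re a < 0" "Re b < 0" "Re d < 0"
  shows "hol (polar_path a b) \<cdot> hol (polar_path b d) = hol (polar_path a d)"
proof -
  let ?L = "{z. Re z < 0}"
  have seg: "closed_segment p q \<subseteq> ?L" if "Re p < 0" "Re q < 0" for p q
    using that by (intro closed_segment_subset convex_halfspace_Re_lt) simp_all
  have "homotopic_paths ?L (linepath a b +++ linepath b d) (linepath a d)"
    by (intro homotopic_paths_convex convex_halfspace_Re_lt)
      (use seg assms in \<open>simp_all add: path_image_join\<close>)
  then have "exp \<circ> (linepath a b +++ linepath b d) \<simeq> exp \<circ> linepath a d"
    by (rule homotopic_paths_continuous_image) (auto intro: continuous_intros simp: exp_left_not_grid)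
  then have "hol (exp \<circ> (linepath a b +++ linepath b d)) = hol (polar_path a d)"
    unfolding polar_path_def by (intro H.hol_homotopic) (simp add: Union_strips)
  moreover have "exp \<circ> (linepath a b +++ linepath b d) = polar_path a b +++ polar_path b d"
    by (simp add: polar_path_def path_compose_join)
  ultimately show ?thesis
    using H.hol_join[of "polar_path a b" "polar_path b d"] polar_path_subset assms by (simp add: Union_strips)
qed

lemma hol_polar_path_inv:
  assumes "Re a < 0" "Re b < 0"
  shows "hol (polar_path b a) = inv\<^bsub>F_xy\<^esub> hol (polar_path a b)"
proof -
  have "hol (polar_path a a) \<cdot> hol (polar_path a a) = hol (polar_path a a)"
    using hol_polar_path_mult assms by blast
  then have "hol (polar_path a a) = \<one>\<^bsub>F_xy\<^esub>" using F.r_cancel_one H.hol_closed by blast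
  then have "hol (polar_path b a) \<cdot> hol (polar_path a b) = \<one>\<^bsub>F_xy\<^esub>"
    using hol_polar_path_mult[OF assms(2,1,2)] hol_polar_path_mult[OF assms(1,2,1)] F.inv_comm H.hol_closed by metis
  then show ?thesis by (rule F.inv_equality[symmetric]) simp_all
qed

lemma linepath_add: "linepath (a + k) (b + k) t = linepath a b t + k"
  by (simp add: linepath_def algebra_simps)

text \<open>Subtracting \<open>\<i> * pi\<close> from a logarithm is a clockwise half turn, that is,
  negation.\<close>

lemma polar_path_half_turn: "polar_path (a - \<i> * pi) (b - \<i> * pi) = uminus \<circ> polar_path a b"
  using linepath_add[of a "- (\<i> * pi)" b] by (auto simp: polar_path_def exp_diff)

lemma hol_polar_path_half_turn:
  assumes "Re a < 0" "Re b < 0"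
  shows "hol (polar_path (a - \<i> * pi) (b - \<i> * pi)) =
    inv\<^bsub>F_xy\<^esub> edge_corr (exp a) \<cdot> map letter_inv (hol (polar_path a b)) \<cdot> edge_corr (exp b)"
  unfolding polar_path_half_turn using hol_uminus[OF _ polar_path_subset[OF assms]] by simp

text \<open>The clockwise half turn from a point of the second quadrant crosses the imaginary axis
  before the real one, so that its word is \<open>x y\<^sup>-\<^sup>1\<close> without any conjugation.\<close>

definition ref_log :: complex where
  "ref_log = Complex (- ln 2) (3 * pi / 4)"

definition twist_word :: "(xy \<times> bool) list" where
  "twist_word = free_gen Gx \<cdot> inv\<^bsub>F_xy\<^esub> (free_gen Gy)"

lemma twist_word_closed [simp]: "twist_word \<in> carrier F_xy"
  unfolding twist_word_def by (intro F.m_closed F.inv_closed free_gen_carrier)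

lemma Re_ref_log [simp]: "Re ref_log < 0"
  by (simp add: ref_log_def)

text \<open>The real part \<open>- ln 2\<close> stands for the circle of radius 1/2, which separates
  the puncture 0 from all other grid points.\<close>

lemma exp_ref: "exp (Complex (- ln 2) t) = Complex (cos t / 2) (sin t / 2)"
  by (simp add: exp_eq_polar complex_eq_iff exp_minus)

lemma exp_ref_log: "exp ref_log = Complex (- (sqrt 2 / 4)) (sqrt 2 / 4)"
proof -
  have angle: "3 * pi / 4 = pi - pi / 4" by simp
  show ?thesis
    unfolding ref_log_def exp_ref unfolding angle cos_pi_minus sin_pi_minus cos_45 sin_45 by simp
qed

lemma sqrt_2_bounds: "0 < sqrt 2 / 4" "sqrt 2 / 4 < 1"
  using real_sqrt_less_mono[of 2 16] by simp_all

lemma edge_corr_ref [simp]: "edge_corr (exp ref_log) = \<one>\<^bsub>F_xy\<^esub>"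
proof (rule edge_corr_one)
  show "Re (exp ref_log) \<notin> \<int>"
    using no_int_between[of "-1" "Re (exp ref_log)"] sqrt_2_bounds by (simp add: exp_ref_log)
  show "Im (exp ref_log) \<notin> \<int>"
    using no_int_between[of 0 "Im (exp ref_log)"] sqrt_2_bounds by (simp add: exp_ref_log)
qed

lemma polar_path_circle:
  "polar_path (Complex (- ln 2) a) (Complex (- ln 2) b) t = Complex (cos (linepath a b t) / 2) (sin (linepath a b t) / 2)"
proof -
  have "linepath (Complex (- ln 2) a) (Complex (- ln 2) b) t = Complex (- ln 2) (linepath a b t)"
    by (simp add: linepath_def complex_eq_iff algebra_simps)
  then show ?thesis by (simp add: polar_path_def exp_ref)
qed

lemma hol_ref_half_turn: "hol (polar_path ref_log (ref_log - \<i> * pi)) = twist_word"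
proof -
  let ?z = "\<lambda>t. Complex (- ln 2) t"
  have ref: "?z (3 * pi / 4) = ref_log" by (simp add: ref_log_def)
  have exp_1: "exp (?z (pi / 4)) = Complex (sqrt 2 / 4) (sqrt 2 / 4)"
    unfolding exp_ref cos_45 sin_45 by simp
  have exp_2: "exp (?z (- pi / 4)) = Complex (sqrt 2 / 4) (- (sqrt 2 / 4))"
    unfolding exp_ref minus_divide_left[symmetric] cos_minus sin_minus cos_45 sin_45 by simp
  have seg: "linepath a b t \<in> closed_segment a b" if "t \<in> {0..1}" for a b t :: real
    using that unfolding path_image_linepath[symmetric] path_image_def by blast
  have floors: "\<lfloor>sqrt 2 / 4\<rfloor> = 0" "\<lfloor>- (sqrt 2 / 4)\<rfloor> = - 1"
    using sqrt_2_bounds by (simp_all add: floor_eq_iff)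
  have "path_image (polar_path (?z (3 * pi / 4)) (?z (pi / 4))) \<subseteq> Im_strip 0"
    unfolding path_image_def
  proof (rule image_subsetI)
    fix t :: real assume "t \<in> {0..1}"
    then have "pi / 4 \<le> linepath (3 * pi / 4) (pi / 4) t" "linepath (3 * pi / 4) (pi / 4) t \<le> 3 * pi / 4"
      using seg[of t "3 * pi / 4" "pi / 4"] by (simp_all add: closed_segment_eq_real_ivl split: if_splits)
    then have "0 < linepath (3 * pi / 4) (pi / 4) t" "linepath (3 * pi / 4) (pi / 4) t < pi"
      using pi_gt_zero by linarith+
    then have "0 < sin (linepath (3 * pi / 4) (pi / 4) t)" by (rule sin_gt_zero)
    then show "polar_path (?z (3 * pi / 4)) (?z (pi / 4)) t \<in> Im_strip 0"
      using le_less_trans[OF sin_le_one, of 2 "linepath (3 * pi / 4) (pi / 4) t"]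
      unfolding polar_path_circle Im_strip_def by simp
  qed
  \<comment> \<open>Upper arc: the imaginary axis is crossed from left to right, which gives
    \<open>x\<close>.\<close>
  have 1: "hol (polar_path (?z (3 * pi / 4)) (?z (pi / 4))) = free_gen Gx"
    unfolding H.hol_within[OF \<open>_ \<subseteq> Im_strip 0\<close> strips_intros(2)] unfolding polar_path_simps ref exp_ref_log exp_1
    by (simp add: crossing_def floors F.int_pow_1[OF free_gen_carrier] F.r_one[OF free_gen_carrier])
  have "path_image (polar_path (?z (pi / 4)) (?z (- pi / 4))) \<subseteq> Re_strip 0" unfolding path_image_def
  proof (rule image_subsetI)
    fix t :: real assume "t \<in> {0..1}"
    then have "- pi / 4 \<le> linepath (pi / 4) (- pi / 4) t" "linepath (pi / 4) (- pi / 4) t \<le> pi / 4"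
      using seg[of t "pi / 4" "- pi / 4"] by (simp_all add: closed_segment_eq_real_ivl split: if_splits)
    then have "- (pi / 2) < linepath (pi / 4) (- pi / 4) t" "linepath (pi / 4) (- pi / 4) t < pi / 2"
      using pi_gt_zero by linarith+
    then have "0 < cos (linepath (pi / 4) (- pi / 4) t)" by (rule cos_gt_zero_pi)
    then show "polar_path (?z (pi / 4)) (?z (- pi / 4)) t \<in> Re_strip 0"
      using le_less_trans[OF cos_le_one, of 2 "linepath (pi / 4) (- pi / 4) t"]
      unfolding polar_path_circle Re_strip_def by simp
  qed
  \<comment> \<open>Right arc: the real axis is crossed downwards, which gives the inverse of
    \<open>y\<close>.\<close>
  have 2: "hol (polar_path (?z (pi / 4)) (?z (- pi / 4))) = inv\<^bsub>F_xy\<^esub> (free_gen Gy)"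
    unfolding H.hol_within[OF \<open>_ \<subseteq> Re_strip 0\<close> strips_intros(1)] unfolding polar_path_simps exp_1 exp_2
    by (simp add: crossing_def floors F.int_pow_neg[OF free_gen_carrier] F.int_pow_1[OF free_gen_carrier])
  have "ref_log - \<i> * pi = ?z (- pi / 4)" by (simp add: ref_log_def complex_eq_iff)
  then show ?thesis
    using hol_polar_path_mult[of "?z (3 * pi / 4)" "?z (pi / 4)" "?z (- pi / 4)"] 1 2
    by (simp add: twist_word_def ref_log_def)
qed

lemma full_twist_word:
  "twist_word \<cdot> map letter_inv twist_word = commutator F_xy (free_gen Gx) (inv\<^bsub>F_xy\<^esub> (free_gen Gy))"
proof -
  have J: "map letter_inv (free_gen a) = inv\<^bsub>F_xy\<^esub> (free_gen a)" for a
    by (simp add: free_gen_def inv_letter)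
  show ?thesis unfolding twist_word_def commutator_def
    by (simp only: J.hom_mult J.hom_inv J free_gen_carrier F.inv_closed F.m_closed F.m_assoc)
qed

section \<open>Half and full turns from an arbitrary point\<close>

context
  fixes a :: complex assumes a: "Re a < 0"
begin

text \<open>The turn is deformed to pass through the reference point. Its last leg is the negative
  of the reversed first leg, so \<open>hol_uminus\<close> yields its word; the correction remains
  because \<open>exp a\<close> may lie on a grid line.\<close>

lemma hol_half_turn:
  "hol (polar_path a (a - \<i> * pi)) = hol (polar_path a ref_log) \<cdot> twist_word \<cdot>
     inv\<^bsub>F_xy\<^esub> (map letter_inv (hol (polar_path a ref_log))) \<cdot> edge_corr (exp a)"
proof -
  let ?g = "hol (polar_path a ref_log)"
  have Re: "Re (a - \<i> * pi) < 0" "Re (ref_log - \<i> * pi) < 0" using a by simp_all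
  have "hol (polar_path a (a - \<i> * pi)) =
      ?g \<cdot> hol (polar_path ref_log (ref_log - \<i> * pi)) \<cdot> hol (polar_path (ref_log - \<i> * pi) (a - \<i> * pi))"
    by (simp only: hol_polar_path_mult[OF a Re_ref_log Re(2)] hol_polar_path_mult[OF a Re(2) Re(1)])
  also have "hol (polar_path (ref_log - \<i> * pi) (a - \<i> * pi)) = inv\<^bsub>F_xy\<^esub> (map letter_inv ?g) \<cdot> edge_corr (exp a)"
    unfolding hol_polar_path_half_turn[OF Re_ref_log a] edge_corr_ref hol_polar_path_inv[OF a Re_ref_log]
    by (simp only: J.hom_inv H.hol_closed F.inv_one F.l_one F.inv_closed J.hom_closed)
  finally show ?thesis unfolding hol_ref_half_turn
    by (simp only: F.m_assoc F.m_closed F.inv_closed H.hol_closed J.hom_closed twist_word_closed edge_corr_closed)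
qed

text \<open>After two half turns the last leg is the reversed first leg itself, so no correction
  survives and the word is a true conjugate.\<close>

lemma hol_full_turn:
  "hol (polar_path a (a - \<i> * pi)) \<cdot> hol (uminus \<circ> polar_path a (a - \<i> * pi)) =
     hol (polar_path a ref_log) \<cdot> (twist_word \<cdot> map letter_inv twist_word) \<cdot>
     inv\<^bsub>F_xy\<^esub> hol (polar_path a ref_log)"
proof -
  let ?g = "hol (polar_path a ref_log)" and ?a1 = "a - \<i> * pi" and ?r1 = "ref_log - \<i> * pi"
  let ?a2 = "?a1 - \<i> * pi" and ?r2 = "?r1 - \<i> * pi"
  have Re: "Re ?a1 < 0" "Re ?r1 < 0" "Re ?a2 < 0" "Re ?r2 < 0" using a by simp_all
  have "polar_path ?r2 ?a2 = polar_path ref_log a"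
    unfolding polar_path_half_turn by (simp add: fun_eq_iff)
  then have final: "hol (polar_path ?r2 ?a2) = inv\<^bsub>F_xy\<^esub> ?g"
    by (simp add: hol_polar_path_inv[OF a Re_ref_log])
  have second: "hol (polar_path ?r1 ?r2) = map letter_inv twist_word"
    unfolding hol_polar_path_half_turn[OF Re_ref_log Re(2)] edge_corr_ref hol_ref_half_turn
  proof -
    have "edge_corr (exp ?r1) = \<one>\<^bsub>F_xy\<^esub>"
    proof -
      have "exp ?r1 = - exp ref_log" by (simp add: exp_diff)
      moreover have "edge_corr (- u) = edge_corr u" for u
        by (simp add: edge_corr_def int_indicator_def)
      ultimately show ?thesis by simp
    qed
    then show "inv\<^bsub>F_xy\<^esub> \<one>\<^bsub>F_xy\<^esub> \<cdot> map letter_inv twist_word \<cdot> edge_corr (exp ?r1) = map letter_inv twist_word"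
      by (simp only: F.inv_one F.l_one F.r_one J.hom_closed twist_word_closed)
  qed
  have "hol (polar_path a ?a1) \<cdot> hol (polar_path ?a1 ?a2) =
      ?g \<cdot> (hol (polar_path ref_log ?r1) \<cdot> hol (polar_path ?r1 ?r2)) \<cdot> hol (polar_path ?r2 ?a2)"
    by (simp only: hol_polar_path_mult a Re Re_ref_log)
  then show ?thesis unfolding final second hol_ref_half_turn polar_path_half_turn[of a ?a1] .
qed

end

section \<open>Braid groups of the torus\<close>

lemma homotopic_paths_Pair:
  fixes P P' :: "real \<Rightarrow> 'a::topological_space \<times> 'b::topological_space"
  assumes "homotopic_paths A (fst \<circ> P) (fst \<circ> P')" "homotopic_paths B (snd \<circ> P) (snd \<circ> P')"
  shows "homotopic_paths (A \<times> B) P P'"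
proof -
  obtain h where h: "continuous_on unit_square h" "h \<in> unit_square \<rightarrow> A"
    "\<forall>x\<in>{0..1}. h (0, x) = (fst \<circ> P) x" "\<forall>x\<in>{0..1}. h (1, x) = (fst \<circ> P') x"
    "\<forall>t\<in>{0..1}. pathstart (h \<circ> Pair t) = pathstart (fst \<circ> P) \<and> pathfinish (h \<circ> Pair t) = pathfinish (fst \<circ> P)"
    using assms(1) unfolding homotopic_paths by (elim exE conjE)
  obtain k where k: "continuous_on unit_square k" "k \<in> unit_square \<rightarrow> B"
    "\<forall>x\<in>{0..1}. k (0, x) = (snd \<circ> P) x" "\<forall>x\<in>{0..1}. k (1, x) = (snd \<circ> P') x"
    "\<forall>t\<in>{0..1}. pathstart (k \<circ> Pair t) = pathstart (snd \<circ> P) \<and> pathfinish (k \<circ> Pair t) = pathfinish (snd \<circ> P)"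
    using assms(2) unfolding homotopic_paths by (elim exE conjE)
  show ?thesis unfolding homotopic_paths
  proof (intro exI conjI)
    show "continuous_on unit_square (\<lambda>z. (h z, k z))" by (intro continuous_intros h k)
    show "(\<lambda>z. (h z, k z)) \<in> unit_square \<rightarrow> A \<times> B" using h(2) k(2) by (simp add: Pi_iff)
  qed (use h(3-5) k(3-5) in \<open>simp_all add: pathstart_def pathfinish_def prod_eq_iff\<close>)
qed

abbreviation cover_pts :: "(complex \<times> complex) set" where
  "cover_pts \<equiv> UNIV \<times> - grid"

abbreviation deck :: "(complex \<times> complex) set" where
  "deck \<equiv> grid \<times> grid"

lemma deck_add: "d \<in> deck \<Longrightarrow> d' \<in> deck \<Longrightarrow> d + d' \<in> deck"
  by (simp add: mem_Times_iff grid_add)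

lemma path_image_cover_iff: "path_image P \<subseteq> cover_pts \<longleftrightarrow> path_image (snd \<circ> P) \<subseteq> - grid"
proof -
  have "A \<subseteq> UNIV \<times> B \<longleftrightarrow> snd ` A \<subseteq> B" for A :: "(complex \<times> complex) set" and B by force
  then show ?thesis unfolding path_image_compose .
qed

definition cover_path :: "complex \<times> complex \<Rightarrow> (real \<Rightarrow> complex \<times> complex) \<Rightarrow> bool" where
  "cover_path s P \<longleftrightarrow> path P \<and> path_image P \<subseteq> cover_pts \<and> pathstart P = s"

lemma cover_pathD:
  assumes "cover_path s P"
  shows "path P" "path_image P \<subseteq> cover_pts" "pathstart P = s"
    "path (fst \<circ> P)" "path (snd \<circ> P)" "path_image (snd \<circ> P) \<subseteq> - grid"
  using assms by (auto simp: cover_path_def path_image_compose intro!: path_continuous_image continuous_intros)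

text \<open>In the first factor, a plane, only the end points matter; in the second, end points and
  word are complete by \<open>homotopic_iff_hol\<close>.\<close>

lemma cover_homotopic_iff:
  assumes P: "cover_path s P" and P': "cover_path s P'"
  shows "homotopic_paths cover_pts P P' \<longleftrightarrow> pathfinish P = pathfinish P' \<and> hol (snd \<circ> P) = hol (snd \<circ> P')"
proof
  assume hom: "homotopic_paths cover_pts P P'"
  have "snd \<circ> P \<simeq> snd \<circ> P'"
    by (rule homotopic_paths_continuous_image[OF hom]) (auto intro!: continuous_intros)
  then have "hol (snd \<circ> P) = hol (snd \<circ> P')" by (intro H.hol_homotopic) (simp add: Union_strips)
  with homotopic_paths_imp_pathfinish[OF hom]
  show "pathfinish P = pathfinish P' \<and> hol (snd \<circ> P) = hol (snd \<circ> P')" by simp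
next
  assume eq: "pathfinish P = pathfinish P' \<and> hol (snd \<circ> P) = hol (snd \<circ> P')"
  note D = cover_pathD[OF P] cover_pathD[OF P']
  show "homotopic_paths cover_pts P P'"
  proof (rule homotopic_paths_Pair)
    show "homotopic_paths UNIV (fst \<circ> P) (fst \<circ> P')"
      by (rule homotopic_paths_convex) (use D eq in \<open>simp_all add: pathstart_compose pathfinish_compose\<close>)
    show "snd \<circ> P \<simeq> snd \<circ> P'"
      by (subst homotopic_iff_hol) (use D eq in \<open>simp_all add: pathstart_compose pathfinish_compose\<close>)
  qed
qed

definition translate :: "complex \<times> complex \<Rightarrow> (real \<Rightarrow> complex \<times> complex) \<Rightarrow> real \<Rightarrow> complex \<times> complex" where
  "translate d P = (\<lambda>t. P t + d)"

lemma translate_ends [simp]: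
  "pathstart (translate d P) = pathstart P + d" "pathfinish (translate d P) = pathfinish P + d"
  by (simp_all add: translate_def pathstart_def pathfinish_def)

lemma cover_path_translate:
  assumes "cover_path s P" "d \<in> deck"
  shows "cover_path (s + d) (translate d P)" "hol (snd \<circ> translate d P) = hol (snd \<circ> P)"
proof -
  note D = cover_pathD[OF assms(1)]
  have "path (translate d P)"
    using D(1) unfolding path_def translate_def by (intro continuous_intros)
  moreover have "path_image (translate d P) \<subseteq> cover_pts"
  proof -
    have "snd (P t) + snd d \<in> - grid" if "t \<in> {0..1}" for t
      using subsetD[OF D(6)[unfolded path_image_def] imageI[OF that]] assms(2) by (simp add: mem_Times_iff)
    then show ?thesis unfolding path_image_cover_iff unfolding path_image_def
      by (intro image_subsetI) (simp add: translate_def)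
  qed
  ultimately show "cover_path (s + d) (translate d P)" using D(3) by (simp add: cover_path_def)
  have "snd \<circ> translate d P = (\<lambda>z. z + snd d) \<circ> (snd \<circ> P)" by (simp add: translate_def fun_eq_iff)
  then show "hol (snd \<circ> translate d P) = hol (snd \<circ> P)"
    using hol_translate[OF D(5,6)] assms(2) by (simp add: mem_Times_iff)
qed

lemma cover_path_join:
  assumes "cover_path s P" "cover_path (pathfinish P) Q"
  shows "cover_path s (P +++ Q)" "hol (snd \<circ> (P +++ Q)) = hol (snd \<circ> P) \<cdot> hol (snd \<circ> Q)"
proof -
  note D = cover_pathD[OF assms(1)] cover_pathD[OF assms(2)]
  show "cover_path s (P +++ Q)" using D by (simp add: cover_path_def path_image_join)
  show "hol (snd \<circ> (P +++ Q)) = hol (snd \<circ> P) \<cdot> hol (snd \<circ> Q)" unfolding path_compose_join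
    by (rule H.hol_join) (use D in \<open>simp_all add: Union_strips pathstart_compose pathfinish_compose\<close>)
qed

text \<open>A lift of the exchange of the two points to the cover.\<close>

definition flip :: "complex \<times> complex \<Rightarrow> complex \<times> complex" where
  "flip s = (fst s - snd s, - snd s)"

lemma cover_path_flip:
  assumes "cover_path s P"
  shows "cover_path (flip s) (flip \<circ> P)" "pathfinish (flip \<circ> P) = flip (pathfinish P)"
    "snd \<circ> (flip \<circ> P) = uminus \<circ> (snd \<circ> P)"
proof -
  note D = cover_pathD[OF assms]
  have "path (flip \<circ> P)"
    unfolding flip_def using D(1) by (intro path_continuous_image) (auto intro!: continuous_intros)
  moreover have "path_image (flip \<circ> P) \<subseteq> cover_pts"
    using D(2) unfolding path_image_compose by (auto simp: flip_def)
  ultimately show "cover_path (flip s) (flip \<circ> P)"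
    using D(3) by (simp add: cover_path_def pathstart_compose)
qed (simp_all add: pathfinish_compose flip_def fun_eq_iff)

section \<open>Braids at a fixed base pair\<close>

locale torus_half_twist = torus_covering tc for tc +
  fixes c v :: complex
  assumes v_pos: "0 < norm v" and v_small: "norm v < 1 / 2"
begin

text \<open>The second entry is the difference of \<open>c + v\<close> and \<open>c - v\<close>. By
  the bounds on \<open>v\<close> it lies in the punctured unit disc, away from the grid.\<close>

definition base :: "complex \<times> complex" where
  "base = (c + v, 2 * v)"

definition y0 :: "point \<times> point" where
  "y0 = (tc (c + v), tc (c - v))"

abbreviation P2 :: "(real \<Rightarrow> point \<times> point) set monoid" where
  "P2 \<equiv> pure_braid_group y0"

abbreviation B2 :: "(real \<Rightarrow> point set) set monoid" where
  "B2 \<equiv> full_braid_group y0"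

abbreviation incl :: "(real \<Rightarrow> point \<times> point) set \<Rightarrow> (real \<Rightarrow> point set) set" where
  "incl \<equiv> braid_incl y0"

text \<open>Clockwise in the coordinates of \<open>tc\<close>; the other orientation is obtained by
  choosing a different \<open>tc\<close>.\<close>

definition sigma :: "(real \<Rightarrow> point set) set" where
  "sigma = loop_class D2_torus (unordered y0)
     (\<lambda>t. unordered (tc (c + cis (- pi * t) * v), tc (c - cis (- pi * t) * v)))"

definition braid_cover :: "complex \<times> complex \<Rightarrow> point set" where
  "braid_cover = unordered \<circ> pair_cover"

lemma pair_cover_base: "pair_cover base = y0"
  by (simp add: pair_cover_def base_def y0_def)

lemma base_in: "base \<in> cover_pts"
  using small_not_grid[of "2 * v"] v_pos v_small by (simp add: base_def norm_mult)

lemma y0_in: "y0 \<in> config_pts"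
  using pair.continuous base_in unfolding F2_torus_eq pair_cover_base[symmetric]
  by (auto simp: continuous_map_in_subtopology)

sublocale full: path_lifting cover_pts D2_torus braid_cover
  unfolding braid_cover_def
  by (rule path_lifting_compose[OF pair.path_lifting_axioms[unfolded F2_torus_eq] D2.path_lifting_axioms])

sublocale P2: group P2
  unfolding pure_braid_group_def by (rule group_fundamental_group) (simp add: y0_in)

sublocale B2: group B2
  unfolding full_braid_group_def by (rule group_fundamental_group) (simp add: y0_in)

lemma pair_cover_flip: "pair_cover (flip s) = swap_pair (pair_cover s)"
  by (simp add: pair_cover_def flip_def swap_pair_def)

lemma braid_cover_flip: "braid_cover (flip s) = braid_cover s"
  by (simp add: braid_cover_def pair_cover_flip)

lemma pair_cover_translate: "d \<in> deck \<Longrightarrow> pair_cover \<circ> translate d P = pair_cover \<circ> P"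
  by (auto simp: fun_eq_iff translate_def pair_cover_eq_iff)

section \<open>Braids as classes of lifted paths\<close>

definition pure_class :: "(real \<Rightarrow> complex \<times> complex) \<Rightarrow> (real \<Rightarrow> point \<times> point) set" where
  "pure_class P = loop_class F2_torus y0 (pair_cover \<circ> P)"

definition full_class :: "(real \<Rightarrow> complex \<times> complex) \<Rightarrow> (real \<Rightarrow> point set) set" where
  "full_class P = loop_class D2_torus (unordered y0) (braid_cover \<circ> P)"

definition pure_path :: "(real \<Rightarrow> complex \<times> complex) \<Rightarrow> bool" where
  "pure_path P \<longleftrightarrow> cover_path base P \<and> pathfinish P - base \<in> deck"

definition full_path :: "(real \<Rightarrow> complex \<times> complex) \<Rightarrow> bool" where
  "full_path P \<longleftrightarrow> cover_path base P \<and> braid_cover (pathfinish P) = unordered y0"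

lemma pure_path_iff: "pure_path P \<longleftrightarrow> cover_path base P \<and> pair_cover (pathfinish P) = y0"
  unfolding pure_path_def pair_cover_base[symmetric] pair_cover_eq_iff by (simp add: mem_Times_iff)

lemma pure_imp_full: "pure_path P \<Longrightarrow> full_path P"
  by (simp add: pure_path_iff full_path_def braid_cover_def)

lemma pure_loop: "pure_path P \<Longrightarrow> pair_cover \<circ> P \<in> loops_at F2_torus y0"
  by (rule pair.compose_in_loops) (simp_all add: pure_path_iff cover_path_def pair_cover_base)

lemma full_loop: "full_path P \<Longrightarrow> braid_cover \<circ> P \<in> loops_at D2_torus (unordered y0)"
  by (rule full.compose_in_loops) (simp_all add: full_path_def cover_path_def braid_cover_def pair_cover_base)

lemma pure_class_carrier: "pure_path P \<Longrightarrow> pure_class P \<in> carrier P2"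
  unfolding pure_class_def pure_braid_group_def by (intro loop_class_carrier pure_loop)

lemma full_class_carrier: "full_path P \<Longrightarrow> full_class P \<in> carrier B2"
  unfolding full_class_def full_braid_group_def by (intro loop_class_carrier full_loop)

lemma pure_class_surj:
  assumes "A \<in> carrier P2" obtains P where "pure_path P" "A = pure_class P"
proof -
  have "A \<in> carrier (fundamental_group F2_torus (pair_cover base))"
    using assms by (simp add: pair_cover_base pure_braid_group_def)
  then show thesis using base_in
  proof (rule pair.ex_lift_of_class)
    fix P assume "path P" "path_image P \<subseteq> cover_pts" "pathstart P = base"
      "pair_cover (pathfinish P) = pair_cover base"
      "A = loop_class F2_torus (pair_cover base) (pair_cover \<circ> P)"
    then show thesis
      by (intro that[of P]) (simp_all add: pure_path_iff cover_path_def pair_cover_base pure_class_def)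
  qed
qed

lemma full_class_surj:
  assumes "A \<in> carrier B2" obtains P where "full_path P" "A = full_class P"
proof -
  have b: "braid_cover base = unordered y0" by (simp add: braid_cover_def pair_cover_base)
  have "A \<in> carrier (fundamental_group D2_torus (braid_cover base))"
    using assms by (simp add: b full_braid_group_def)
  then show thesis using base_in
  proof (rule full.ex_lift_of_class)
    fix P assume "path P" "path_image P \<subseteq> cover_pts" "pathstart P = base"
      "braid_cover (pathfinish P) = braid_cover base"
      "A = loop_class D2_torus (braid_cover base) (braid_cover \<circ> P)"
    then show thesis
      by (intro that[of P]) (simp_all add: full_path_def cover_path_def b full_class_def)
  qed
qed

lemma pure_class_eq_iff:
  assumes "pure_path P" "pure_path P'"
  shows "pure_class P = pure_class P' \<longleftrightarrow> pathfinish P = pathfinish P' \<and> hol (snd \<circ> P) = hol (snd \<circ> P')"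
  unfolding pure_class_def by (subst pair.loop_class_eq_iff_homotopic_paths)
    (use assms cover_homotopic_iff[of base P P'] in \<open>simp_all add: pure_path_iff cover_path_def pair_cover_base\<close>)

lemma full_class_eq_iff:
  assumes "full_path P" "full_path P'"
  shows "full_class P = full_class P' \<longleftrightarrow> pathfinish P = pathfinish P' \<and> hol (snd \<circ> P) = hol (snd \<circ> P')"
  unfolding full_class_def by (subst full.loop_class_eq_iff_homotopic_paths)
    (use assms cover_homotopic_iff[of base P P'] in
      \<open>simp_all add: full_path_def cover_path_def braid_cover_def pair_cover_base\<close>)

lemma incl_pure_class: "pure_path P \<Longrightarrow> incl (pure_class P) = full_class P"
  using induced_hom_loop_class[OF continuous_unordered pure_loop]
  by (simp add: braid_incl_def pure_class_def full_class_def braid_cover_def comp_assoc)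

text \<open>Injectivity is immediate, because one lift represents both a pure braid and its image,
  and both classes are determined by its end point and word.\<close>

lemma incl_mon: "incl \<in> mon P2 B2"
  unfolding mon_def
proof (intro CollectI conjI inj_onI)
  show "incl \<in> hom P2 B2" using induced_hom_is_hom[OF continuous_unordered]
    by (simp add: braid_incl_def[abs_def] pure_braid_group_def full_braid_group_def)
  fix A B assume "A \<in> carrier P2" "B \<in> carrier P2" and eq: "incl A = incl B"
  then obtain P Q where P: "pure_path P" "A = pure_class P" and Q: "pure_path Q" "B = pure_class Q"
    using pure_class_surj by metis
  have "full_class P = full_class Q" using eq P Q by (simp add: incl_pure_class)
  then show "A = B"
    unfolding P(2) Q(2) full_class_eq_iff[OF pure_imp_full[OF P(1)] pure_imp_full[OF Q(1)]]
      pure_class_eq_iff[OF P(1) Q(1)] .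
qed

text \<open>The second lift must start where the first one ends. The deck translation that achieves
  this changes neither its braid nor its word.\<close>

lemma pure_path_join:
  assumes "pure_path P" "pure_path P'"
  defines "Q \<equiv> P +++ translate (pathfinish P - base) P'"
  shows "pure_path Q" "pure_class P \<otimes>\<^bsub>P2\<^esub> pure_class P' = pure_class Q"
    "hol (snd \<circ> Q) = hol (snd \<circ> P) \<cdot> hol (snd \<circ> P')" "pathfinish Q = pathfinish P + pathfinish P' - base"
proof -
  let ?d = "pathfinish P - base"
  have d: "?d \<in> deck" and P: "cover_path base P" and P': "cover_path base P'" "pathfinish P' - base \<in> deck"
    using assms(1,2) by (simp_all add: pure_path_def)
  have T: "cover_path (pathfinish P) (translate ?d P')" "hol (snd \<circ> translate ?d P') = hol (snd \<circ> P')"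
    using cover_path_translate[OF P'(1) d] by simp_all
  show fin: "pathfinish Q = pathfinish P + pathfinish P' - base" by (simp add: Q_def)
  have "pathfinish Q - base = ?d + (pathfinish P' - base)" unfolding fin by simp
  then have "pathfinish Q - base \<in> deck" using deck_add[OF d P'(2)] by (simp only:)
  then show "pure_path Q" using cover_path_join(1)[OF P T(1)] by (simp add: pure_path_def Q_def)
  show "hol (snd \<circ> Q) = hol (snd \<circ> P) \<cdot> hol (snd \<circ> P')"
    using cover_path_join(2)[OF P T(1)] T(2) by (simp add: Q_def)
  have "loop_join (pair_cover \<circ> P) (pair_cover \<circ> P') = pair_cover \<circ> Q"
    unfolding Q_def pair_cover_translate[OF d, of P', symmetric] by (rule loop_join_compose)
  then show "pure_class P \<otimes>\<^bsub>P2\<^esub> pure_class P' = pure_class Q"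
    unfolding pure_class_def pure_braid_group_def
    by (simp only: loop_class_mult pure_loop assms(1,2))
qed

text \<open>\<open>Q\<close> is the lift of the second braid that starts at the end of
  \<open>P\<close>: a deck translate after a pure braid, one involving \<open>flip\<close> after a
  half-twist.\<close>

lemma full_class_mult:
  assumes "full_path P" "full_path P'" "cover_path (pathfinish P) Q" "braid_cover \<circ> Q = braid_cover \<circ> P'"
  shows "full_path (P +++ Q)" "full_class P \<otimes>\<^bsub>B2\<^esub> full_class P' = full_class (P +++ Q)"
proof -
  have "braid_cover (pathfinish Q) = braid_cover (pathfinish P')"
    using fun_cong[OF assms(4), of 1] by (simp add: pathfinish_def)
  then show "full_path (P +++ Q)"
    using cover_path_join(1)[of base P Q] assms(1-3) by (simp add: full_path_def)
  have "loop_join (braid_cover \<circ> P) (braid_cover \<circ> P') = braid_cover \<circ> (P +++ Q)"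
    unfolding assms(4)[symmetric] by (rule loop_join_compose)
  then show "full_class P \<otimes>\<^bsub>B2\<^esub> full_class P' = full_class (P +++ Q)"
    unfolding full_class_def full_braid_group_def
    by (simp only: loop_class_mult full_loop assms(1,2))
qed

section \<open>The half-twist as a lifted path\<close>

definition twist_path :: "real \<Rightarrow> complex \<times> complex" where
  "twist_path t = (c + cis (- pi * t) * v, 2 * cis (- pi * t) * v)"

definition base_log :: complex where
  "base_log = Ln (2 * v)"

lemma exp_base_log: "exp base_log = 2 * v"
  using v_pos by (simp add: base_log_def)

lemma Re_base_log: "Re base_log < 0"
proof -
  have "norm (exp base_log) < 1" using v_small by (simp add: exp_base_log norm_mult)
  then show ?thesis by simp
qed

text \<open>The difference of the two rotating points makes a half turn about the puncture 0, which
  reduces the word of the half-twist to that of a polar path.\<close>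

lemma snd_twist_path: "snd \<circ> twist_path = polar_path base_log (base_log - \<i> * pi)"
proof
  fix t :: real
  have "linepath base_log (base_log - \<i> * pi) t = base_log + \<i> * (- pi * t)"
    by (simp add: linepath_def algebra_simps complex_eq_iff)
  then have "polar_path base_log (base_log - \<i> * pi) t = 2 * v * cis (- pi * t)"
    unfolding polar_path_def o_apply by (simp only: exp_add exp_base_log cis_conv_exp of_real_mult of_real_minus)
  then show "(snd \<circ> twist_path) t = polar_path base_log (base_log - \<i> * pi) t"
    by (simp add: twist_path_def)
qed

lemma twist_path_full: "full_path twist_path" "pathfinish twist_path = flip base"
proof -
  have "cis (- pi) = - 1" by (simp add: complex_eq_iff)
  then have ends: "pathstart twist_path = base" "pathfinish twist_path = flip base"
    by (simp_all add: pathstart_def pathfinish_def twist_path_def base_def flip_def)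
  show "pathfinish twist_path = flip base" by fact
  have "path twist_path" unfolding path_def twist_path_def by (intro continuous_intros)
  moreover have "path_image twist_path \<subseteq> cover_pts"
  proof -
    show ?thesis
      unfolding path_image_cover_iff snd_twist_path using polar_path_subset[OF Re_base_log] Re_base_log by simp
  qed
  ultimately show "full_path twist_path"
    using ends by (simp add: full_path_def cover_path_def braid_cover_flip) (simp add: braid_cover_def pair_cover_base)
qed

lemma sigma_eq: "sigma = full_class twist_path"
proof -
  have "(\<lambda>t. unordered (tc (c + cis (- pi * t) * v), tc (c - cis (- pi * t) * v))) = braid_cover \<circ> twist_path"
    by (simp add: fun_eq_iff braid_cover_def pair_cover_def twist_path_def algebra_simps)
  then show ?thesis by (simp add: sigma_def full_class_def)
qed

text \<open>Transport from the base difference to the reference point. Conjugation by it gives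
  braids the same coordinates wherever \<open>2 * v\<close> lies.\<close>

definition conjugator :: "(xy \<times> bool) list" where
  "conjugator = hol (polar_path base_log ref_log)"

lemma conjugator_closed [simp]: "conjugator \<in> carrier F_xy"
  by (simp add: conjugator_def)

lemma hol_twist_path:
  "hol (snd \<circ> twist_path) = conjugator \<cdot> twist_word \<cdot>
     inv\<^bsub>F_xy\<^esub> (map letter_inv conjugator) \<cdot> edge_corr (2 * v)"
  unfolding snd_twist_path conjugator_def hol_half_turn[OF Re_base_log] exp_base_log ..

text \<open>The lifts of the braid with coordinates \<open>(f, Re k, Im k)\<close>.  The sign of \<open>k\<close> makes
  conjugation by \<open>\<sigma>\<close> add the exponent sums of \<open>f\<close> to \<open>k\<close>.\<close>

definition param :: "(xy \<times> bool) list \<Rightarrow> complex \<Rightarrow> (real \<Rightarrow> complex \<times> complex) \<Rightarrow> bool" where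
  "param f k P \<longleftrightarrow> cover_path base P \<and> hol (snd \<circ> P) = conjugator \<cdot> f \<cdot> inv\<^bsub>F_xy\<^esub> conjugator \<and>
     pathfinish P = base + (- k, word_shift f)"

lemma param_pure: "param f k P \<Longrightarrow> k \<in> grid \<Longrightarrow> pure_path P"
  by (simp add: param_def pure_path_def)

lemma ex_param:
  assumes "f \<in> carrier F_xy"
  obtains P where "param f k P"
proof -
  let ?w = "conjugator \<cdot> f \<cdot> inv\<^bsub>F_xy\<^esub> conjugator"
  have w: "?w \<in> carrier F_xy" using assms by simp
  have "word_shift ?w = word_shift f" by (simp add: word_shift_mult word_shift_inv)
  then obtain p where p: "path p" "path_image p \<subseteq> - grid" "pathstart p = snd base"
    "pathfinish p = snd base + word_shift f" "hol p = ?w"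
    using ex_path_hol[OF _ w, of "snd base"] base_in by (metis ComplD mem_Times_iff)
  let ?P = "\<lambda>t. (linepath (fst base) (fst base - k) t, p t)"
  have "snd \<circ> ?P = p" by (simp add: fun_eq_iff)
  moreover have "path ?P" using p(1) unfolding path_def by (intro continuous_intros)
  moreover have "path_image ?P \<subseteq> cover_pts" using p(2) by (auto simp: path_image_def)
  moreover have "pathstart ?P = base" "pathfinish ?P = base + (- k, word_shift f)"
    using p(3,4) by (simp_all add: pathstart_def pathfinish_def linepath_0' linepath_1' prod_eq_iff)
  ultimately have "param f k ?P" using p(5) by (simp add: param_def cover_path_def)
  then show thesis by (rule that)
qed

text \<open>Only the first displacement is a free coordinate. The second is forced by the word
  through \<open>word_shift_hol_loop\<close>.\<close>

lemma pure_path_param: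
  assumes "pure_path P"
  obtains f k where "f \<in> carrier F_xy" "k \<in> grid" "param f k P"
proof -
  define f where "f = inv\<^bsub>F_xy\<^esub> conjugator \<cdot> hol (snd \<circ> P) \<cdot> conjugator"
  have f: "f \<in> carrier F_xy" by (simp add: f_def)
  have P: "cover_path base P" "pathfinish P - base \<in> deck"
    using assms by (simp_all add: pure_path_def)
  note D = cover_pathD[OF P(1)]
  have "conjugator \<cdot> (inv\<^bsub>F_xy\<^esub> conjugator \<cdot> w) = w" if "w \<in> carrier F_xy" for w
    using that by (simp flip: F.m_assoc)
  then have "conjugator \<cdot> f \<cdot> inv\<^bsub>F_xy\<^esub> conjugator = hol (snd \<circ> P)" by (simp add: f_def F.m_assoc)
  moreover have "word_shift f = word_shift (hol (snd \<circ> P))"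
    by (simp add: f_def word_shift_mult word_shift_inv)
  moreover have "word_shift (hol (snd \<circ> P)) = snd (pathfinish P - base)"
    using word_shift_hol_loop[OF D(5,6)] P(2) D(3)
    by (simp add: pathstart_compose pathfinish_compose mem_Times_iff)
  ultimately have "param f (- fst (pathfinish P - base)) P"
    using P(1) by (simp add: param_def prod_eq_iff)
  moreover have "- fst (pathfinish P - base) \<in> grid"
    unfolding grid_minus_iff using P(2) by (simp only: mem_Times_iff)
  ultimately show thesis using that f by blast
qed

text \<open>The inner conjugators cancel and the displacements add, which makes the parametrization
  a homomorphism.\<close>

lemma param_join:
  assumes P: "param f k P" "k \<in> grid" "f \<in> carrier F_xy" and P': "param f' k' P'" "k' \<in> grid" "f' \<in> carrier F_xy"
  obtains Q where "param (f \<cdot> f') (k + k') Q" "pure_class P \<otimes>\<^bsub>P2\<^esub> pure_class P' = pure_class Q"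
proof -
  note pp = param_pure[OF P(1,2)] param_pure[OF P'(1,2)]
  let ?Q = "P +++ translate (pathfinish P - base) P'"
  note J = pure_path_join[OF pp]
  have "inv\<^bsub>F_xy\<^esub> conjugator \<cdot> (conjugator \<cdot> w) = w" if "w \<in> carrier F_xy" for w
    using that by (simp flip: F.m_assoc)
  then have "hol (snd \<circ> ?Q) = conjugator \<cdot> (f \<cdot> f') \<cdot> inv\<^bsub>F_xy\<^esub> conjugator"
    unfolding J(3) using P P' by (simp add: param_def F.m_assoc)
  moreover have "pathfinish ?Q = base + (- (k + k'), word_shift (f \<cdot> f'))"
    using P(1) P'(1) by (simp only: J(4)) (simp add: param_def word_shift_mult prod_eq_iff)
  ultimately have "param (f \<cdot> f') (k + k') ?Q" using J(1) by (simp add: param_def pure_path_def)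
  then show thesis using J(2) by (rule that)
qed

lemma param_eq_iff:
  assumes "param f k P" "param f' k' P'" "k \<in> grid" "k' \<in> grid" "f \<in> carrier F_xy" "f' \<in> carrier F_xy"
  shows "pure_class P = pure_class P' \<longleftrightarrow> f = f' \<and> k = k'"
proof -
  have "conjugator \<cdot> f \<cdot> inv\<^bsub>F_xy\<^esub> conjugator = conjugator \<cdot> f' \<cdot> inv\<^bsub>F_xy\<^esub> conjugator \<longleftrightarrow> f = f'"
    using assms(5,6) by (simp add: F.m_assoc)
  then show ?thesis using assms by (subst pure_class_eq_iff) (auto simp: param_pure param_def)
qed

text \<open>Both sides are represented by paths with the same end point and the same holonomy.\<close>

lemma conj_sigma:
  assumes P: "param f k P" "k \<in> grid" "f \<in> carrier F_xy"
    and P': "param (twist_word \<cdot> map letter_inv f \<cdot> inv\<^bsub>F_xy\<^esub> twist_word) (k + word_shift f) P'"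
  shows "sigma \<otimes>\<^bsub>B2\<^esub> full_class P = full_class P' \<otimes>\<^bsub>B2\<^esub> sigma"
proof -
  let ?f' = "twist_word \<cdot> map letter_inv f \<cdot> inv\<^bsub>F_xy\<^esub> twist_word"
  let ?J = "map letter_inv" and ?K = "edge_corr (2 * v)"
  have "k + word_shift f \<in> grid" using P(2) by simp
  note pp = param_pure[OF P(1,2)] param_pure[OF P' this]
  note cp = pp[unfolded pure_path_def]
  have JF: "?J f \<in> carrier F_xy" "?J conjugator \<in> carrier F_xy"
    using P(3) by (simp_all only: J.hom_closed conjugator_closed)
  have ws: "word_shift ?f' = - word_shift f"
    using JF(1) by (simp add: word_shift_mult word_shift_inv word_shift_map_letter_inv)
  have cover_flip: "braid_cover \<circ> (flip \<circ> P) = braid_cover \<circ> P"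
    by (simp add: fun_eq_iff braid_cover_flip)
  have c1: "cover_path (pathfinish twist_path) (flip \<circ> P)"
    using cover_path_flip(1)[of base P] cp(1) by (simp add: twist_path_full)
  note m1 = full_class_mult[OF twist_path_full(1) pure_imp_full[OF pp(1)] c1 cover_flip]
  let ?d = "pathfinish P' - base"
  have tw: "cover_path base twist_path" using twist_path_full(1) by (simp add: full_path_def)
  have c2: "cover_path (pathfinish P') (translate ?d twist_path)"
    using cover_path_translate(1)[OF tw, of ?d] cp(2) by simp
  have "braid_cover \<circ> translate ?d twist_path = braid_cover \<circ> twist_path"
    using pair_cover_translate[of ?d twist_path] cp(2) by (simp add: braid_cover_def comp_assoc)
  note m2 = full_class_mult[OF pure_imp_full[OF pp(2)] twist_path_full(1) c2 this]
  \<comment> \<open>\<open>flip\<close> subtracts the second coordinate from the first, so the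
    displacement \<open>word_shift f\<close> enters the first coordinate; \<open>P'\<close> accounts
    for it by \<open>k + word_shift f\<close>.\<close>
  have ends: "pathfinish (twist_path +++ (flip \<circ> P)) = pathfinish (P' +++ translate ?d twist_path)"
    using P(1) P' by (simp add: cover_path_flip(2) cp param_def twist_path_full flip_def ws prod_eq_iff)
      (simp add: pathfinish_compose flip_def)
  have neg: "hol (snd \<circ> (flip \<circ> P)) = inv\<^bsub>F_xy\<^esub> ?K \<cdot>
      ?J (conjugator \<cdot> f \<cdot> inv\<^bsub>F_xy\<^esub> conjugator) \<cdot> ?K"
  proof -
    have "cover_path base P" using cp(1) by simp
    note D = cover_pathD[OF this]
    \<comment> \<open>The two ends differ by a grid vector and hence carry the same
      correction.\<close>
    have "edge_corr (pathfinish (snd \<circ> P)) = ?K" "edge_corr (pathstart (snd \<circ> P)) = ?K"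
      using P(1) D(3) edge_corr_translate[of "word_shift f" "2 * v"]
      by (simp_all add: pathstart_compose pathfinish_compose param_def base_def)
    then show ?thesis
      using hol_uminus[OF D(5,6)] P(1) cover_path_flip(3)[OF \<open>cover_path base P\<close>] by (simp add: param_def)
  qed
  have cancel: "inv\<^bsub>F_xy\<^esub> u \<cdot> (u \<cdot> w) = w" "u \<cdot> (inv\<^bsub>F_xy\<^esub> u \<cdot> w) = w"
    if "u \<in> carrier F_xy" "w \<in> carrier F_xy" for u w
    using that by (simp_all flip: F.m_assoc)
  have "hol (snd \<circ> (twist_path +++ (flip \<circ> P))) = hol (snd \<circ> twist_path) \<cdot> hol (snd \<circ> (flip \<circ> P))"
    by (rule cover_path_join(2)[OF tw c1])
  \<comment> \<open>The correction that ends the twist meets the inverse one that starts the flipped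
    path, and so do the sign-changed conjugators. The factors left at the end recombine to the word
    of the twist.\<close>
  also have "\<dots> = conjugator \<cdot> ?f' \<cdot> inv\<^bsub>F_xy\<^esub> conjugator \<cdot> hol (snd \<circ> twist_path)"
    unfolding neg hol_twist_path J.hom_mult[OF F.m_closed[OF conjugator_closed P(3)] F.inv_closed[OF conjugator_closed]]
      J.hom_mult[OF conjugator_closed P(3)] J.hom_inv[OF conjugator_closed]
    by (simp only: F.m_assoc F.m_closed F.inv_closed conjugator_closed twist_word_closed edge_corr_closed JF cancel)
  also have "\<dots> = hol (snd \<circ> P') \<cdot> hol (snd \<circ> translate ?d twist_path)"
    using P' cover_path_translate(2)[OF tw, of ?d] cp(2) by (simp add: param_def)
  also have "\<dots> = hol (snd \<circ> (P' +++ translate ?d twist_path))"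
    by (rule cover_path_join(2)[OF conjunct1[OF cp(2)] c2, symmetric])
  finally show ?thesis
    unfolding sigma_eq m1(2) m2(2) full_class_eq_iff[OF m1(1) m2(1)] using ends by simp
qed

text \<open>The second twist is lifted as the flip of the first, so the difference completes a full
  turn, and the lift returns to \<open>base\<close> because \<open>flip\<close> is an
  involution.\<close>

lemma sigma_square:
  assumes "param (commutator F_xy (free_gen Gx) (inv\<^bsub>F_xy\<^esub> (free_gen Gy))) 0 P"
  shows "sigma \<otimes>\<^bsub>B2\<^esub> sigma = full_class P"
proof -
  have tw: "cover_path base twist_path" using twist_path_full(1) by (simp add: full_path_def)
  have c: "cover_path (pathfinish twist_path) (flip \<circ> twist_path)"
    using cover_path_flip(1)[OF tw] by (simp add: twist_path_full)
  have "braid_cover \<circ> (flip \<circ> twist_path) = braid_cover \<circ> twist_path"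
    by (simp add: fun_eq_iff braid_cover_flip)
  note m = full_class_mult[OF twist_path_full(1) twist_path_full(1) c this]
  have "hol (snd \<circ> (twist_path +++ (flip \<circ> twist_path))) = hol (snd \<circ> P)"
    using cover_path_join(2)[OF tw c] hol_full_turn[OF Re_base_log] assms cover_path_flip(3)[OF tw]
    by (simp add: param_def full_twist_word snd_twist_path conjugator_def)
  moreover have "word_shift (commutator F_xy (free_gen Gx) (inv\<^bsub>F_xy\<^esub> (free_gen Gy))) = 0"
    by (simp add: commutator_def word_shift_mult word_shift_inv)
  then have "pathfinish (twist_path +++ (flip \<circ> twist_path)) = pathfinish P"
    using assms by (simp add: cover_path_flip(2)[OF tw] twist_path_full param_def flip_def base_def)
  moreover have "pure_path P" using assms by (rule param_pure) simp
  ultimately show ?thesis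
    unfolding sigma_eq m(2) using full_class_eq_iff[OF m(1) pure_imp_full] by blast
qed

section \<open>The half-twist and the cosets of the pure braids\<close>

lemma sigma_carrier: "sigma \<in> carrier B2"
  unfolding sigma_eq by (intro full_class_carrier twist_path_full)

text \<open>The end point of a lift depends only on the class, and the lift of the half-twist ends
  over the swapped base pair.\<close>

lemma sigma_not_pure: "sigma \<notin> incl ` carrier P2"
proof
  assume "sigma \<in> incl ` carrier P2"
  then obtain A where A: "A \<in> carrier P2" "sigma = incl A" by blast
  then obtain P where P: "pure_path P" "A = pure_class P" using pure_class_surj by metis
  then have "full_class twist_path = full_class P"
    using A(2) by (simp add: sigma_eq incl_pure_class)
  then have "pathfinish P = flip base"
    using full_class_eq_iff[OF twist_path_full(1) pure_imp_full[OF P(1)]] twist_path_full(2) by simp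
  then have "swap_pair y0 = y0"
    using P(1) by (simp add: pure_path_iff pair_cover_flip pair_cover_base)
  then show False using swap_pair_neq[OF y0_in] by simp
qed

lemma full_path_cases:
  assumes "full_path P"
  shows "full_class P \<in> incl ` carrier P2 \<or> full_class P \<otimes>\<^bsub>B2\<^esub> sigma \<in> incl ` carrier P2"
proof -
  have P: "cover_path base P" "unordered (pair_cover (pathfinish P)) = unordered y0"
    using assms by (simp_all add: full_path_def braid_cover_def)
  then consider "y0 = pair_cover (pathfinish P)" | "y0 = swap_pair (pair_cover (pathfinish P))"
    unfolding unordered_eq_iff by blast
  then show ?thesis
  proof cases
    case 1
    then have "pure_path P" using P(1) by (simp add: pure_path_iff)
    then show ?thesis using incl_pure_class pure_class_carrier by (metis imageI)
  next
    case 2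
    \<comment> \<open>The deck element for which \<open>flip (base + d)\<close> is the end of
      \<open>P\<close>, so that the flipped translate of the twist can be appended.\<close>
    define d where "d = flip (pathfinish P) - base"
    have "pair_cover (flip (pathfinish P)) = pair_cover base"
      using 2 by (simp add: pair_cover_flip pair_cover_base)
    then have d: "d \<in> deck" by (simp add: d_def pair_cover_eq_iff mem_Times_iff)
    have tw: "cover_path base twist_path" using twist_path_full(1) by (simp add: full_path_def)
    let ?Q = "flip \<circ> translate d twist_path"
    have ff: "flip (flip s) = s" for s by (simp add: flip_def)
    have "cover_path (flip (base + d)) ?Q"
      by (intro cover_path_flip(1) cover_path_translate(1) tw d)
    then have c: "cover_path (pathfinish P) ?Q" by (simp add: d_def ff)
    have "braid_cover \<circ> ?Q = braid_cover \<circ> translate d twist_path"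
      by (simp add: fun_eq_iff braid_cover_flip)
    also have "\<dots> = braid_cover \<circ> twist_path"
      using pair_cover_translate[OF d, of twist_path] by (simp add: braid_cover_def comp_assoc)
    finally have "braid_cover \<circ> ?Q = braid_cover \<circ> twist_path" .
    note m = full_class_mult[OF assms twist_path_full(1) c this]
    have "pair_cover (pathfinish ?Q) = y0"
    proof -
      have "pathfinish ?Q = flip (flip base + d)" by (simp add: pathfinish_compose twist_path_full)
      moreover have "pair_cover (flip base + d) = pair_cover (flip base)"
        using d by (simp add: pair_cover_eq_iff mem_Times_iff)
      ultimately show ?thesis by (simp add: pair_cover_flip pair_cover_base)
    qed
    then have "pure_path (P +++ ?Q)" using m(1) by (simp add: pure_path_iff full_path_def)
    then have "full_class P \<otimes>\<^bsub>B2\<^esub> sigma = incl (pure_class (P +++ ?Q))" "pure_class (P +++ ?Q) \<in> carrier P2"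
      using m(2) by (simp_all add: sigma_eq incl_pure_class pure_class_carrier)
    then show ?thesis by blast
  qed
qed

end

section \<open>The isomorphism onto the pure braid group\<close>

lemma Complex_int_grid [simp]: "Complex (of_int m) (of_int n) \<in> grid"
  by (simp add: grid_def)

lemma grid_obtain_ints:
  assumes "k \<in> grid" obtains m n :: int where "k = Complex m n"
  using assms by (auto simp: grid_def complex_eq_iff elim!: Ints_cases)

context torus_half_twist
begin

text \<open>The representing path is an arbitrary choice; by \<open>param_eq_iff\<close> its class
  depends on the coordinates alone.\<close>

definition Phi :: "(xy \<times> bool) list \<times> int \<times> int \<Rightarrow> (real \<Rightarrow> point \<times> point) set" where
  "Phi t = pure_class (SOME P. param (fst t) (Complex (fst (snd t)) (snd (snd t))) P)"

lemma Phi_eq: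
  assumes "param f (Complex m n) P" "f \<in> carrier F_xy"
  shows "Phi (f, m, n) = pure_class P"
proof -
  define Q where "Q = (SOME P. param f (Complex m n) P)"
  have "param f (Complex m n) Q"
    unfolding Q_def by (rule someI[where P = "param f (Complex m n)", OF assms(1)])
  then have "pure_class Q = pure_class P"
    using param_eq_iff[of f "Complex m n" Q f "Complex m n" P] assms by simp
  then show ?thesis by (simp add: Phi_def Q_def)
qed

lemma Phi_carrier: "f \<in> carrier F_xy \<Longrightarrow> Phi (f, m, n) \<in> carrier P2"
  using ex_param[of f "Complex m n"] Phi_eq param_pure pure_class_carrier by (metis Complex_int_grid)

lemma Phi_surj:
  assumes "A \<in> carrier P2"
  obtains f m n P where "f \<in> carrier F_xy" "param f (Complex (of_int m) (of_int n)) P" "A = pure_class P" "A = Phi (f, m, n)"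
proof -
  obtain P where P: "pure_path P" "A = pure_class P" using pure_class_surj[OF assms] .
  obtain f k where f: "f \<in> carrier F_xy" "k \<in> grid" "param f k P" using pure_path_param[OF P(1)] .
  obtain m n where k: "k = Complex (of_int m) (of_int n)" using grid_obtain_ints[OF f(2)] .
  have "A = Phi (f, m, n)" using Phi_eq[of f m n P] f k P(2) by simp
  with that[of f m n P] f k P(2) show thesis by simp
qed

lemma Phi_mult:
  assumes "f \<in> carrier F_xy" "f' \<in> carrier F_xy"
  shows "Phi (f \<cdot> f', m + m', n + n') = Phi (f, m, n) \<otimes>\<^bsub>P2\<^esub> Phi (f', m', n')"
proof -
  obtain P where P: "param f (Complex m n) P" using ex_param[OF assms(1)] .
  obtain P' where P': "param f' (Complex m' n') P'" using ex_param[OF assms(2)] .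
  obtain Q where Q: "param (f \<cdot> f') (Complex m n + Complex m' n') Q"
    "pure_class P \<otimes>\<^bsub>P2\<^esub> pure_class P' = pure_class Q"
    by (rule param_join[OF P _ assms(1) P' _ assms(2)]) simp_all
  have "Complex m n + Complex m' n' = Complex (of_int (m + m')) (of_int (n + n'))"
    by (simp add: complex_eq_iff)
  then have "Phi (f \<cdot> f', m + m', n + n') = pure_class Q"
    using Q(1) assms by (intro Phi_eq) simp_all
  then show ?thesis using Phi_eq[OF P assms(1)] Phi_eq[OF P' assms(2)] Q(2) by simp
qed

lemma Phi_inj:
  assumes "f \<in> carrier F_xy" "f' \<in> carrier F_xy" "Phi (f, m, n) = Phi (f', m', n')"
  shows "f = f'" "m = m'" "n = n'"
proof -
  obtain P where P: "param f (Complex m n) P" using ex_param[OF assms(1)] .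
  obtain P' where P': "param f' (Complex m' n') P'" using ex_param[OF assms(2)] .
  have "pure_class P = pure_class P'" using assms Phi_eq[OF P] Phi_eq[OF P'] by simp
  then have "f = f' \<and> Complex m n = Complex m' n'" using param_eq_iff[OF P P'] assms by simp
  then show "f = f'" "m = m'" "n = n'" by simp_all
qed

lemma Phi_iso: "Phi \<in> iso (F_xy \<times>\<times> Z2) P2"
proof (rule isoI)
  show "Phi \<in> hom (F_xy \<times>\<times> Z2) P2" by (rule homI) (auto simp: DirProd_def Phi_carrier Phi_mult)
  show "bij_betw Phi (carrier (F_xy \<times>\<times> Z2)) (carrier P2)"
  proof (rule bij_betw_imageI)
    show "inj_on Phi (carrier (F_xy \<times>\<times> Z2))"
      by (rule inj_onI) (auto simp: DirProd_def dest: Phi_inj)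
    show "Phi ` carrier (F_xy \<times>\<times> Z2) = carrier P2"
    proof (intro equalityI subsetI)
      fix A assume "A \<in> carrier P2"
      then obtain f m n P where "f \<in> carrier F_xy" "A = Phi (f, m, n)" by (rule Phi_surj)
      then show "A \<in> Phi ` carrier (F_xy \<times>\<times> Z2)"
        by (intro image_eqI[of _ _ "(f, m, n)"]) (simp_all add: DirProd_def)
    qed (auto simp: DirProd_def Phi_carrier)
  qed
qed

subsection \<open>The projection to the torus\<close>

text \<open>The segment is taken in the negative direction to match the sign in
  \<open>param\<close>, so that the projection to the first point carries no sign.\<close>

definition torus_class :: "int \<times> int \<Rightarrow> (real \<Rightarrow> point) set" where
  "torus_class t = loop_class torus (fst y0)
     (tc \<circ> linepath (fst base) (fst base - Complex (fst t) (snd t)))"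

lemma tc_base: "tc (fst base) = fst y0"
  by (simp add: base_def y0_def)

lemma torus_class_eq_iff:
  assumes "path p" "pathstart p = fst base" "pathfinish p - fst base \<in> grid"
    "path q" "pathstart q = fst base" "pathfinish q - fst base \<in> grid"
  shows "loop_class torus (fst y0) (tc \<circ> p) = loop_class torus (fst y0) (tc \<circ> q) \<longleftrightarrow> pathfinish p = pathfinish q"
proof -
  have ends: "tc (pathfinish p) = fst y0" "tc (pathfinish q) = fst y0"
    using assms(3,6) unfolding tc_base[symmetric] tc_eq_iff by simp_all
  have "homotopic_paths UNIV p q \<longleftrightarrow> pathfinish p = pathfinish q"
    using homotopic_paths_imp_pathfinish homotopic_paths_convex[of UNIV p q] assms by auto
  then show ?thesis
    by (subst T.loop_class_eq_iff_homotopic_paths) (use assms ends in \<open>simp_all add: tc_base\<close>)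
qed

lemma tc_loop:
  assumes "path p" "pathstart p = fst base" "pathfinish p - fst base \<in> grid"
  shows "tc \<circ> p \<in> loops_at torus (fst y0)"
  by (rule T.compose_in_loops)
    (use assms in \<open>simp_all add: tc_base tc_eq_iff flip: tc_base\<close>)

lemma torus_class_eqI:
  assumes "path p" "pathstart p = fst base" "pathfinish p = fst base - Complex m n"
  shows "loop_class torus (fst y0) (tc \<circ> p) = torus_class (m, n)"
  unfolding torus_class_def by (subst torus_class_eq_iff) (use assms in simp_all)

lemma torus_class_iso: "torus_class \<in> iso Z2 (fundamental_group torus (fst y0))"
proof (rule isoI)
  let ?l = "\<lambda>t. linepath (fst base) (fst base - Complex (of_int (fst t)) (of_int (snd t)))"
  have loop: "tc \<circ> ?l t \<in> loops_at torus (fst y0)" for t :: "int \<times> int" by (rule tc_loop) simp_all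
  show "torus_class \<in> hom Z2 (fundamental_group torus (fst y0))"
  proof (rule homI)
    show "torus_class t \<in> carrier (fundamental_group torus (fst y0))" for t
      unfolding torus_class_def by (intro loop_class_carrier loop)
    fix t u :: "int \<times> int"
    define q where "q = (\<lambda>s. ?l u s - Complex (fst t) (snd t))"
    have q: "path q" "pathstart q = pathfinish (?l t)"
      "pathfinish q = fst base - Complex (of_int (fst t + fst u)) (of_int (snd t + snd u))"
      by (simp_all add: q_def path_def pathstart_def pathfinish_def linepath_0' linepath_1' complex_eq_iff continuous_intros)
    have "tc \<circ> q = tc \<circ> ?l u" by (simp add: fun_eq_iff q_def tc_eq_iff)
    then have "loop_join (tc \<circ> ?l t) (tc \<circ> ?l u) = tc \<circ> (?l t +++ q)" by (metis loop_join_compose)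
    then have "torus_class t \<otimes>\<^bsub>fundamental_group torus (fst y0)\<^esub> torus_class u =
        loop_class torus (fst y0) (tc \<circ> (?l t +++ q))"
      unfolding torus_class_def by (simp only: loop_class_mult loop)
    also have "\<dots> = torus_class (fst t + fst u, snd t + snd u)"
      by (rule torus_class_eqI) (use q in simp_all)
    finally show "torus_class (t \<otimes>\<^bsub>Z2\<^esub> u) = torus_class t \<otimes>\<^bsub>fundamental_group torus (fst y0)\<^esub> torus_class u"
      by (simp add: DirProd_def case_prod_beta)
  qed
  show "bij_betw torus_class (carrier Z2) (carrier (fundamental_group torus (fst y0)))"
  proof (rule bij_betw_imageI)
    show "inj_on torus_class (carrier Z2)"
    proof (rule inj_onI)
      fix t u :: "int \<times> int" assume "torus_class t = torus_class u"
      then have "pathfinish (?l t) = pathfinish (?l u)"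
        unfolding torus_class_def by (subst (asm) torus_class_eq_iff) simp_all
      then show "t = u" by (simp add: prod_eq_iff)
    qed
    show "torus_class ` carrier Z2 = carrier (fundamental_group torus (fst y0))"
    proof (intro equalityI subsetI)
      fix A assume "A \<in> carrier (fundamental_group torus (fst y0))"
      then have "A \<in> carrier (fundamental_group torus (tc (fst base)))" by (simp add: tc_base)
      then obtain p where p: "path p" "pathstart p = fst base" "tc (pathfinish p) = tc (fst base)"
        "A = loop_class torus (tc (fst base)) (tc \<circ> p)"
        by (rule T.ex_lift_of_class[OF _ UNIV_I])
      have "- (pathfinish p - fst base) \<in> grid" using p(3) unfolding tc_eq_iff grid_minus_iff .
      then obtain m n where "- (pathfinish p - fst base) = Complex (of_int m) (of_int n)"
        by (rule grid_obtain_ints)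
      then have "pathfinish p = fst base - Complex (of_int m) (of_int n)"
        by (simp add: algebra_simps)
      then have "A = torus_class (m, n)"
        using torus_class_eqI[OF p(1,2)] p(4) by (simp add: tc_base)
      then show "A \<in> torus_class ` carrier Z2" by (simp add: DirProd_def)
    next
      fix A assume "A \<in> torus_class ` carrier Z2"
      then show "A \<in> carrier (fundamental_group torus (fst y0))"
        unfolding torus_class_def by (auto intro: loop_class_carrier loop)
    qed
  qed
qed

lemma continuous_fst_F2: "continuous_map F2_torus torus fst"
  unfolding F2_torus_eq torus_eq
  by (auto simp: continuous_map_in_subtopology config_pts_def intro!: continuous_intros)

lemma p1_Phi:
  assumes "f \<in> carrier F_xy"
  shows "p1_hom y0 (Phi (f, m, n)) = torus_class (m, n)"
proof -
  obtain P where P: "param f (Complex m n) P" using ex_param[OF assms] .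
  have pP: "pure_path P" using param_pure[OF P] by simp
  have "p1_hom y0 (Phi (f, m, n)) = loop_class torus (fst y0) (fst \<circ> (pair_cover \<circ> P))"
    unfolding Phi_eq[OF P assms] pure_class_def p1_hom_def
    by (rule induced_hom_loop_class[OF continuous_fst_F2 pure_loop[OF pP]])
  also have "fst \<circ> (pair_cover \<circ> P) = tc \<circ> (fst \<circ> P)" by (simp add: fun_eq_iff pair_cover_def)
  also have "loop_class torus (fst y0) (tc \<circ> (fst \<circ> P)) = torus_class (m, n)"
  proof (rule torus_class_eqI)
    have "cover_path base P" using P by (simp add: param_def)
    then show "path (fst \<circ> P)" "pathstart (fst \<circ> P) = fst base"
      by (simp_all add: cover_pathD pathstart_compose)
    show "pathfinish (fst \<circ> P) = fst base - Complex m n"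
      using P by (simp add: param_def pathfinish_compose)
  qed
  finally show ?thesis .
qed

subsection \<open>Conjugation by the half-twist\<close>

sublocale incl: group_hom P2 B2 incl
  using incl_mon by unfold_locales (simp add: mon_def)

lemma incl_inj: "inj_on incl (carrier P2)"
  using incl_mon by (simp add: mon_def)

abbreviation l_sigma :: "(real \<Rightarrow> point \<times> point) set \<Rightarrow> (real \<Rightarrow> point \<times> point) set" where
  "l_sigma \<equiv> conj_on_pure y0 sigma"

text \<open>The floors merely read the Gaussian integer \<open>word_shift f\<close> as a pair of
  integers. The second claim shows that the conjugate lies in the image of \<open>incl\<close>,
  which gives meaning to the inverse of \<open>incl\<close> in \<open>l_sigma\<close>.\<close>

lemma
  fixes m n :: int
  assumes "f \<in> carrier F_xy"
  defines "g \<equiv> Phi (twist_word \<cdot> map letter_inv f \<cdot> inv\<^bsub>F_xy\<^esub> twist_word,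
     m + \<lfloor>Re (word_shift f)\<rfloor>, n + \<lfloor>Im (word_shift f)\<rfloor>)"
  shows l_sigma_Phi: "l_sigma (Phi (f, m, n)) = g"
    and conj_sigma_Phi: "sigma \<otimes>\<^bsub>B2\<^esub> incl (Phi (f, m, n)) \<otimes>\<^bsub>B2\<^esub> inv\<^bsub>B2\<^esub> sigma = incl g"
proof -
  let ?f' = "twist_word \<cdot> map letter_inv f \<cdot> inv\<^bsub>F_xy\<^esub> twist_word"
  let ?k = "Complex (of_int m) (of_int n)"
  have f': "?f' \<in> carrier F_xy"
    using assms(1) by (simp only: F.m_closed F.inv_closed J.hom_closed twist_word_closed)
  obtain i j where ij: "word_shift f = Complex (of_int i) (of_int j)"
    by (rule grid_obtain_ints[OF word_shift_in_grid])
  have k': "Complex (of_int (m + \<lfloor>Re (word_shift f)\<rfloor>)) (of_int (n + \<lfloor>Im (word_shift f)\<rfloor>)) = ?k + word_shift f"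
    by (simp add: ij complex_eq_iff)
  obtain P where P: "param f ?k P" using ex_param[OF assms(1)] .
  obtain P' where P': "param ?f' (?k + word_shift f) P'" using ex_param[OF f'] .
  have g: "g = pure_class P'" unfolding g_def by (rule Phi_eq) (use P' f' k' in simp_all)
  have pure: "pure_path P" "pure_path P'" using param_pure[OF P] param_pure[OF P'] by simp_all
  have gc: "g \<in> carrier P2" unfolding g by (rule pure_class_carrier[OF pure(2)])
  have Pc: "Phi (f, m, n) \<in> carrier P2" using assms(1) by (rule Phi_carrier)
  have "sigma \<otimes>\<^bsub>B2\<^esub> incl (Phi (f, m, n)) = incl g \<otimes>\<^bsub>B2\<^esub> sigma"
    unfolding Phi_eq[OF P assms(1)] g incl_pure_class[OF pure(1)] incl_pure_class[OF pure(2)]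
    by (rule conj_sigma[OF P _ assms(1) P']) simp
  then show conj: "sigma \<otimes>\<^bsub>B2\<^esub> incl (Phi (f, m, n)) \<otimes>\<^bsub>B2\<^esub> inv\<^bsub>B2\<^esub> sigma = incl g"
    using sigma_carrier incl.hom_closed[OF gc] by (simp add: B2.m_assoc)
  show "l_sigma (Phi (f, m, n)) = g"
    unfolding conj_on_pure_def conj by (rule the_inv_into_f_f[OF incl_inj gc])
qed

lemma
  assumes "A \<in> carrier P2"
  shows l_sigma_carrier: "l_sigma A \<in> carrier P2"
    and incl_l_sigma: "incl (l_sigma A) = sigma \<otimes>\<^bsub>B2\<^esub> incl A \<otimes>\<^bsub>B2\<^esub> inv\<^bsub>B2\<^esub> sigma"
proof -
  obtain f m n where f: "f \<in> carrier F_xy" "A = Phi (f, m, n)" using Phi_surj[OF assms] .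
  show "l_sigma A \<in> carrier P2" unfolding f(2) l_sigma_Phi[OF f(1)]
    by (rule Phi_carrier) (use f(1) in \<open>simp only: F.m_closed F.inv_closed J.hom_closed twist_word_closed\<close>)
  show "incl (l_sigma A) = sigma \<otimes>\<^bsub>B2\<^esub> incl A \<otimes>\<^bsub>B2\<^esub> inv\<^bsub>B2\<^esub> sigma"
    unfolding f(2) l_sigma_Phi[OF f(1)] conj_sigma_Phi[OF f(1)] ..
qed

lemma l_sigma_hom: "l_sigma \<in> hom P2 P2"
proof (rule homI)
  fix A B assume AB: "A \<in> carrier P2" "B \<in> carrier P2"
  have cancel: "inv\<^bsub>B2\<^esub> sigma \<otimes>\<^bsub>B2\<^esub> (sigma \<otimes>\<^bsub>B2\<^esub> w) = w" if "w \<in> carrier B2" for w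
    using that sigma_carrier by (simp flip: B2.m_assoc)
  have "incl (l_sigma (A \<otimes>\<^bsub>P2\<^esub> B)) = incl (l_sigma A \<otimes>\<^bsub>P2\<^esub> l_sigma B)"
    using AB sigma_carrier by (simp add: incl_l_sigma l_sigma_carrier B2.m_assoc cancel)
  then show "l_sigma (A \<otimes>\<^bsub>P2\<^esub> B) = l_sigma A \<otimes>\<^bsub>P2\<^esub> l_sigma B"
    using AB by (intro inj_onD[OF incl_inj]) (simp_all add: l_sigma_carrier)
qed (rule l_sigma_carrier)

lemma index_2: "card (rcosets\<^bsub>B2\<^esub> (incl ` carrier P2)) = 2"
proof -
  let ?H = "incl ` carrier P2"
  \<comment> \<open>The inverse arises because \<open>full_path_cases\<close> places
    \<open>b\<close> times \<open>sigma\<close> in the subgroup, that is, \<open>b\<close> in this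
    right coset.\<close>
  let ?C = "?H #>\<^bsub>B2\<^esub> inv\<^bsub>B2\<^esub> sigma"
  have H: "subgroup ?H B2" by (rule incl.img_is_subgroup)
  have inv: "inv\<^bsub>B2\<^esub> sigma \<in> carrier B2" using sigma_carrier by simp
  have coset: "?H #>\<^bsub>B2\<^esub> b = (if b \<in> ?H then ?H else ?C)" if b: "b \<in> carrier B2" for b
  proof (cases "b \<in> ?H")
    case True
    then show ?thesis using B2.coset_join2[OF b H] by simp
  next
    case False
    obtain P where P: "full_path P" "b = full_class P" using full_class_surj[OF b] .
    then have "b \<otimes>\<^bsub>B2\<^esub> sigma \<in> ?H" using full_path_cases[OF P(1)] False by simp
    moreover have "b = b \<otimes>\<^bsub>B2\<^esub> sigma \<otimes>\<^bsub>B2\<^esub> inv\<^bsub>B2\<^esub> sigma"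
      using b sigma_carrier by (simp add: B2.m_assoc)
    ultimately have "b \<in> ?C" unfolding r_coset_def by blast
    then have "?C = ?H #>\<^bsub>B2\<^esub> b" using inv H by (rule B2.repr_independence)
    with False show ?thesis by simp
  qed
  have "rcosets\<^bsub>B2\<^esub> ?H = {?H, ?C}"
  proof (intro equalityI subsetI)
    fix D assume "D \<in> rcosets\<^bsub>B2\<^esub> ?H"
    then obtain b where "b \<in> carrier B2" "D = ?H #>\<^bsub>B2\<^esub> b" by (auto simp: RCOSETS_def)
    then show "D \<in> {?H, ?C}" using coset[of b] by (cases "b \<in> ?H") simp_all
  next
    fix D assume "D \<in> {?H, ?C}"
    then have "D = ?H #>\<^bsub>B2\<^esub> \<one>\<^bsub>B2\<^esub> \<or> D = ?H #>\<^bsub>B2\<^esub> sigma"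
      using coset[OF B2.one_closed] coset[OF sigma_carrier] sigma_not_pure subgroup.one_closed[OF H] by auto
    then show "D \<in> rcosets\<^bsub>B2\<^esub> ?H" unfolding RCOSETS_def using sigma_carrier by auto
  qed
  moreover have "?H \<noteq> ?C"
  proof -
    have "sigma \<in> ?H #>\<^bsub>B2\<^esub> sigma" using sigma_carrier H by (rule B2.rcos_self)
    then show ?thesis using coset[OF sigma_carrier] sigma_not_pure by auto
  qed
  ultimately show ?thesis by simp
qed

text \<open>With A = x y^-1 and B = x y^-1 x^-1 y: A x^-1 A^-1 = x y^-1 x^-1 y x^-1 = B x^-1 and A
  y^-1 A^-1 = x y^-1 x^-1 = B y^-1.\<close>

lemma twist_word_conj:
  "twist_word \<cdot> map letter_inv (free_gen a) \<cdot> inv\<^bsub>F_xy\<^esub> twist_word =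
    commutator F_xy (free_gen Gx) (inv\<^bsub>F_xy\<^esub> (free_gen Gy)) \<cdot> inv\<^bsub>F_xy\<^esub> (free_gen a)"
proof -
  have J: "map letter_inv (free_gen a) = inv\<^bsub>F_xy\<^esub> (free_gen a)"
    by (simp add: free_gen_def inv_letter)
  have cancel: "u \<cdot> (inv\<^bsub>F_xy\<^esub> u \<cdot> w) = w" "inv\<^bsub>F_xy\<^esub> u \<cdot> (u \<cdot> w) = w"
    if "u \<in> carrier F_xy" "w \<in> carrier F_xy" for u w
    using that by (simp_all flip: F.m_assoc)
  show ?thesis unfolding J twist_word_def commutator_def
    by (cases a) (simp_all only: F.inv_mult_group F.inv_inv F.m_assoc F.m_closed F.inv_closed free_gen_carrier
        cancel F.r_inv F.l_inv F.r_one F.l_one F.one_closed)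
qed

theorem half_twist_action:
  defines "x \<equiv> free_gen Gx" and "y \<equiv> free_gen Gy"
  defines "B \<equiv> commutator F_xy x (inv\<^bsub>F_xy\<^esub> y)"
  shows "incl \<in> mon P2 B2 \<and> card (rcosets\<^bsub>B2\<^esub> (incl ` carrier P2)) = 2 \<and>
    l_sigma \<in> hom P2 P2 \<and>
    (\<forall>g \<in> carrier P2. incl (l_sigma g) = sigma \<otimes>\<^bsub>B2\<^esub> incl g \<otimes>\<^bsub>B2\<^esub> inv\<^bsub>B2\<^esub> sigma) \<and>
    (\<exists>\<Phi> \<theta>. \<Phi> \<in> iso (F_xy \<times>\<times> Z2) P2 \<and>
      \<theta> \<in> iso (fundamental_group torus (fst y0)) Z2 \<and>
      (\<forall>w \<in> carrier F_xy. \<forall>m n. \<theta> (p1_hom y0 (\<Phi> (w, m, n))) = (m, n)) \<and>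
      sigma \<in> carrier B2 - incl ` carrier P2 \<and>
      sigma \<otimes>\<^bsub>B2\<^esub> sigma = incl (\<Phi> (B, 0, 0)) \<and>
      l_sigma (\<Phi> (x, 0, 0)) = \<Phi> (B \<cdot> inv\<^bsub>F_xy\<^esub> x, 1, 0) \<and>
      l_sigma (\<Phi> (y, 0, 0)) = \<Phi> (B \<cdot> inv\<^bsub>F_xy\<^esub> y, 0, 1) \<and>
      l_sigma (\<Phi> (\<one>\<^bsub>F_xy\<^esub>, 1, 0)) = \<Phi> (\<one>\<^bsub>F_xy\<^esub>, 1, 0) \<and>
      l_sigma (\<Phi> (\<one>\<^bsub>F_xy\<^esub>, 0, 1)) = \<Phi> (\<one>\<^bsub>F_xy\<^esub>, 0, 1))"
proof (intro conjI exI ballI allI)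
  let ?\<theta> = "inv_into (carrier Z2) torus_class"
  show "?\<theta> \<in> iso (fundamental_group torus (fst y0)) Z2"
    using torus_class_iso by (intro group.iso_set_sym) (simp_all add: DirProd_group)
  show "?\<theta> (p1_hom y0 (Phi (w, m, n))) = (m, n)" if "w \<in> carrier F_xy" for w m n
    unfolding p1_Phi[OF that]
    by (rule inv_into_f_f) (use torus_class_iso in \<open>simp_all add: iso_def bij_betw_def DirProd_def\<close>)
  show "sigma \<in> carrier B2 - incl ` carrier P2" using sigma_carrier sigma_not_pure by blast
  have B: "B \<in> carrier F_xy"
    unfolding B_def x_def y_def commutator_def by (simp only: F.m_closed F.inv_closed free_gen_carrier)
  obtain P where P: "param B 0 P" using ex_param[OF B] .
  moreover have "Complex (of_int 0) (of_int 0) = 0" by (simp add: complex_eq_iff)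
  ultimately have "Phi (B, 0, 0) = pure_class P" using B by (intro Phi_eq) simp_all
  then show "sigma \<otimes>\<^bsub>B2\<^esub> sigma = incl (Phi (B, 0, 0))"
    using sigma_square[of P] P incl_pure_class[OF param_pure[OF P]] by (simp add: B_def x_def y_def)
  show "l_sigma (Phi (x, 0, 0)) = Phi (B \<cdot> inv\<^bsub>F_xy\<^esub> x, 1, 0)"
    unfolding x_def y_def B_def by (subst l_sigma_Phi) (simp_all only: twist_word_conj free_gen_carrier, simp)
  show "l_sigma (Phi (y, 0, 0)) = Phi (B \<cdot> inv\<^bsub>F_xy\<^esub> y, 0, 1)"
    unfolding x_def y_def B_def by (subst l_sigma_Phi) (simp_all only: twist_word_conj free_gen_carrier, simp)
  have one: "twist_word \<cdot> map letter_inv \<one>\<^bsub>F_xy\<^esub> \<cdot> inv\<^bsub>F_xy\<^esub> twist_word = \<one>\<^bsub>F_xy\<^esub>"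
    by (simp only: J.hom_one F.r_one F.r_inv twist_word_closed)
  show "l_sigma (Phi (\<one>\<^bsub>F_xy\<^esub>, 1, 0)) = Phi (\<one>\<^bsub>F_xy\<^esub>, 1, 0)"
    "l_sigma (Phi (\<one>\<^bsub>F_xy\<^esub>, 0, 1)) = Phi (\<one>\<^bsub>F_xy\<^esub>, 0, 1)"
    by (simp_all only: l_sigma_Phi[OF F.one_closed] one) simp_all
qed (use incl_mon index_2 l_sigma_hom incl_l_sigma Phi_iso in simp_all)

end

text \<open>A reflection conjugates a rotation into its inverse.\<close>

lemma exchange_rotate: "exchange True (cis t * z) = cis (- t) * exchange True z"
  by (simp add: exchange_def complex_eq_iff)

lemma exchange_add: "exchange b (z + w) = exchange b z + exchange b w"
  "exchange b (z - w) = exchange b z - exchange b w"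
  by (simp_all add: exchange_def complex_eq_iff)

text \<open>The opening conjuncts justify regarding the pure group as a subgroup of index 2 and
  conjugation as a map of it into itself; without them \<open>l\<^sub>\<sigma>\<close>, defined
  through an inverse of \<open>\<iota>\<close>, would say nothing. Both orientations of the
  half-twist are covered by \<open>d\<close>.\<close>

theorem theorem14:
  fixes c v :: complex and d :: real
  assumes "0 < norm v" "norm v < 1 / 2"
    and "d \<in> {1, -1}"
  defines "y0 \<equiv> twist_base c v"
  defines "P2 \<equiv> pure_braid_group y0"
  defines "B2 \<equiv> full_braid_group y0"
  defines "\<iota> \<equiv> braid_incl y0"
  defines "\<sigma> \<equiv> half_twist d c v"
  defines "l\<^sub>\<sigma> \<equiv> conj_on_pure y0 \<sigma>"
  defines "x \<equiv> free_gen Gx"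
  defines "y \<equiv> free_gen Gy"
  defines "B \<equiv> commutator F_xy x (inv\<^bsub>F_xy\<^esub> y)"
  shows "\<iota> \<in> mon P2 B2 \<and> card (rcosets\<^bsub>B2\<^esub> (\<iota> ` carrier P2)) = 2 \<and>
    l\<^sub>\<sigma> \<in> hom P2 P2 \<and>
    (\<forall>g \<in> carrier P2. \<iota> (l\<^sub>\<sigma> g) = \<sigma> \<otimes>\<^bsub>B2\<^esub> \<iota> g \<otimes>\<^bsub>B2\<^esub> inv\<^bsub>B2\<^esub> \<sigma>) \<and>
    (\<exists>\<Phi> \<theta>. \<Phi> \<in> iso (F_xy \<times>\<times> Z2) P2 \<and>
      \<theta> \<in> iso (fundamental_group torus (fst y0)) Z2 \<and>
      (\<forall>w \<in> carrier F_xy. \<forall>m n. \<theta> (p1_hom y0 (\<Phi> (w, m, n))) = (m, n)) \<and>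
      \<sigma> \<in> carrier B2 - \<iota> ` carrier P2 \<and>
      \<sigma> \<otimes>\<^bsub>B2\<^esub> \<sigma> = \<iota> (\<Phi> (B, 0, 0)) \<and>
      l\<^sub>\<sigma> (\<Phi> (x, 0, 0)) = \<Phi> (B \<otimes>\<^bsub>F_xy\<^esub> inv\<^bsub>F_xy\<^esub> x, 1, 0) \<and>
      l\<^sub>\<sigma> (\<Phi> (y, 0, 0)) = \<Phi> (B \<otimes>\<^bsub>F_xy\<^esub> inv\<^bsub>F_xy\<^esub> y, 0, 1) \<and>
      l\<^sub>\<sigma> (\<Phi> (\<one>\<^bsub>F_xy\<^esub>, 1, 0)) = \<Phi> (\<one>\<^bsub>F_xy\<^esub>, 1, 0) \<and>
      l\<^sub>\<sigma> (\<Phi> (\<one>\<^bsub>F_xy\<^esub>, 0, 1)) = \<Phi> (\<one>\<^bsub>F_xy\<^esub>, 0, 1))"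
proof -
  \<comment> \<open>The coordinates are reflected exactly for the counterclockwise twist. It then
    reads as a clockwise one, while the base pair and the braid itself are unchanged.\<close>
  define b where "b = (d = 1)"
  have norm: "norm (exchange b v) = norm v" by (simp add: exchange_def cmod_def add.commute)
  interpret tw: torus_half_twist "torus_cover \<circ> exchange b" "exchange b c" "exchange b v"
    using torus_covering_exchange[of b] assms(1,2) norm
    by (intro torus_half_twist.intro torus_half_twist_axioms.intro) simp_all
  have y0: "y0 = tw.y0" by (simp add: y0_def tw.y0_def twist_base_def flip: exchange_add)
  have "exchange b (cis (d * pi * t) * v) = cis (- pi * t) * exchange b v" for t
  proof (cases b)
    case True
    then have "d = 1" by (simp add: b_def)
    then show ?thesis using True exchange_rotate[of "pi * t" v] by simp
  next
    case False
    then have "d = - 1" using assms(3) by (simp add: b_def)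
    then show ?thesis using False by (simp add: exchange_def)
  qed
  then have "(torus_cover \<circ> exchange b) (exchange b c + cis (- pi * t) * exchange b v) = torus_cover (c + cis (d * pi * t) * v)"
    "(torus_cover \<circ> exchange b) (exchange b c - cis (- pi * t) * exchange b v) = torus_cover (c - cis (d * pi * t) * v)" for t
    by (metis o_apply exchange_add exchange_exchange)+
  then have "\<sigma> = tw.sigma"
    unfolding \<sigma>_def tw.sigma_def half_twist_def y0[symmetric] y0_def twist_base_def by simp
  then show ?thesis
    using tw.half_twist_action unfolding l\<^sub>\<sigma>_def \<iota>_def P2_def B2_def B_def x_def y_def y0 by simp
qed

end
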